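(* Let $(T_n)_{n\ge 1}$, $(V_n)_{n\ge1}$ be sequences in the $C^*$-algebra $\mathcal A=C(\Omega)\rtimes\mathbb Z^d$ of covariant local operator families, with $V_n=V_n^*$, $T_n$ invertible, and $\Lambda=\sup_{n\ge 1}\{\|T_n\|,\|T_n^{-1}\|,\|V_n\|\}<\infty$. Let $U_N^E\in\mathcal A$ be the associated Prüfer phase. For every $E\in\mathbb R$ and $N\ge 2$, the phase velocity operator $$S_N^E=\frac{1}{\imath N}\,(U_N^E)^*\,\partial_E U_N^E\;\in\;\mathcal A$$ is positive semi-definite, and $$\int_{-\infty}^{\infty}dE\;\mathcal T(S_N^E)=2\pi .$$
   Context: Algebra. Let $\Omega$ be a compact space with a continuous action $\tau=(\tau_1,\dots,\tau_d)$ of $\mathbb Z^d$ and an invariant ergodic probability measure $\mathbb P$ (expectation $\mathbf E$). Let $S_1,\dots,S_d$ be the right shifts on $\ell^2(\mathbb Z^d)$. $\mathcal A_0$ is the algebra of strongly continuous families $A=(A_\omega)_{\omega\in\Omega}$ of bounded operators on $\ell^2(\mathbb Z^d)$ satisfying the covariance relation $S_jA_\omega S_j^*=A_{\tau_j\omega}$ ($j=1,\dots,d$) and of finite range (there is $R$ with $\langle n|A_\omega|m\rangle=0$ for $|n-m|>R$ and all $\omega$). $\mathcal A=C(\Omega)\rtimes\mathbb Z^d$ is the completion of $\mathcal A_0$ in the norm $\|A\|=\sup_{\omega}\|A_\omega\|$. Its elements are called covariant and local. The finite normalized trace on $\mathcal A$ is $\mathcal T(A)=\mathbf E\,\langle 0|A_\omega|0\rangle$.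 By convention $\mathbb Z^0$ is one point. Transfer operators and Prüfer phase. For $E\in\mathbb R$, $$\mathcal M_n^E=\begin{pmatrix}(E\mathbf 1-V_n)T_n^{-1}&-T_n^*\\ T_n^{-1}&0\end{pmatrix},\qquad n\ge 1,$$ with the convention $T_1=\mathbf 1$, and $$U_N^E=\Big[\tbinom{\mathbf 1}{\imath\mathbf 1}^*\mathcal M_N^E\cdots\mathcal M_1^E\tbinom{\mathbf 1}{0}\Big]\Big[\tbinom{\mathbf 1}{-\imath\mathbf 1}^*\mathcal M_N^E\cdots\mathcal M_1^E\tbinom{\mathbf 1}{0}\Big]^{-1},$$ which is a well-defined unitary element of $\mathcal A$ (here $\binom{\mathbf 1}{\imath\mathbf 1}^*=(\mathbf 1,-\imath\mathbf 1)$). *)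

theory Defs
  imports "HOL-Probability.Probability"
begin

text \<open>The rank is \<open>CARD('d)\<close>. As \<open>CARD('d) = 0\<close> for infinite \<open>'d\<close> (for instance for the
  numeral type \<open>0\<close>), every rank \<open>d \<ge> 0\<close> occurs, and the lattice of rank 0 is one point.\<close>

typedef 'd lattice = "{n :: nat \<Rightarrow> int. \<forall>i\<ge>CARD('d). n i = 0}"
  morphisms coord Abs_lattice
  by (rule exI[of _ "\<lambda>_. 0"]) simp

setup_lifting type_definition_lattice

instantiation lattice :: (type) ab_group_add
begin
lift_definition zero_lattice :: "'a lattice" is "\<lambda>_. 0" by simp
lift_definition plus_lattice :: "'a lattice \<Rightarrow> 'a lattice \<Rightarrow> 'a lattice" is "\<lambda>m n i. m i + n i" by simp
lift_definition minus_lattice :: "'a lattice \<Rightarrow> 'a lattice \<Rightarrow> 'a lattice" is "\<lambda>m n i. m i - n i" by simp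
lift_definition uminus_lattice :: "'a lattice \<Rightarrow> 'a lattice" is "\<lambda>m i. - m i" by simp
instance by standard (transfer; auto)+
end

lift_definition basis_vec :: "nat \<Rightarrow> 'd lattice" is
  "\<lambda>j i. if i = j \<and> j < CARD('d) then 1 else 0" by auto

definition lattice_norm :: "'d lattice \<Rightarrow> real" where
  "lattice_norm n = sqrt (\<Sum>i<CARD('d). (real_of_int (coord n i))\<^sup>2)"

typedef 'a ell2 = "{x :: 'a \<Rightarrow> complex. (\<lambda>i. (cmod (x i))\<^sup>2) summable_on UNIV}"
  morphisms ell2_nth Abs_ell2
  by (rule exI[of _ "\<lambda>_. 0"]) simp

setup_lifting type_definition_ell2

lemma ell2_prod_abs_summable:
  fixes x y :: "'a \<Rightarrow> complex"
  assumes "(\<lambda>i. (cmod (x i))\<^sup>2) summable_on UNIV" "(\<lambda>i. (cmod (y i))\<^sup>2) summable_on UNIV"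
  shows "(\<lambda>i. norm (cnj (x i) * y i)) summable_on UNIV"
proof (rule summable_on_comparison_test)
  show "(\<lambda>i. (cmod (x i))\<^sup>2 + (cmod (y i))\<^sup>2) summable_on UNIV"
    using assms by (rule summable_on_add)
  fix i
  have "0 \<le> (cmod (x i) - cmod (y i))\<^sup>2" by simp
  then have "2 * (cmod (x i) * cmod (y i)) \<le> (cmod (x i))\<^sup>2 + (cmod (y i))\<^sup>2"
    by (simp add: power2_diff)
  moreover have "0 \<le> cmod (x i) * cmod (y i)" by simp
  ultimately show "norm (cnj (x i) * y i) \<le> (cmod (x i))\<^sup>2 + (cmod (y i))\<^sup>2"
    unfolding norm_mult complex_mod_cnj by linarith
qed auto

lemma ell2_add_summable:
  fixes x y :: "'a \<Rightarrow> complex"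
  assumes "(\<lambda>i. (cmod (x i))\<^sup>2) summable_on UNIV" "(\<lambda>i. (cmod (y i))\<^sup>2) summable_on UNIV"
  shows "(\<lambda>i. (cmod (x i + y i))\<^sup>2) summable_on UNIV"
proof (rule summable_on_comparison_test)
  show "(\<lambda>i. 2 * (cmod (x i))\<^sup>2 + 2 * (cmod (y i))\<^sup>2) summable_on UNIV"
    using assms by (intro summable_on_add summable_on_cmult_right)
  fix i
  have "(cmod (x i + y i))\<^sup>2 \<le> (cmod (x i) + cmod (y i))\<^sup>2"
    by (simp add: norm_triangle_ineq power_mono)
  moreover have "0 \<le> (cmod (x i) - cmod (y i))\<^sup>2" by simp
  ultimately show "(cmod (x i + y i))\<^sup>2 \<le> 2 * (cmod (x i))\<^sup>2 + 2 * (cmod (y i))\<^sup>2"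
    by (simp add: power2_diff power2_sum)
qed auto

lemma ell2_cmult_summable:
  fixes x :: "'a \<Rightarrow> complex"
  assumes "(\<lambda>i. (cmod (x i))\<^sup>2) summable_on UNIV"
  shows "(\<lambda>i. (cmod (c * x i))\<^sup>2) summable_on UNIV"
  using assms by (simp add: norm_mult power_mult_distrib summable_on_cmult_right)

lift_definition cinner :: "'a ell2 \<Rightarrow> 'a ell2 \<Rightarrow> complex" is
  "\<lambda>x y. \<Sum>\<^sub>\<infinity>i. cnj (x i) * y i" .

lift_definition cscale :: "complex \<Rightarrow> 'a ell2 \<Rightarrow> 'a ell2" (infixr "*\<^sub>C" 75) is
  "\<lambda>c x i. c * x i"
  by (rule ell2_cmult_summable)

lift_definition ket :: "'a \<Rightarrow> 'a ell2" is "\<lambda>j i. if i = j then 1 else 0"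
proof -
  fix j :: 'a
  have "(\<lambda>i. (cmod (if i = j then 1 else 0))\<^sup>2) summable_on {j}" by simp
  then show "(\<lambda>i. (cmod (if i = j then 1 else 0))\<^sup>2) summable_on UNIV"
    by (rule summable_on_cong_neutral[THEN iffD1, rotated -1]) auto
qed

lemma ell2_summable: "(\<lambda>i. (cmod (ell2_nth x i))\<^sup>2) summable_on UNIV"
  using ell2_nth[of x] by simp

lemma cinner_self: "cinner x x = of_real (\<Sum>\<^sub>\<infinity>i. (cmod (ell2_nth x i))\<^sup>2)"
proof -
  have "((\<lambda>i. of_real ((cmod (ell2_nth x i))\<^sup>2) :: complex) has_sum
      of_real (\<Sum>\<^sub>\<infinity>i. (cmod (ell2_nth x i))\<^sup>2)) UNIV"
    by (rule has_sum_of_real[OF has_sum_infsum[OF ell2_summable]])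
  moreover have "of_real ((cmod z)\<^sup>2) = cnj z * z" for z :: complex
    by (metis complex_norm_square mult.commute)
  ultimately show ?thesis by (simp add: cinner.rep_eq infsumI)
qed

instantiation ell2 :: (type) real_inner
begin

lift_definition zero_ell2 :: "'a ell2" is "\<lambda>_. 0" by simp
lift_definition plus_ell2 :: "'a ell2 \<Rightarrow> 'a ell2 \<Rightarrow> 'a ell2" is "\<lambda>x y i. x i + y i"
  by (rule ell2_add_summable)
lift_definition uminus_ell2 :: "'a ell2 \<Rightarrow> 'a ell2" is "\<lambda>x i. - x i" by simp
lift_definition minus_ell2 :: "'a ell2 \<Rightarrow> 'a ell2 \<Rightarrow> 'a ell2" is "\<lambda>x y i. x i - y i"
proof -
  fix x y :: "'a \<Rightarrow> complex"
  assume "(\<lambda>i. (cmod (x i))\<^sup>2) summable_on UNIV" "(\<lambda>i. (cmod (y i))\<^sup>2) summable_on UNIV"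
  then show "(\<lambda>i. (cmod (x i - y i))\<^sup>2) summable_on UNIV"
    using ell2_add_summable[of x "\<lambda>i. - y i"] by simp
qed
lift_definition scaleR_ell2 :: "real \<Rightarrow> 'a ell2 \<Rightarrow> 'a ell2" is "\<lambda>r x i. r *\<^sub>R x i"
  unfolding scaleR_conv_of_real by (rule ell2_cmult_summable)
definition inner_ell2 :: "'a ell2 \<Rightarrow> 'a ell2 \<Rightarrow> real" where
  "inner_ell2 x y = Re (cinner x y)"
definition norm_ell2 :: "'a ell2 \<Rightarrow> real" where
  "norm_ell2 x = sqrt (inner x x)"
definition sgn_ell2 :: "'a ell2 \<Rightarrow> 'a ell2" where
  "sgn_ell2 x = inverse (norm x) *\<^sub>R x"
definition dist_ell2 :: "'a ell2 \<Rightarrow> 'a ell2 \<Rightarrow> real" where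
  "dist_ell2 x y = norm (x - y)"
definition uniformity_ell2 :: "('a ell2 \<times> 'a ell2) filter" where
  "uniformity_ell2 = (INF e\<in>{0 <..}. principal {(x, y). dist x y < e})"
definition open_ell2 :: "'a ell2 set \<Rightarrow> bool" where
  "open_ell2 U = (\<forall>x\<in>U. \<forall>\<^sub>F (x', y) in uniformity. x' = x \<longrightarrow> y \<in> U)"

instance
proof
  fix x y z :: "'a ell2" and r s :: real
  show "x + y + z = x + (y + z)" "x + y = y + x" "0 + x = x" "- x + x = 0" "x - y = x + - y"
    by (transfer; auto)+
  show "r *\<^sub>R (x + y) = r *\<^sub>R x + r *\<^sub>R y" "(r + s) *\<^sub>R x = r *\<^sub>R x + s *\<^sub>R x"
    "r *\<^sub>R s *\<^sub>R x = (r * s) *\<^sub>R x" "1 *\<^sub>R x = x"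
    by (transfer; auto simp: algebra_simps)+
  show "dist x y = norm (x - y)" by (rule dist_ell2_def)
  show "sgn x = inverse (norm x) *\<^sub>R x" by (rule sgn_ell2_def)
  show "norm x = sqrt (inner x x)" by (rule norm_ell2_def)
  have smm: "(\<lambda>i. cnj (ell2_nth u i) * ell2_nth v i) summable_on UNIV" for u v :: "'a ell2"
    by (rule abs_summable_summable, rule ell2_prod_abs_summable)
       (use ell2_nth[of u] ell2_nth[of v] in auto)
  have "cinner x y = cnj (cinner y x)"
    unfolding cinner.rep_eq by (simp flip: infsum_cnj add: mult.commute)
  then show "inner x y = inner y x" by (simp add: inner_ell2_def)
  have "cinner (x + y) z = cinner x z + cinner y z"
    unfolding cinner.rep_eq plus_ell2.rep_eq
    by (simp add: distrib_right infsum_add[OF smm smm])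
  then show "inner (x + y) z = inner x z + inner y z" by (simp add: inner_ell2_def)
  have "cinner (r *\<^sub>R x) y = r *\<^sub>R cinner x y"
    unfolding cinner.rep_eq scaleR_ell2.rep_eq
    by (simp add: infsum_cmult_right' scaleR_conv_of_real mult.assoc)
  then show "inner (r *\<^sub>R x) y = r * inner x y" by (simp add: inner_ell2_def)
  note sq = cinner_self[of x]
  show "0 \<le> inner x x" by (simp add: inner_ell2_def sq infsum_nonneg)
  show "(inner x x = 0) = (x = 0)"
  proof
    assume "inner x x = 0"
    then have "(\<Sum>\<^sub>\<infinity>i. (cmod (ell2_nth x i))\<^sup>2) \<le> 0" by (simp add: inner_ell2_def sq)
    then have "(cmod (ell2_nth x i))\<^sup>2 = 0" for i
      using nonneg_infsum_le_0D[of "\<lambda>i. (cmod (ell2_nth x i))\<^sup>2" UNIV i] ell2_nth[of x] by auto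
    then show "x = 0" by transfer auto
  next
    assume "x = 0"
    then show "inner x x = 0" by (simp add: inner_ell2_def cinner.rep_eq zero_ell2.rep_eq)
  qed
qed (rule uniformity_ell2_def open_ell2_def)+

end

lemma norm_ell2_sq: "(norm x)\<^sup>2 = (\<Sum>\<^sub>\<infinity>i. (cmod (ell2_nth x i))\<^sup>2)"
proof -
  show ?thesis by (simp add: norm_ell2_def inner_ell2_def cinner_self infsum_nonneg)
qed

lemma norm_cscale [simp]: "norm (c *\<^sub>C x) = cmod c * norm x"
proof -
  have "(norm (c *\<^sub>C x))\<^sup>2 = (cmod c * norm x)\<^sup>2"
    unfolding norm_ell2_sq power_mult_distrib cscale.rep_eq norm_mult
    by (simp add: infsum_cmult_right')
  then show ?thesis by (simp add: power2_eq_iff_nonneg)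
qed

lemma finite_sum_le_norm_ell2:
  assumes "finite F"
  shows "(\<Sum>i\<in>F. (cmod (ell2_nth x i))\<^sup>2) \<le> (norm x)\<^sup>2"
  unfolding norm_ell2_sq using ell2_summable assms by (intro finite_sum_le_infsum) auto

lemma norm_ell2_nth_le: "cmod (ell2_nth x i) \<le> norm x"
  using finite_sum_le_norm_ell2[of "{i}" x] by (simp add: power2_le_iff_abs_le)

lemma norm_ell2_leI:
  assumes "\<And>F. finite F \<Longrightarrow> (\<Sum>i\<in>F. (cmod (ell2_nth x i))\<^sup>2) \<le> b\<^sup>2" "0 \<le> b"
  shows "norm x \<le> b"
proof -
  have "(norm x)\<^sup>2 \<le> b\<^sup>2"
    unfolding norm_ell2_sq by (rule infsum_le_finite_sums[OF ell2_summable]) (use assms in auto)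
  then show ?thesis using assms(2) by (simp add: power2_le_iff_abs_le)
qed

instance ell2 :: (type) banach
proof
  fix X :: "nat \<Rightarrow> 'a ell2"
  assume C: "Cauchy X"
  have "Cauchy (\<lambda>n. ell2_nth (X n) i)" for i
  proof (rule CauchyI)
    fix e :: real assume "0 < e"
    then obtain M where M: "\<forall>m\<ge>M. \<forall>n\<ge>M. norm (X m - X n) < e"
      using CauchyD[OF C] by blast
    have "norm (ell2_nth (X m) i - ell2_nth (X n) i) < e" if "m \<ge> M" "n \<ge> M" for m n
      using norm_ell2_nth_le[of "X m - X n" i] M that
      by (simp add: minus_ell2.rep_eq) (meson le_less_trans)
    then show "\<exists>M. \<forall>m\<ge>M. \<forall>n\<ge>M. norm (ell2_nth (X m) i - ell2_nth (X n) i) < e" by blast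
  qed
  then have "\<forall>i. \<exists>l. (\<lambda>n. ell2_nth (X n) i) \<longlonglongrightarrow> l"
    using Cauchy_convergent convergent_def by blast
  then obtain y where y: "\<And>i. (\<lambda>n. ell2_nth (X n) i) \<longlonglongrightarrow> y i" by metis
  have fin: "(\<Sum>i\<in>F. (cmod (ell2_nth (X n) i - y i))\<^sup>2) \<le> e\<^sup>2"
    if "finite F" "0 \<le> e" "\<And>m. m \<ge> M \<Longrightarrow> norm (X n - X m) \<le> e" for F n M e
  proof (rule tendsto_upperbound)
    show "(\<lambda>m. \<Sum>i\<in>F. (cmod (ell2_nth (X n) i - ell2_nth (X m) i))\<^sup>2)
        \<longlonglongrightarrow> (\<Sum>i\<in>F. (cmod (ell2_nth (X n) i - y i))\<^sup>2)"
      by (intro tendsto_intros y)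
    show "\<forall>\<^sub>F m in sequentially.
        (\<Sum>i\<in>F. (cmod (ell2_nth (X n) i - ell2_nth (X m) i))\<^sup>2) \<le> e\<^sup>2"
      unfolding eventually_sequentially
    proof (intro exI[of _ M] allI impI)
      fix m assume "M \<le> m"
      have "(\<Sum>i\<in>F. (cmod (ell2_nth (X n) i - ell2_nth (X m) i))\<^sup>2) \<le> (norm (X n - X m))\<^sup>2"
        using finite_sum_le_norm_ell2[OF \<open>finite F\<close>, of "X n - X m"]
        by (simp add: minus_ell2.rep_eq)
      also have "\<dots> \<le> e\<^sup>2" using that(3)[OF \<open>M \<le> m\<close>] by (simp add: power_mono)
      finally show "(\<Sum>i\<in>F. (cmod (ell2_nth (X n) i - ell2_nth (X m) i))\<^sup>2) \<le> e\<^sup>2" .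
    qed
  qed simp
  have sm: "(\<lambda>i. (cmod (ell2_nth (X n) i - y i))\<^sup>2) summable_on UNIV"
    if "0 \<le> e" "\<And>m. m \<ge> M \<Longrightarrow> norm (X n - X m) \<le> e" for n M e
    by (rule nonneg_bounded_partial_sums_imp_summable_on[where C = "e\<^sup>2"])
       (auto intro!: eventually_finite_subsets_at_top_weakI fin that)
  obtain M0 where M0: "\<forall>m\<ge>M0. \<forall>n\<ge>M0. norm (X m - X n) < 1"
    using CauchyD[OF C, of 1] by auto
  have "(\<lambda>i. (cmod (ell2_nth (X M0) i - y i))\<^sup>2) summable_on UNIV"
    by (rule sm[of 1 M0]) (use M0 in \<open>auto intro: less_imp_le\<close>)
  then have "(\<lambda>i. (cmod (ell2_nth (X M0) i + - (ell2_nth (X M0) i - y i)))\<^sup>2) summable_on UNIV"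
    by (intro ell2_add_summable[OF ell2_summable]) (simp only: norm_minus_cancel)
  then have ysum: "(\<lambda>i. (cmod (y i))\<^sup>2) summable_on UNIV" by simp
  define L where "L = Abs_ell2 y"
  have L: "ell2_nth L = y" unfolding L_def using ysum by (simp add: Abs_ell2_inverse)
  have "X \<longlonglongrightarrow> L"
  proof (rule LIMSEQ_I)
    fix r :: real assume "0 < r"
    then obtain M where M: "\<forall>m\<ge>M. \<forall>n\<ge>M. norm (X m - X n) < r / 2"
      using CauchyD[OF C, of "r / 2"] by auto
    have "norm (X n - L) \<le> r / 2" if "n \<ge> M" for n
    proof (rule norm_ell2_leI)
      fix F :: "'a set" assume "finite F"
      then show "(\<Sum>i\<in>F. (cmod (ell2_nth (X n - L) i))\<^sup>2) \<le> (r / 2)\<^sup>2"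
        unfolding minus_ell2.rep_eq L
        by (rule fin[where M = M]) (use \<open>0 < r\<close> M that in \<open>auto intro: less_imp_le\<close>)
    qed (use \<open>0 < r\<close> in simp)
    then show "\<exists>M. \<forall>n\<ge>M. norm (X n - L) < r"
      using \<open>0 < r\<close> by (intro exI[of _ M]) (auto intro: le_less_trans[where y = "r / 2"])
  qed
  then show "convergent X" by (auto simp: convergent_def)
qed

lemma cscale_add_right: "c *\<^sub>C (x + y) = c *\<^sub>C x + c *\<^sub>C y"
  and cscale_scaleR: "c *\<^sub>C r *\<^sub>R x = r *\<^sub>R c *\<^sub>C x"
  and cscale_cscale: "c *\<^sub>C d *\<^sub>C x = (c * d) *\<^sub>C x"
  by (transfer; auto simp: algebra_simps)+

lemma bounded_linear_cscale: "bounded_linear (\<lambda>x. c *\<^sub>C x)"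
  by (rule bounded_linear_intro[where K = "cmod c"])
     (auto simp: cscale_add_right cscale_scaleR mult.commute)

lemma cinner_summable: "(\<lambda>i. cnj (ell2_nth x i) * ell2_nth y i) summable_on UNIV"
  by (rule abs_summable_summable, rule ell2_prod_abs_summable) (rule ell2_summable)+

lemma cinner_cscale_right: "cinner x (c *\<^sub>C y) = c * cinner x y"
  unfolding cinner.rep_eq cscale.rep_eq
  by (simp add: mult.left_commute[of _ c] infsum_cmult_right')

lemma cinner_cscale_left: "cinner (c *\<^sub>C x) y = cnj c * cinner x y"
  unfolding cinner.rep_eq cscale.rep_eq
  by (simp add: mult.assoc infsum_cmult_right')

lemma cinner_eq_inner: "cinner x y = Complex (inner x y) (inner x ((- \<i>) *\<^sub>C y))"
  by (simp add: inner_ell2_def cinner_cscale_right complex_eq_iff)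

lemma cinner_add_left: "cinner (x + y) z = cinner x z + cinner y z"
  and cinner_add_right: "cinner x (y + z) = cinner x y + cinner x z"
  by (simp_all add: cinner_eq_inner cscale_add_right inner_add complex_eq_iff)

lemma cinner_zero_left [simp]: "cinner 0 y = 0"
  by (simp add: cinner_eq_inner complex_eq_iff)

lemma cinner_sum_left: "cinner (\<Sum>i\<in>F. f i) y = (\<Sum>i\<in>F. cinner (f i) y)"
  by (induction F rule: infinite_finite_induct) (auto simp: cinner_add_left)

lemma tendsto_cinner_left:
  assumes "(f \<longlongrightarrow> x) F"
  shows "((\<lambda>i. cinner (f i) y) \<longlongrightarrow> cinner x y) F"
  unfolding cinner_eq_inner by (intro tendsto_intros assms)

lemma cinner_right_eqI:
  assumes "\<And>x. cinner x y = cinner x z"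
  shows "y = z"
proof -
  have "inner x y = inner x z" for x using assms by (simp add: inner_ell2_def)
  then show ?thesis by (metis inner_commute vector_eq_ldot)
qed

lemma ell2_nth_sum: "ell2_nth (\<Sum>j\<in>F. f j) i = (\<Sum>j\<in>F. ell2_nth (f j) i)"
  by (induction F rule: infinite_finite_induct) (auto simp: plus_ell2.rep_eq zero_ell2.rep_eq)

lemma ell2_nth_trunc:
  assumes "finite F"
  shows "ell2_nth (\<Sum>j\<in>F. c j *\<^sub>C ket j) i = (if i \<in> F then c i else 0)"
proof -
  have "ell2_nth (\<Sum>j\<in>F. c j *\<^sub>C ket j) i = (\<Sum>j\<in>F. if i = j then c j else 0)"
    unfolding ell2_nth_sum by (rule sum.cong) (auto simp: cscale.rep_eq ket.rep_eq)
  then show ?thesis using assms by simp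
qed

lemma norm_trunc:
  assumes "finite F"
  shows "(norm (\<Sum>j\<in>F. c j *\<^sub>C ket j))\<^sup>2 = (\<Sum>j\<in>F. (cmod (c j))\<^sup>2)"
proof -
  have "(norm (\<Sum>j\<in>F. c j *\<^sub>C ket j))\<^sup>2 = (\<Sum>\<^sub>\<infinity>i\<in>F. (cmod (c i))\<^sup>2)"
    unfolding norm_ell2_sq ell2_nth_trunc[OF assms] by (rule infsum_cong_neutral) auto
  then show ?thesis using assms by simp
qed

lemma trunc_tendsto:
  "((\<lambda>F. \<Sum>j\<in>F. ell2_nth x j *\<^sub>C ket j) \<longlongrightarrow> x) (finite_subsets_at_top UNIV)"
proof -
  let ?t = "\<lambda>F. \<Sum>j\<in>F. ell2_nth x j *\<^sub>C ket j"
  let ?s = "\<lambda>i. (cmod (ell2_nth x i))\<^sup>2"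
  have eq: "(norm (?t F - x))\<^sup>2 = infsum ?s UNIV - sum ?s F" if "finite F" for F
  proof -
    have "(norm (?t F - x))\<^sup>2 = infsum ?s (UNIV - F)"
      unfolding norm_ell2_sq minus_ell2.rep_eq ell2_nth_trunc[OF that]
      by (rule infsum_cong_neutral) auto
    also have "\<dots> = infsum ?s UNIV - infsum ?s F"
      by (rule infsum_Diff[OF ell2_summable]) (use that in auto)
    finally show ?thesis using that by simp
  qed
  have "(sum ?s \<longlongrightarrow> infsum ?s UNIV) (finite_subsets_at_top UNIV)"
    using has_sum_infsum[OF ell2_summable[of x]] by (simp add: has_sum_def)
  then have "((\<lambda>F. infsum ?s UNIV - sum ?s F) \<longlongrightarrow> infsum ?s UNIV - infsum ?s UNIV)
      (finite_subsets_at_top UNIV)"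
    by (intro tendsto_intros)
  then have "((\<lambda>F. infsum ?s UNIV - sum ?s F) \<longlongrightarrow> 0) (finite_subsets_at_top UNIV)" by simp
  then have "((\<lambda>F. (norm (?t F - x))\<^sup>2) \<longlongrightarrow> 0) (finite_subsets_at_top UNIV)"
    by (rule Lim_transform_eventually)
       (auto simp: eq intro!: eventually_finite_subsets_at_top_weakI)
  then have "((\<lambda>F. sqrt ((norm (?t F - x))\<^sup>2)) \<longlongrightarrow> sqrt 0) (finite_subsets_at_top UNIV)"
    by (rule tendsto_real_sqrt)
  then have "((\<lambda>F. norm (?t F - x)) \<longlongrightarrow> 0) (finite_subsets_at_top UNIV)" by simp
  then show ?thesis using LIM_zero_cancel tendsto_norm_zero_iff by blast
qed

text \<open>The library's bounded linear maps are only real-linear.\<close>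

typedef 'a opr =
  "{f :: 'a ell2 \<Rightarrow>\<^sub>L 'a ell2. \<forall>c x. blinfun_apply f (c *\<^sub>C x) = c *\<^sub>C blinfun_apply f x}"
  morphisms opr_blinfun Abs_opr
  by (rule exI[of _ id_blinfun]) simp

setup_lifting type_definition_opr

definition opr_apply :: "'a opr \<Rightarrow> 'a ell2 \<Rightarrow> 'a ell2" where
  "opr_apply A = blinfun_apply (opr_blinfun A)"

lemma cscale_zero [simp]: "c *\<^sub>C 0 = 0"
  and cscale_minus_right: "c *\<^sub>C (- x) = - (c *\<^sub>C x)"
  and cscale_diff_right: "c *\<^sub>C (x - y) = c *\<^sub>C x - c *\<^sub>C y"
  by (transfer; auto simp: algebra_simps)+

instantiation opr :: (type) real_normed_algebra_1
begin

lift_definition zero_opr :: "'a opr" is 0 by simp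
lift_definition one_opr :: "'a opr" is id_blinfun by simp
lift_definition plus_opr :: "'a opr \<Rightarrow> 'a opr \<Rightarrow> 'a opr" is "(+)"
  by (simp add: plus_blinfun.rep_eq cscale_add_right)
lift_definition uminus_opr :: "'a opr \<Rightarrow> 'a opr" is uminus
  by (simp add: uminus_blinfun.rep_eq cscale_minus_right)
lift_definition minus_opr :: "'a opr \<Rightarrow> 'a opr \<Rightarrow> 'a opr" is "(-)"
  by (simp add: minus_blinfun.rep_eq cscale_diff_right)
lift_definition times_opr :: "'a opr \<Rightarrow> 'a opr \<Rightarrow> 'a opr" is "(o\<^sub>L)" by simp
lift_definition scaleR_opr :: "real \<Rightarrow> 'a opr \<Rightarrow> 'a opr" is "(*\<^sub>R)"
  by (simp add: scaleR_blinfun.rep_eq cscale_scaleR)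
lift_definition norm_opr :: "'a opr \<Rightarrow> real" is norm .
definition sgn_opr :: "'a opr \<Rightarrow> 'a opr" where
  "sgn_opr x = inverse (norm x) *\<^sub>R x"
definition dist_opr :: "'a opr \<Rightarrow> 'a opr \<Rightarrow> real" where
  "dist_opr x y = norm (x - y)"
definition uniformity_opr :: "('a opr \<times> 'a opr) filter" where
  "uniformity_opr = (INF e\<in>{0 <..}. principal {(x, y). dist x y < e})"
definition open_opr :: "'a opr set \<Rightarrow> bool" where
  "open_opr U = (\<forall>x\<in>U. \<forall>\<^sub>F (x', y) in uniformity. x' = x \<longrightarrow> y \<in> U)"

instance
proof
  fix x y z :: "'a opr" and r s :: real
  show "x + y + z = x + (y + z)" "x + y = y + x" "0 + x = x" "- x + x = 0" "x - y = x + - y"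
    by (transfer; auto)+
  show "r *\<^sub>R (x + y) = r *\<^sub>R x + r *\<^sub>R y" "(r + s) *\<^sub>R x = r *\<^sub>R x + s *\<^sub>R x"
    "r *\<^sub>R s *\<^sub>R x = (r * s) *\<^sub>R x" "1 *\<^sub>R x = x"
    by (transfer; auto simp: algebra_simps)+
  show "dist x y = norm (x - y)" by (rule dist_opr_def)
  show "sgn x = inverse (norm x) *\<^sub>R x" by (rule sgn_opr_def)
  show "x * y * z = x * (y * z)" "(x + y) * z = x * z + y * z" "x * (y + z) = x * y + x * z"
    "1 * x = x" "x * 1 = x" "r *\<^sub>R x * y = r *\<^sub>R (x * y)" "x * r *\<^sub>R y = r *\<^sub>R (x * y)"
    by (transfer; auto intro!: blinfun_eqI simp: blinfun.bilinear_simps)+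
  show "(norm x = 0) = (x = 0)" "norm (x + y) \<le> norm x + norm y"
    "norm (r *\<^sub>R x) = \<bar>r\<bar> * norm x"
    by (transfer; auto intro: norm_triangle_ineq)+
  show "norm (x * y) \<le> norm x * norm y" by transfer (rule norm_blinfun_compose)
  have "ell2_nth (ket undefined) undefined \<noteq> ell2_nth (0 :: 'a ell2) undefined"
    by (simp add: ket.rep_eq zero_ell2.rep_eq)
  then have "ket undefined \<noteq> (0 :: 'a ell2)" by metis
  then have nt: "norm (id_blinfun :: 'a ell2 \<Rightarrow>\<^sub>L 'a ell2) = 1"
    using norm_blinfun[of id_blinfun "ket undefined :: 'a ell2"]
      norm_blinfun_id_le[where 'a = "'a ell2"]
    by (intro antisym) auto
  show one: "norm (1 :: 'a opr) = 1" by transfer (rule nt)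
  show "(0 :: 'a opr) \<noteq> 1"
    using nt by transfer auto
qed (rule uniformity_opr_def open_opr_def)+

end

lemma dist_opr_blinfun: "dist (opr_blinfun A) (opr_blinfun B) = dist A B"
  by (simp add: dist_norm norm_opr.rep_eq minus_opr.rep_eq)

instance opr :: (type) banach
proof
  fix X :: "nat \<Rightarrow> 'a opr"
  assume "Cauchy X"
  then have "Cauchy (\<lambda>n. opr_blinfun (X n))"
    by (simp add: Cauchy_def dist_opr_blinfun)
  then obtain L where L: "(\<lambda>n. opr_blinfun (X n)) \<longlonglongrightarrow> L"
    using Cauchy_convergent convergent_def by blast
  have pt: "(\<lambda>n. blinfun_apply (opr_blinfun (X n)) x) \<longlonglongrightarrow> blinfun_apply L x" for x
    by (intro tendsto_intros L)
  have "blinfun_apply L (c *\<^sub>C x) = c *\<^sub>C blinfun_apply L x" for c x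
  proof (rule LIMSEQ_unique[OF pt])
    have "(\<lambda>n. c *\<^sub>C blinfun_apply (opr_blinfun (X n)) x) \<longlonglongrightarrow> c *\<^sub>C blinfun_apply L x"
      by (rule bounded_linear.tendsto[OF bounded_linear_cscale pt])
    moreover have "blinfun_apply (opr_blinfun (X n)) (c *\<^sub>C x)
        = c *\<^sub>C blinfun_apply (opr_blinfun (X n)) x" for n
      using opr_blinfun[of "X n"] by simp
    ultimately show "(\<lambda>n. blinfun_apply (opr_blinfun (X n)) (c *\<^sub>C x))
        \<longlonglongrightarrow> c *\<^sub>C blinfun_apply L x" by simp
  qed
  then have "opr_blinfun (Abs_opr L) = L" by (simp add: Abs_opr_inverse)
  then have "X \<longlonglongrightarrow> Abs_opr L"
    using L by (simp add: tendsto_iff flip: dist_opr_blinfun)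
  then show "convergent X" by (auto simp: convergent_def)
qed

lift_definition cscale_opr :: "complex \<Rightarrow> 'a opr \<Rightarrow> 'a opr" is
  "\<lambda>c A. Blinfun (\<lambda>x. c *\<^sub>C x) o\<^sub>L A"
  by (simp add: bounded_linear_Blinfun_apply bounded_linear_cscale cscale_cscale mult.commute)

lemma opr_apply_cscale: "opr_apply A (c *\<^sub>C x) = c *\<^sub>C opr_apply A x"
  unfolding opr_apply_def using opr_blinfun[of A] by simp

lemma bounded_linear_opr_apply: "bounded_linear (opr_apply A)"
  unfolding opr_apply_def by (rule blinfun.bounded_linear_right)

lemma norm_opr_apply: "norm (opr_apply A x) \<le> norm A * norm x"
  unfolding opr_apply_def norm_opr.rep_eq by (rule norm_blinfun)

lemma opr_eqI: "(\<And>x. opr_apply A x = opr_apply B x) \<Longrightarrow> A = B"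
  unfolding opr_apply_def opr_blinfun_inject[symmetric] by (rule blinfun_eqI)

lemma opr_of_fun:
  assumes "\<And>x y. f (x + y) = f x + f y" "\<And>c x. f (c *\<^sub>C x) = c *\<^sub>C f x"
    and "\<And>x. norm (f x) \<le> K * norm x"
  shows "\<exists>A. opr_apply A = f"
proof -
  have sc: "r *\<^sub>R x = of_real r *\<^sub>C x" for r and x :: "'a ell2"
    by transfer (simp add: scaleR_conv_of_real)
  have bl: "bounded_linear f"
    by (rule bounded_linear_intro[where K = K])
       (use assms in \<open>auto simp: sc mult.commute\<close>)
  have "opr_apply (Abs_opr (Blinfun f)) = f"
    using assms(2) bl by (simp add: opr_apply_def Abs_opr_inverse bounded_linear_Blinfun_apply)
  then show ?thesis by blast
qed

definition adj :: "'a opr \<Rightarrow> 'a opr" where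
  "adj A = (THE B. \<forall>x y. cinner (opr_apply A x) y = cinner x (opr_apply B y))"

lemma adj_exists_bounded:
  "\<exists>B. (\<forall>x y. cinner (opr_apply A x) y = cinner x (opr_apply B y)) \<and> norm B \<le> norm A"
proof -
  have ex: "\<exists>z. (\<forall>x. cinner (opr_apply A x) y = cinner x z) \<and> norm z \<le> norm A * norm y" for y
  proof -
    define c where "c i = cinner (opr_apply A (ket i)) y" for i
    define K where "K = norm A * norm y"
    have K: "0 \<le> K" by (simp add: K_def)
    have lin: "cinner (opr_apply A (\<Sum>i\<in>F. a i *\<^sub>C ket i)) y = (\<Sum>i\<in>F. cnj (a i) * c i)"
      for F a
      by (simp add: linear_sum[OF bounded_linear.linear[OF bounded_linear_opr_apply]]
          opr_apply_cscale cinner_sum_left cinner_cscale_left c_def)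
    have fin: "(\<Sum>i\<in>F. (cmod (c i))\<^sup>2) \<le> K\<^sup>2" if "finite F" for F
    proof -
      let ?v = "\<Sum>i\<in>F. c i *\<^sub>C ket i"
      have "(norm ?v)\<^sup>2 = Re (cinner (opr_apply A ?v) y)"
        unfolding lin norm_trunc[OF that] by (simp add: cmod_power2 flip: power2_eq_square)
      also have "\<dots> \<le> norm (opr_apply A ?v) * norm y"
        using norm_cauchy_schwarz[of "opr_apply A ?v" y] by (simp add: inner_ell2_def)
      also have "\<dots> \<le> norm ?v * K"
        using mult_right_mono[OF norm_opr_apply[of A ?v], of "norm y"]
        by (simp add: K_def mult_ac)
      finally have "norm ?v \<le> K"
        using K by (cases "norm ?v = 0") (auto simp: power2_eq_square mult_le_cancel_left)
      then have "(norm ?v)\<^sup>2 \<le> K\<^sup>2" by (simp add: power_mono)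
      then show ?thesis by (simp add: norm_trunc[OF that])
    qed
    have "(\<lambda>i. (cmod (c i))\<^sup>2) summable_on UNIV"
      by (rule nonneg_bounded_partial_sums_imp_summable_on[where C = "K\<^sup>2"])
         (auto intro!: eventually_finite_subsets_at_top_weakI fin)
    then have nth: "ell2_nth (Abs_ell2 c) = c" by (simp add: Abs_ell2_inverse)
    have "cinner (opr_apply A x) y = cinner x (Abs_ell2 c)" for x
    proof (rule tendsto_unique)
      show "((\<lambda>F. cinner (opr_apply A (\<Sum>i\<in>F. ell2_nth x i *\<^sub>C ket i)) y)
          \<longlongrightarrow> cinner (opr_apply A x) y) (finite_subsets_at_top UNIV)"
        by (intro tendsto_cinner_left bounded_linear.tendsto[OF bounded_linear_opr_apply]
            trunc_tendsto)
      show "((\<lambda>F. cinner (opr_apply A (\<Sum>i\<in>F. ell2_nth x i *\<^sub>C ket i)) y)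
          \<longlongrightarrow> cinner x (Abs_ell2 c)) (finite_subsets_at_top UNIV)"
        using has_sum_infsum[OF cinner_summable[of x "Abs_ell2 c"]]
        unfolding lin by (simp add: has_sum_def cinner.rep_eq[of x "Abs_ell2 c"] nth)
    qed simp
    moreover have "norm (Abs_ell2 c) \<le> K"
      by (rule norm_ell2_leI) (use fin K in \<open>auto simp: nth\<close>)
    ultimately show ?thesis unfolding K_def by blast
  qed
  then obtain g where g: "\<And>x y. cinner (opr_apply A x) y = cinner x (g y)"
    and bd: "\<And>y. norm (g y) \<le> norm A * norm y"
    by metis
  have "\<exists>B. opr_apply B = g"
  proof (rule opr_of_fun)
    show "g (x + y) = g x + g y" for x y
      by (rule cinner_right_eqI) (simp add: cinner_add_right flip: g)
    show "g (c *\<^sub>C x) = c *\<^sub>C g x" for c x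
      by (rule cinner_right_eqI) (simp add: cinner_cscale_right flip: g)
  qed (rule bd)
  then obtain B where B: "opr_apply B = g" by blast
  have "norm B \<le> norm A"
    using bd unfolding B[symmetric] opr_apply_def norm_opr.rep_eq by (auto intro: norm_blinfun_bound)
  then show ?thesis using g B by metis
qed

lemma adj_unique:
  assumes "\<And>x y. cinner (opr_apply A x) y = cinner x (opr_apply B y)"
  shows "adj A = B"
  unfolding adj_def
proof (rule the_equality)
  fix C assume "\<forall>x y. cinner (opr_apply A x) y = cinner x (opr_apply C y)"
  then show "C = B"
    by (intro opr_eqI cinner_right_eqI) (simp flip: assms)
qed (use assms in blast)

lemma cinner_adj: "cinner (opr_apply A x) y = cinner x (opr_apply (adj A) y)"
  using adj_exists_bounded[of A] adj_unique[of A] by metis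

lemma norm_adj_le: "norm (adj A) \<le> norm A"
  using adj_exists_bounded[of A] adj_unique[of A] by metis

definition matrix_elem :: "'a \<Rightarrow> 'a opr \<Rightarrow> 'a \<Rightarrow> complex" where
  "matrix_elem n A m = cinner (ket n) (opr_apply A (ket m))"

definition pos_semidef :: "'a opr \<Rightarrow> bool" where
  "pos_semidef A \<longleftrightarrow> (\<forall>x. cinner x (opr_apply A x) \<in> \<real> \<and> 0 \<le> Re (cinner x (opr_apply A x)))"

lift_definition translate :: "'g::ab_group_add \<Rightarrow> 'g ell2 \<Rightarrow> 'g ell2" is "\<lambda>g x n. x (n - g)"
proof -
  fix g :: 'g and x :: "'g \<Rightarrow> complex"
  have "bij (\<lambda>n. n - g)" by (rule bij_betw_byWitness[where f' = "\<lambda>n. n + g"]) auto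
  moreover assume "(\<lambda>i. (cmod (x i))\<^sup>2) summable_on UNIV"
  ultimately show "(\<lambda>n. (cmod (x (n - g)))\<^sup>2) summable_on UNIV"
    using summable_on_reindex_bij_betw[of "\<lambda>n. n - g" UNIV UNIV "\<lambda>i. (cmod (x i))\<^sup>2"] by simp
qed

lemma norm_translate: "norm (translate g x) = norm x"
proof -
  have "bij (\<lambda>n. n - g)" by (rule bij_betw_byWitness[where f' = "\<lambda>n. n + g"]) auto
  then have "(norm (translate g x))\<^sup>2 = (norm x)\<^sup>2"
    unfolding norm_ell2_sq translate.rep_eq by (rule infsum_reindex_bij_betw)
  then show ?thesis by (simp add: power2_eq_iff_nonneg)
qed

definition shift :: "nat \<Rightarrow> 'd lattice opr" where
  "shift j = (THE S. opr_apply S = translate (basis_vec j))"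

lemma translate_add: "translate g (x + y) = translate g x + translate g y"
  and translate_cscale: "translate g (c *\<^sub>C x) = c *\<^sub>C translate g x"
  by (simp_all add: ell2_nth_inject[symmetric] translate.rep_eq plus_ell2.rep_eq cscale.rep_eq)

lemma opr_apply_shift: "opr_apply (shift j) = translate (basis_vec j)"
  unfolding shift_def
proof (rule theI')
  obtain S where S: "opr_apply S = translate (basis_vec j :: 'd lattice)"
    using opr_of_fun[of "translate (basis_vec j :: 'd lattice)" 1]
    by (auto simp: norm_translate translate_add translate_cscale)
  show "\<exists>!S. opr_apply S = translate (basis_vec j :: 'd lattice)"
  proof (rule ex1I[where a = S])
    show "opr_apply S = translate (basis_vec j)" by (rule S)
  next
    fix S' assume "opr_apply S' = translate (basis_vec j :: 'd lattice)"
    then show "S' = S" using S by (intro opr_eqI) simp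
  qed
qed

lemma shift_ket: "opr_apply (shift j) (ket n) = ket (n + basis_vec j)"
  unfolding opr_apply_shift
  by (simp add: ell2_nth_inject[symmetric] translate.rep_eq ket.rep_eq fun_eq_iff algebra_simps)

typedef ('w, 'a) fam = "{A :: 'w \<Rightarrow> 'a opr. bounded (range A)}"
  morphisms fam_at Abs_fam
  by (rule exI[of _ "\<lambda>_. 0"]) (simp add: image_constant_conv)

setup_lifting type_definition_fam

lemma bounded_familyI: "(\<And>w. norm (A w) \<le> K) \<Longrightarrow> bounded (range A)"
  unfolding bounded_iff by auto

lemma bounded_familyE:
  assumes "bounded (range A)"
  obtains K where "\<And>w. norm (A w) \<le> K" "0 \<le> K"
proof -
  obtain K where K: "\<forall>w. norm (A w) \<le> K" using assms unfolding bounded_iff by auto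
  then have "0 \<le> K" by (meson norm_ge_zero order_trans)
  with K that show thesis by blast
qed

lemma bdd_above_family:
  fixes A :: "'w \<Rightarrow> 'a::real_normed_vector"
  shows "bounded (range A) \<Longrightarrow> bdd_above (range (\<lambda>w. norm (A w)))"
  by (erule bounded_familyE) (auto simp: bdd_above_def)

instantiation fam :: (type, type) real_normed_algebra_1
begin

lift_definition zero_fam :: "('a, 'b) fam" is "\<lambda>_. 0"
  by (rule bounded_familyI[of _ 0]) simp
lift_definition one_fam :: "('a, 'b) fam" is "\<lambda>_. 1"
  by (rule bounded_familyI[of _ 1]) simp
lift_definition plus_fam :: "('a, 'b) fam \<Rightarrow> ('a, 'b) fam \<Rightarrow> ('a, 'b) fam" is "\<lambda>A B w. A w + B w"
  by (rule bounded_plus_comp)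
lift_definition uminus_fam :: "('a, 'b) fam \<Rightarrow> ('a, 'b) fam" is "\<lambda>A w. - A w"
  by (auto elim!: bounded_familyE intro: bounded_familyI)
lift_definition minus_fam :: "('a, 'b) fam \<Rightarrow> ('a, 'b) fam \<Rightarrow> ('a, 'b) fam" is "\<lambda>A B w. A w - B w"
  by (rule bounded_minus_comp)
lift_definition times_fam :: "('a, 'b) fam \<Rightarrow> ('a, 'b) fam \<Rightarrow> ('a, 'b) fam" is "\<lambda>A B w. A w * B w"
proof -
  fix A B :: "'a \<Rightarrow> 'b opr"
  assume "bounded (range A)" "bounded (range B)"
  then obtain K L where "\<And>w. norm (A w) \<le> K" "0 \<le> K" "\<And>w. norm (B w) \<le> L"
    by (metis bounded_familyE)
  then have "norm (A w * B w) \<le> K * L" for w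
    by (meson mult_mono norm_ge_zero norm_mult_ineq order_trans)
  then show "bounded (range (\<lambda>w. A w * B w))" by (rule bounded_familyI)
qed
lift_definition scaleR_fam :: "real \<Rightarrow> ('a, 'b) fam \<Rightarrow> ('a, 'b) fam" is "\<lambda>r A w. r *\<^sub>R A w"
  by (rule bounded_scaleR_comp)
lift_definition norm_fam :: "('a, 'b) fam \<Rightarrow> real" is "\<lambda>A. SUP w. norm (A w)" .
definition sgn_fam :: "('a, 'b) fam \<Rightarrow> ('a, 'b) fam" where
  "sgn_fam x = inverse (norm x) *\<^sub>R x"
definition dist_fam :: "('a, 'b) fam \<Rightarrow> ('a, 'b) fam \<Rightarrow> real" where
  "dist_fam x y = norm (x - y)"
definition uniformity_fam :: "(('a, 'b) fam \<times> ('a, 'b) fam) filter" where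
  "uniformity_fam = (INF e\<in>{0 <..}. principal {(x, y). dist x y < e})"
definition open_fam :: "('a, 'b) fam set \<Rightarrow> bool" where
  "open_fam U = (\<forall>x\<in>U. \<forall>\<^sub>F (x', y) in uniformity. x' = x \<longrightarrow> y \<in> U)"

instance
proof
  fix x y z :: "('a, 'b) fam" and r s :: real
  show "x + y + z = x + (y + z)" "x + y = y + x" "0 + x = x" "- x + x = 0" "x - y = x + - y"
    by (transfer; auto)+
  show "r *\<^sub>R (x + y) = r *\<^sub>R x + r *\<^sub>R y" "(r + s) *\<^sub>R x = r *\<^sub>R x + s *\<^sub>R x"
    "r *\<^sub>R s *\<^sub>R x = (r * s) *\<^sub>R x" "1 *\<^sub>R x = x"
    by (transfer; auto simp: algebra_simps)+
  show "dist x y = norm (x - y)" by (rule dist_fam_def)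
  show "sgn x = inverse (norm x) *\<^sub>R x" by (rule sgn_fam_def)
  show "x * y * z = x * (y * z)" "(x + y) * z = x * z + y * z" "x * (y + z) = x * y + x * z"
    "1 * x = x" "x * 1 = x" "r *\<^sub>R x * y = r *\<^sub>R (x * y)" "x * r *\<^sub>R y = r *\<^sub>R (x * y)"
    by (transfer; auto simp: algebra_simps)+
  have at: "norm (fam_at a w) \<le> norm a" for a :: "('a, 'b) fam" and w
    unfolding norm_fam.rep_eq
    by (rule cSUP_upper[OF UNIV_I bdd_above_family]) (use fam_at[of a] in simp)
  have least: "norm a \<le> K" if "\<And>w. norm (fam_at a w) \<le> K" for a :: "('a, 'b) fam" and K
    unfolding norm_fam.rep_eq by (rule cSUP_least) (use that in auto)
  show "(norm x = 0) = (x = 0)"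
  proof
    assume "norm x = 0"
    then have "fam_at x w = 0" for w using at[of x w] by simp
    then show "x = 0" by transfer auto
  qed (simp add: norm_fam.rep_eq zero_fam.rep_eq)
  show "norm (x + y) \<le> norm x + norm y"
  proof (rule least)
    fix w
    show "norm (fam_at (x + y) w) \<le> norm x + norm y"
      using norm_triangle_ineq[of "fam_at x w" "fam_at y w"] at[of x w] at[of y w]
      by (simp add: plus_fam.rep_eq)
  qed
  show "norm (x * y) \<le> norm x * norm y"
  proof (rule least)
    fix w
    have "norm (fam_at x w) * norm (fam_at y w) \<le> norm x * norm y"
      using at[of x w] at[of y w] norm_ge_zero order_trans by (intro mult_mono) blast+
    then show "norm (fam_at (x * y) w) \<le> norm x * norm y"
      using norm_mult_ineq[of "fam_at x w" "fam_at y w"] by (simp add: times_fam.rep_eq)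
  qed
  have le: "norm (r *\<^sub>R a) \<le> \<bar>r\<bar> * norm a" for r and a :: "('a, 'b) fam"
    by (rule least) (simp add: scaleR_fam.rep_eq at mult_left_mono)
  show "norm (r *\<^sub>R x) = \<bar>r\<bar> * norm x"
  proof (cases "r = 0")
    case False
    have "x = inverse r *\<^sub>R r *\<^sub>R x" using False by transfer auto
    then have "norm x \<le> \<bar>inverse r\<bar> * norm (r *\<^sub>R x)" using le by metis
    then show ?thesis using le[of r x] False by (simp add: field_simps)
  next
    case True
    then have "r *\<^sub>R x = 0" by transfer auto
    then show ?thesis using True by (simp add: norm_fam.rep_eq zero_fam.rep_eq)
  qed
  show "norm (1 :: ('a, 'b) fam) = 1" by (simp add: norm_fam.rep_eq one_fam.rep_eq)
  show "(0 :: ('a, 'b) fam) \<noteq> 1" by transfer (simp add: fun_eq_iff)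
qed (rule uniformity_fam_def open_fam_def)+

end

lemma norm_fam_at: "norm (fam_at A w) \<le> norm A"
  unfolding norm_fam.rep_eq
  by (rule cSUP_upper[OF UNIV_I bdd_above_family]) (use fam_at[of A] in simp)

lemma norm_fam_leI: "(\<And>w. norm (fam_at A w) \<le> K) \<Longrightarrow> norm A \<le> K"
  unfolding norm_fam.rep_eq by (rule cSUP_least) auto

instance fam :: (type, type) banach
proof
  fix X :: "nat \<Rightarrow> ('a, 'b) fam"
  assume C: "Cauchy X"
  have diff: "norm (fam_at (X m) w - fam_at (X n) w) \<le> norm (X m - X n)" for m n w
    using norm_fam_at[of "X m - X n" w] by (simp add: minus_fam.rep_eq)
  have "Cauchy (\<lambda>n. fam_at (X n) w)" for w
    using CauchyD[OF C] diff by (intro CauchyI) (meson le_less_trans)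
  then have "\<forall>w. \<exists>l. (\<lambda>n. fam_at (X n) w) \<longlonglongrightarrow> l"
    using Cauchy_convergent convergent_def by blast
  then obtain L where L: "\<And>w. (\<lambda>n. fam_at (X n) w) \<longlonglongrightarrow> L w" by metis
  have close: "norm (fam_at (X n) w - L w) \<le> e"
    if "\<And>m. m \<ge> M \<Longrightarrow> norm (X n - X m) \<le> e" for n M e w
  proof (rule tendsto_upperbound)
    show "(\<lambda>m. norm (fam_at (X n) w - fam_at (X m) w)) \<longlonglongrightarrow> norm (fam_at (X n) w - L w)"
      by (intro tendsto_intros L)
    show "\<forall>\<^sub>F m in sequentially. norm (fam_at (X n) w - fam_at (X m) w) \<le> e"
      unfolding eventually_sequentially using diff that by (meson order_trans)
  qed simp
  obtain M0 where M0: "\<forall>m\<ge>M0. \<forall>n\<ge>M0. norm (X m - X n) < 1"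
    using CauchyD[OF C, of 1] by auto
  have "norm (fam_at (X M0) w - L w) \<le> 1" for w
    by (rule close[of M0]) (use M0 in \<open>auto intro: less_imp_le\<close>)
  then have "norm (L w) \<le> norm (X M0) + 1" for w
    using norm_fam_at[of "X M0" w] norm_triangle_sub[of "L w" "fam_at (X M0) w"]
    by (metis add_mono norm_minus_commute order_trans)
  then have "bounded (range L)" by (rule bounded_familyI)
  then have at: "fam_at (Abs_fam L) = L" by (simp add: Abs_fam_inverse)
  have "X \<longlonglongrightarrow> Abs_fam L"
  proof (rule LIMSEQ_I)
    fix r :: real assume "0 < r"
    then obtain M where M: "\<forall>m\<ge>M. \<forall>n\<ge>M. norm (X m - X n) < r / 2"
      using CauchyD[OF C, of "r / 2"] by auto
    have "norm (X n - Abs_fam L) \<le> r / 2" if "n \<ge> M" for n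
      by (rule norm_fam_leI, unfold minus_fam.rep_eq at, rule close[of M])
         (use M that in \<open>auto intro: less_imp_le\<close>)
    then show "\<exists>M. \<forall>n\<ge>M. norm (X n - Abs_fam L) < r"
      using \<open>0 < r\<close> by (intro exI[of _ M]) (auto intro: le_less_trans[where y = "r / 2"])
  qed
  then show "convergent X" by (auto simp: convergent_def)
qed

lift_definition cscale_fam :: "complex \<Rightarrow> ('w, 'a) fam \<Rightarrow> ('w, 'a) fam" is
  "\<lambda>c A w. cscale_opr c (A w)"
proof -
  fix c and A :: "'w \<Rightarrow> 'a opr"
  assume "bounded (range A)"
  then obtain K where K: "\<And>w. norm (A w) \<le> K" by (rule bounded_familyE) blast
  have "norm (cscale_opr c B) \<le> cmod c * norm B" for B :: "'a opr"
    unfolding norm_opr.rep_eq cscale_opr.rep_eq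
  proof (rule norm_blinfun_bound)
    fix x
    show "norm (blinfun_apply (Blinfun (\<lambda>x. c *\<^sub>C x) o\<^sub>L opr_blinfun B) x)
        \<le> cmod c * norm (opr_blinfun B) * norm x"
      using norm_blinfun[of "opr_blinfun B" x]
      by (simp add: bounded_linear_Blinfun_apply bounded_linear_cscale mult.assoc mult_left_mono)
  qed simp
  then have "norm (cscale_opr c (A w)) \<le> cmod c * K" for w
    by (meson K mult_left_mono norm_ge_zero order_trans)
  then show "bounded (range (\<lambda>w. cscale_opr c (A w)))" by (rule bounded_familyI)
qed

lift_definition star :: "('w, 'a) fam \<Rightarrow> ('w, 'a) fam" is "\<lambda>A w. adj (A w)"
  by (auto elim!: bounded_familyE intro: bounded_familyI order_trans[OF norm_adj_le])

definition fam_pos_semidef :: "('w, 'a) fam \<Rightarrow> bool" where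
  "fam_pos_semidef A \<longleftrightarrow> (\<forall>w. pos_semidef (fam_at A w))"

definition is_ring_inverse :: "'r::ring_1 \<Rightarrow> 'r \<Rightarrow> bool" where
  "is_ring_inverse a b \<longleftrightarrow> a * b = 1 \<and> b * a = 1"

definition ring_inv :: "'r::ring_1 \<Rightarrow> 'r" where
  "ring_inv a = (THE b. is_ring_inverse a b)"

definition invertible_in :: "'r::ring_1 set \<Rightarrow> 'r \<Rightarrow> bool" where
  "invertible_in R a \<longleftrightarrow> (\<exists>b\<in>R. is_ring_inverse a b)"

lemma ring_inv_eq: "is_ring_inverse a b \<Longrightarrow> ring_inv a = b"
  unfolding ring_inv_def is_ring_inverse_def
  by (rule the_equality) (auto, metis mult.assoc mult_1_left mult_1_right)

text \<open>The action is given by its generators \<open>\<tau> j\<close>, \<open>j < d\<close>; the other values of \<open>\<tau>\<close> are irrelevant.\<close>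

definition lattice_action :: "nat \<Rightarrow> (nat \<Rightarrow> 'w::topological_space \<Rightarrow> 'w) \<Rightarrow> bool" where
  "lattice_action d \<tau> \<longleftrightarrow>
     (\<forall>j<d. \<exists>g. homeomorphism UNIV UNIV (\<tau> j) g) \<and>
     (\<forall>i<d. \<forall>j<d. \<tau> i \<circ> \<tau> j = \<tau> j \<circ> \<tau> i)"

definition invariant_ergodic ::
  "nat \<Rightarrow> (nat \<Rightarrow> 'w::topological_space \<Rightarrow> 'w) \<Rightarrow> 'w measure \<Rightarrow> bool" where
  "invariant_ergodic d \<tau> P \<longleftrightarrow>
     (\<forall>j<d. distr P P (\<tau> j) = P) \<and>
     (\<forall>B\<in>sets P. (\<forall>j<d. \<tau> j -` B = B) \<longrightarrow> measure P B = 0 \<or> measure P B = 1)"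

definition strongly_continuous :: "('w::topological_space, 'a) fam \<Rightarrow> bool" where
  "strongly_continuous A \<longleftrightarrow> (\<forall>x. continuous_on UNIV (\<lambda>w. opr_apply (fam_at A w) x))"

definition covariant :: "(nat \<Rightarrow> 'w \<Rightarrow> 'w) \<Rightarrow> ('w, 'd lattice) fam \<Rightarrow> bool" where
  "covariant \<tau> A \<longleftrightarrow>
     (\<forall>j<CARD('d). \<forall>w. shift j * fam_at A w * adj (shift j) = fam_at A (\<tau> j w))"

definition finite_range :: "('w, 'd lattice) fam \<Rightarrow> bool" where
  "finite_range A \<longleftrightarrow>
     (\<exists>R. \<forall>w n m. lattice_norm (n - m) > R \<longrightarrow> matrix_elem n (fam_at A w) m = 0)"

text \<open>Over a compact space, strongly continuous families are bounded by the uniform boundedness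
  principle, so restricting to the type \<open>fam\<close> loses nothing. That type is a Banach space under
  the supremum norm, so the completion is the closure.\<close>

definition finite_range_algebra ::
  "(nat \<Rightarrow> 'w::topological_space \<Rightarrow> 'w) \<Rightarrow> ('w, 'd lattice) fam set" where
  "finite_range_algebra \<tau> = {A. strongly_continuous A \<and> covariant \<tau> A \<and> finite_range A}"

definition crossed_product ::
  "(nat \<Rightarrow> 'w::topological_space \<Rightarrow> 'w) \<Rightarrow> ('w, 'd lattice) fam set" where
  "crossed_product \<tau> = closure (finite_range_algebra \<tau>)"

definition fam_trace :: "'w measure \<Rightarrow> ('w, 'd lattice) fam \<Rightarrow> complex" where
  "fam_trace P A = (\<integral>w. matrix_elem 0 (fam_at A w) 0 \<partial>P)"

text \<open>The entry \<open>T 1\<close> is never used: it is replaced by the unit.\<close>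

definition transfer_op ::
  "(nat \<Rightarrow> ('w, 'a) fam) \<Rightarrow> (nat \<Rightarrow> ('w, 'a) fam) \<Rightarrow> real \<Rightarrow> nat \<Rightarrow> ('w, 'a) fam ^ 2 ^ 2" where
  "transfer_op T V E n =
     (let t = if n = 1 then 1 else T n in
      vector [vector [(of_real E - V n) * ring_inv t, - star t],
              vector [ring_inv t, 0]])"

primrec transfer_prod ::
  "(nat \<Rightarrow> ('w, 'a) fam) \<Rightarrow> (nat \<Rightarrow> ('w, 'a) fam) \<Rightarrow> real \<Rightarrow> nat \<Rightarrow> ('w, 'a) fam ^ 2 ^ 2" where
  "transfer_prod T V E 0 = mat 1"
| "transfer_prod T V E (Suc n) = transfer_op T V E (Suc n) ** transfer_prod T V E n"

definition column_adj_mult :: "('w, 'a) fam ^ 2 \<Rightarrow> ('w, 'a) fam ^ 2 \<Rightarrow> ('w, 'a) fam" where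
  "column_adj_mult u v = (\<Sum>k\<in>UNIV. star (u $ k) * v $ k)"

definition phase_numerator ::
  "(nat \<Rightarrow> ('w, 'a) fam) \<Rightarrow> (nat \<Rightarrow> ('w, 'a) fam) \<Rightarrow> nat \<Rightarrow> real \<Rightarrow> ('w, 'a) fam" where
  "phase_numerator T V N E =
     column_adj_mult (vector [1, cscale_fam \<i> 1]) (transfer_prod T V E N *v vector [1, 0])"

definition phase_denominator ::
  "(nat \<Rightarrow> ('w, 'a) fam) \<Rightarrow> (nat \<Rightarrow> ('w, 'a) fam) \<Rightarrow> nat \<Rightarrow> real \<Rightarrow> ('w, 'a) fam" where
  "phase_denominator T V N E =
     column_adj_mult (vector [1, cscale_fam (- \<i>) 1]) (transfer_prod T V E N *v vector [1, 0])"

definition prufer_phase ::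
  "(nat \<Rightarrow> ('w, 'a) fam) \<Rightarrow> (nat \<Rightarrow> ('w, 'a) fam) \<Rightarrow> nat \<Rightarrow> real \<Rightarrow> ('w, 'a) fam" where
  "prufer_phase T V N E = phase_numerator T V N E * ring_inv (phase_denominator T V N E)"

definition phase_velocity ::
  "(nat \<Rightarrow> ('w, 'a) fam) \<Rightarrow> (nat \<Rightarrow> ('w, 'a) fam) \<Rightarrow> nat \<Rightarrow> real \<Rightarrow> ('w, 'a) fam" where
  "phase_velocity T V N E =
     cscale_fam (1 / (\<i> * of_nat N))
       (star (prufer_phase T V N E) * vector_derivative (prufer_phase T V N) (at E))"

end

(* At real energies the columns a_n, b_n of the transfer products satisfy a_n* b_n = b_n* a_n, and
   the form b_n* a_n' - a_n* b_n' is the sum of the b_k* b_k, k = 1..n. As the numerator a_N - i b_N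
   and the denominator d = a_N + i b_N of the phase have the same absolute value, this gives
   S = (2/N) sum_k (b_k d^-1)* (b_k d^-1), which is positive.

   For Im z >= 0 the denominator d(z) is invertible: one peels off one transfer operator at a time,
   moving a coefficient Z with Im Z > 0 through the upper half-plane by a Moebius map. Hence
   f_V(z) = T(d'(z) d(z)^-1) is holomorphic on the closed upper half-plane, and it is
   N/z + O(1/z^2) because d is a polynomial of degree N with invertible leading coefficient. Closing
   the contour by a semicircle shows that f_V integrates to -i pi N over the real line. Replacing
   (V, z) by (-V, -z) turns the numerator into the denominator up to sign, so by cyclicity of the
   trace T(S) = (- f_{-V}(-E) - f_V(E)) / (i N), whose integral is 2 pi. *)

theory Submission
  imports Defs "HOL-Complex_Analysis.Complex_Analysis"
begin

section \<open>Operators and families\<close>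

text \<open>The trace of the velocity is morally the derivative of an argument of a determinant. The
  algebra has no determinant, and the phase need not commute with its derivative, so traces of
  logarithmic derivatives take the place of a winding number and cyclicity does the work of
  commutation. These operators are not trace class: cyclicity comes from covariance together with
  the invariance of the measure. The denominator is controlled in the upper half-plane and the
  numerator in the lower one, so each contour is closed on its own side, and the reflection merges
  the two cases. The real axis may belong to the contour because the peeling starts at Z = i, which
  is strictly inside. The value -i pi N is minus half of 2 pi i N. As f decays only like 1/z, its
  integral exists merely as a limit over [-r, r]; positivity of S turns that limit into a Lebesgue
  integral. The trace is known to be additive and cyclic only on the crossed product, so all
  inverses have to be found inside it.\<close>

lemma cinner_commute: "cinner y x = cnj (cinner x y)"
  unfolding cinner.rep_eq by (simp flip: infsum_cnj add: mult.commute)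

lemma cinner_self_norm: "cinner x x = of_real ((norm x)\<^sup>2)"
  by (simp add: cinner_self norm_ell2_sq)

lemma cinner_ket: "cinner (ket n) x = ell2_nth x n"
proof -
  have "(\<Sum>\<^sub>\<infinity>i. cnj (ell2_nth (ket n) i) * ell2_nth x i) = (\<Sum>\<^sub>\<infinity>i\<in>{n}. ell2_nth x i)"
    by (rule infsum_cong_neutral) (auto simp: ket.rep_eq)
  then show ?thesis by (simp add: cinner.rep_eq)
qed

text \<open>The inherited Cauchy-Schwarz inequality sees only the real part; rotating
  \<open>y\<close> by a unit scalar makes the complex inner product real and nonnegative.\<close>

lemma norm_cinner_le: "cmod (cinner x y) \<le> norm x * norm y"
proof (cases "cinner x y = 0")
  case False
  define c where "c = cnj (cinner x y) / cmod (cinner x y)"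
  have c: "cmod c = 1" using False by (simp add: c_def norm_divide)
  have "cinner x (c *\<^sub>C y) = of_real (cmod (cinner x y))"
    using False
    by (simp add: cinner_cscale_right c_def mult.commute complex_norm_square[symmetric] power2_eq_square)
  then have "cmod (cinner x y) = inner x (c *\<^sub>C y)" by (simp add: inner_ell2_def)
  also have "\<dots> \<le> norm x * norm (c *\<^sub>C y)" by (rule norm_cauchy_schwarz)
  finally show ?thesis using c by simp
qed simp

lemma norm_ket [simp]: "norm (ket n) = 1"
proof -
  have "of_real ((norm (ket n))\<^sup>2) = (1 :: complex)"
    unfolding cinner_self_norm[symmetric] cinner_ket by (simp add: ket.rep_eq)
  then have "(norm (ket n))\<^sup>2 = 1" by (simp only: of_real_eq_1_iff)
  then show ?thesis using norm_ge_zero[of "ket n"] by (auto simp: power2_eq_1_iff)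
qed

lemma cscale_of_real: "of_real r *\<^sub>C x = r *\<^sub>R x"
  by transfer (simp add: scaleR_conv_of_real)

lemma opr_apply_simps [simp]:
  "opr_apply (A * B) x = opr_apply A (opr_apply B x)"
  "opr_apply (A + B) x = opr_apply A x + opr_apply B x"
  "opr_apply (A - B) x = opr_apply A x - opr_apply B x"
  "opr_apply (- A) x = - opr_apply A x"
  "opr_apply (r *\<^sub>R A) x = r *\<^sub>R opr_apply A x"
  "opr_apply 1 x = x" "opr_apply 0 x = 0"
  "opr_apply (cscale_opr c A) x = c *\<^sub>C opr_apply A x"
  unfolding opr_apply_def
  by (transfer; simp add: blinfun.bilinear_simps bounded_linear_Blinfun_apply bounded_linear_cscale)+

lemma opr_apply_linear [simp]:
  "opr_apply A (x + y) = opr_apply A x + opr_apply A y"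
  "opr_apply A (x - y) = opr_apply A x - opr_apply A y"
  "opr_apply A (- x) = - opr_apply A x"
  "opr_apply A 0 = 0"
  by (simp_all add: opr_apply_def blinfun.bilinear_simps)

lemma norm_opr_leI: "0 \<le> K \<Longrightarrow> (\<And>x. norm (opr_apply A x) \<le> K * norm x) \<Longrightarrow> norm A \<le> K"
  unfolding opr_apply_def norm_opr.rep_eq by (rule norm_blinfun_bound)

lemma cinner_zero_right [simp]: "cinner x 0 = 0"
  using cinner_commute[of 0 x] by simp

lemma cinner_minus_left [simp]: "cinner (- x) y = - cinner x y"
  and cinner_minus_right [simp]: "cinner x (- y) = - cinner x y"
  using cinner_add_left[of "- x" x y] cinner_add_right[of x "- y" y]
  by (simp_all add: add_eq_0_iff2 add_eq_0_iff)

lemma cinner_diff_right: "cinner x (y - z) = cinner x y - cinner x z"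
  using cinner_add_right[of x y "- z"] by simp

lemma cinner_adj_left: "cinner (opr_apply (adj A) x) y = cinner x (opr_apply A y)"
  by (metis cinner_adj cinner_commute)

lemma adj_adj [simp]: "adj (adj A) = A"
  by (rule adj_unique) (rule cinner_adj_left)

lemma adj_mult: "adj (A * B) = adj B * adj A"
  by (rule adj_unique) (simp add: cinner_adj)

lemma adj_add: "adj (A + B) = adj A + adj B"
  by (rule adj_unique) (simp add: cinner_adj cinner_add_left cinner_add_right)

lemma adj_cscale: "adj (cscale_opr c A) = cscale_opr (cnj c) (adj A)"
  by (rule adj_unique) (simp add: cinner_adj cinner_cscale_left cinner_cscale_right)

lemma adj_one [simp]: "adj 1 = 1"
  by (rule adj_unique) simp

lemma fam_eqI: "(\<And>w. fam_at A w = fam_at B w) \<Longrightarrow> A = B"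
  by (simp add: fam_at_inject[symmetric] fun_eq_iff)

lemmas fam_at_simps [simp] = times_fam.rep_eq plus_fam.rep_eq minus_fam.rep_eq uminus_fam.rep_eq
  one_fam.rep_eq zero_fam.rep_eq scaleR_fam.rep_eq star.rep_eq cscale_fam.rep_eq

lemma star_star [simp]: "star (star A) = A"
  and star_mult: "star (A * B) = star B * star A"
  and star_add: "star (A + B) = star A + star B"
  and star_cscale: "star (cscale_fam c A) = cscale_fam (cnj c) (star A)"
  and star_one [simp]: "star 1 = 1"
  by (rule fam_eqI, simp add: adj_mult adj_add adj_cscale)+

lemma cscale_fam_of_real: "cscale_fam (of_real r) A = r *\<^sub>R A"
  by (rule fam_eqI, rule opr_eqI) (simp add: cscale_of_real)

lemma star_scaleR: "star (r *\<^sub>R A) = r *\<^sub>R star A"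
  using star_cscale[of "of_real r" A] by (simp add: cscale_fam_of_real)

lemma norm_star_le: "norm (star A) \<le> norm A"
  by (rule norm_fam_leI) (metis norm_adj_le norm_fam_at order_trans star.rep_eq)

lemma bounded_linear_star: "bounded_linear star"
  by (rule bounded_linear_intro[where K = 1]) (auto simp: star_add star_scaleR norm_star_le)

lemmas star_minus = linear_neg[OF bounded_linear.linear, OF bounded_linear_star]
  and star_diff = linear_diff[OF bounded_linear.linear, OF bounded_linear_star]
  and star_zero = linear_0[OF bounded_linear.linear, OF bounded_linear_star]

text \<open>The type is only a real algebra. Complex scalars become central elements, so that ring
  rewriting applies to them.\<close>

definition cconst :: "complex \<Rightarrow> ('w, 'a) fam" where
  "cconst c = cscale_fam c 1"

lemma fam_at_cconst: "opr_apply (fam_at (cconst c) w) x = c *\<^sub>C x"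
  by (simp add: cconst_def)

lemma cscale_fam_eq: "cscale_fam c A = cconst c * A"
  by (rule fam_eqI, rule opr_eqI) (simp add: cconst_def)

lemma cconst_commute: "A * cconst c = cconst c * A"
  by (rule fam_eqI, rule opr_eqI) (simp add: fam_at_cconst opr_apply_cscale)

lemma cconst_left_commute: "A * (cconst c * B) = cconst c * (A * B)"
  by (metis cconst_commute mult.assoc)

lemma cscale_add_left: "(c + d) *\<^sub>C x = c *\<^sub>C x + d *\<^sub>C x"
  by transfer (simp add: algebra_simps)

lemma cconst_add: "cconst (c + d) = cconst c + cconst d"
  by (rule fam_eqI, rule opr_eqI) (simp add: fam_at_cconst cscale_add_left)

lemma cconst_mult: "cconst (c * d) = cconst c * cconst d"
  by (rule fam_eqI, rule opr_eqI) (simp add: fam_at_cconst cscale_cscale)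

lemma cconst_of_real: "cconst (of_real r) = of_real r"
  unfolding cconst_def cscale_fam_of_real by (simp add: of_real_def)

lemma cconst_0 [simp]: "cconst 0 = 0" and cconst_1 [simp]: "cconst 1 = 1"
  using cconst_of_real[of 0] cconst_of_real[of 1] by simp_all

lemma norm_cconst [simp]: "norm (cconst c :: ('w, 'a) fam) = cmod c"
proof (rule antisym)
  show "norm (cconst c :: ('w, 'a) fam) \<le> cmod c"
    by (intro norm_fam_leI norm_opr_leI) (simp_all add: fam_at_cconst)
  have "cmod c * norm (ket undefined :: 'a ell2)
      \<le> norm (fam_at (cconst c :: ('w, 'a) fam) undefined) * norm (ket undefined :: 'a ell2)"
    by (metis fam_at_cconst norm_cscale norm_opr_apply)
  then show "cmod c \<le> norm (cconst c :: ('w, 'a) fam)"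
    using norm_fam_at[of "cconst c :: ('w, 'a) fam" undefined] by simp
qed

lemma bounded_linear_cconst: "bounded_linear (cconst :: complex \<Rightarrow> ('w, 'a) fam)"
proof (rule bounded_linear_intro[where K = 1])
  show "cconst (r *\<^sub>R c) = r *\<^sub>R (cconst c :: ('w, 'a) fam)" for r c
    by (simp add: scaleR_conv_of_real cconst_mult cconst_of_real)
qed (simp_all add: cconst_add)

lemma star_cconst: "star (cconst c) = cconst (cnj c)"
  by (simp add: cconst_def star_cscale)

lemmas cconst_minus = linear_neg[OF bounded_linear.linear, OF bounded_linear_cconst]
  and cconst_diff = linear_diff[OF bounded_linear.linear, OF bounded_linear_cconst]

section \<open>The crossed product as a star algebra\<close>

lemma lattice_norm_L2: "lattice_norm (n :: 'd lattice) = L2_set (\<lambda>i. real_of_int (coord n i)) {..<CARD('d)}"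
  by (simp add: lattice_norm_def L2_set_def)

lemma lattice_norm_triangle: "lattice_norm (m + n) \<le> lattice_norm m + lattice_norm n"
  unfolding lattice_norm_L2 plus_lattice.rep_eq of_int_add by (rule L2_set_triangle_ineq)

lemma lattice_norm_minus_commute: "lattice_norm (m - n) = lattice_norm (n - m)"
  unfolding lattice_norm_def minus_lattice.rep_eq of_int_diff by (simp add: power2_commute)

text \<open>This makes every row and column of a finite-range operator a finite sum.\<close>

lemma finite_lattice_ball: "finite {n :: 'd lattice. lattice_norm n \<le> R}"
proof (rule finite_imageD)
  let ?B = "{- \<lfloor>R\<rfloor>..\<lfloor>R\<rfloor>}"
  have "\<bar>coord n i\<bar> \<le> \<lfloor>R\<rfloor>" if "lattice_norm n \<le> R" "i < CARD('d)" for n :: "'d lattice" and i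
  proof -
    have "(real_of_int (coord n i))\<^sup>2 \<le> (\<Sum>i<CARD('d). (real_of_int (coord n i))\<^sup>2)"
      using that by (intro member_le_sum) auto
    then have "\<bar>real_of_int (coord n i)\<bar> \<le> lattice_norm n"
      unfolding lattice_norm_def by (intro real_le_rsqrt) simp
    then show ?thesis using that by (simp add: le_floor_iff)
  qed
  then have "coord n i \<in> ?B" if "lattice_norm n \<le> R" "i < CARD('d)" for n :: "'d lattice" and i
    using that by (metis abs_le_iff atLeastAtMost_iff minus_le_iff)
  moreover have "coord n i = 0" if "\<not> i < CARD('d)" for n :: "'d lattice" and i
    using coord[of n] that by simp
  ultimately have "coord ` {n :: 'd lattice. lattice_norm n \<le> R} \<subseteq>
      {f. \<forall>i. (i \<in> {..<CARD('d)} \<longrightarrow> f i \<in> ?B) \<and> (i \<notin> {..<CARD('d)} \<longrightarrow> f i = 0)}"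
    unfolding lessThan_iff by blast
  then show "finite (coord ` {n :: 'd lattice. lattice_norm n \<le> R})"
    by (rule finite_subset) (intro finite_set_of_finite_funs finite_lessThan finite_atLeastAtMost_int)
qed (simp add: inj_on_def coord_inject)

lemma translate_translate: "translate g (translate h x) = translate (g + h) x"
  by (simp add: ell2_nth_inject[symmetric] translate.rep_eq algebra_simps)

lemma translate_0 [simp]: "translate 0 x = x"
  by (simp add: ell2_nth_inject[symmetric] translate.rep_eq)

lemma cinner_translate: "cinner (translate g x) y = cinner x (translate (- g) y)"
proof -
  have "bij (\<lambda>n. n + g)" by (rule bij_betw_byWitness[where f' = "\<lambda>n. n - g"]) auto
  from infsum_reindex_bij_betw[OF this, of "\<lambda>n. cnj (ell2_nth (translate g x) n) * ell2_nth y n"]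
  show ?thesis by (simp add: cinner.rep_eq translate.rep_eq)
qed

lemma opr_apply_adj_shift: "opr_apply (adj (shift j)) = translate (- basis_vec j)"
  by (rule ext, rule cinner_right_eqI)
     (simp add: opr_apply_shift cinner_translate flip: cinner_adj)

lemma shift_unitary: "adj (shift j) * shift j = 1" "shift j * adj (shift j) = 1"
  by (rule opr_eqI, simp add: opr_apply_shift opr_apply_adj_shift translate_translate)+

lemma matrix_elem_adj: "matrix_elem n (adj A) m = cnj (matrix_elem m A n)"
  unfolding matrix_elem_def by (metis cinner_adj cinner_commute)

lemma opr_apply_sum: "opr_apply A (\<Sum>i\<in>F. f i) = (\<Sum>i\<in>F. opr_apply A (f i))"
  by (rule linear_sum[OF bounded_linear.linear[OF bounded_linear_opr_apply]])

lemma bounded_linear_cinner_right: "bounded_linear (cinner x)"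
proof (rule bounded_linear_intro[where K = "norm x"])
  show "cinner x (r *\<^sub>R y) = r *\<^sub>R cinner x y" for r y
    by (simp add: cinner_cscale_right scaleR_conv_of_real flip: cscale_of_real)
  show "norm (cinner x y) \<le> norm y * norm x" for y
    by (metis norm_cinner_le mult.commute)
qed (rule cinner_add_right)

text \<open>Expand \<open>opr_apply B (ket m)\<close> in the basis; the truncations converge and
  \<open>A\<close> is continuous.\<close>

lemma matrix_elem_mult:
  "((\<lambda>k. matrix_elem n A k * matrix_elem k B m) has_sum matrix_elem n (A * B) m) UNIV"
proof -
  have "((\<lambda>F. cinner (ket n) (opr_apply A (\<Sum>k\<in>F. ell2_nth (opr_apply B (ket m)) k *\<^sub>C ket k)))
      \<longlongrightarrow> cinner (ket n) (opr_apply A (opr_apply B (ket m)))) (finite_subsets_at_top UNIV)"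
    by (intro bounded_linear.tendsto[OF bounded_linear_cinner_right]
        bounded_linear.tendsto[OF bounded_linear_opr_apply] trunc_tendsto)
  then show ?thesis
    by (simp add: has_sum_def opr_apply_sum opr_apply_cscale matrix_elem_def cinner_cscale_right
        linear_sum[OF bounded_linear.linear[OF bounded_linear_cinner_right]]
        cinner_ket[of _ "opr_apply B (ket m)"] mult.commute)
qed

lemma norm_matrix_elem_le: "cmod (matrix_elem n A m) \<le> norm A"
  using norm_cinner_le[of "ket n" "opr_apply A (ket m)"] norm_opr_apply[of A "ket m"]
  by (simp add: matrix_elem_def)

lemma finite_range_mult:
  assumes "finite_range A" "finite_range B"
  shows "finite_range (A * B)"
proof -
  obtain R S where R: "\<And>w n m. lattice_norm (n - m) > R \<Longrightarrow> matrix_elem n (fam_at A w) m = 0"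
    and S: "\<And>w n m. lattice_norm (n - m) > S \<Longrightarrow> matrix_elem n (fam_at B w) m = 0"
    using assms unfolding finite_range_def by blast
  have "matrix_elem n (fam_at (A * B) w) m = 0" if "lattice_norm (n - m) > R + S" for w n m
  proof -
    have "matrix_elem n (fam_at A w) k * matrix_elem k (fam_at B w) m = 0" for k
    proof -
      have "lattice_norm (n - m) \<le> lattice_norm (n - k) + lattice_norm (k - m)"
        using lattice_norm_triangle[of "n - k" "k - m"] by simp
      with that have "lattice_norm (n - k) > R \<or> lattice_norm (k - m) > S" by linarith
      then show ?thesis using R S by auto
    qed
    then show ?thesis
      using has_sum_unique[OF matrix_elem_mult[of n "fam_at A w" "fam_at B w" m] has_sum_0] by simp
  qed
  then show ?thesis unfolding finite_range_def by blast
qed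

lemma strongly_continuous_tendsto:
  "strongly_continuous A \<longleftrightarrow> (\<forall>x w. ((\<lambda>w. opr_apply (fam_at A w) x) \<longlongrightarrow> opr_apply (fam_at A w) x) (at w))"
  by (simp add: strongly_continuous_def continuous_on_def)

lemma norm_fam_apply: "norm (opr_apply (fam_at A w) x) \<le> norm A * norm x"
  by (meson mult_right_mono norm_fam_at norm_ge_zero norm_opr_apply order_trans)

text \<open>Split into A_v (B_v x - B_w x) and (A_v - A_w) B_w x. The uniform bound on the family
  \<open>A\<close> controls the first term.\<close>

lemma strongly_continuous_mult:
  assumes A: "strongly_continuous A" and B: "strongly_continuous B"
  shows "strongly_continuous (A * B)"
  unfolding strongly_continuous_tendsto
proof (intro allI)
  fix x w
  have "((\<lambda>v. opr_apply (fam_at B v) x - opr_apply (fam_at B w) x) \<longlongrightarrow> 0) (at w)"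
    using B unfolding strongly_continuous_tendsto by (simp add: LIM_zero)
  then have "((\<lambda>v. norm A * norm (opr_apply (fam_at B v) x - opr_apply (fam_at B w) x)) \<longlongrightarrow> 0) (at w)"
    by (intro tendsto_mult_right_zero tendsto_norm_zero)
  then have 1: "((\<lambda>v. opr_apply (fam_at A v) (opr_apply (fam_at B v) x - opr_apply (fam_at B w) x))
      \<longlongrightarrow> 0) (at w)"
    by (rule Lim_null_comparison[rotated]) (simp add: norm_fam_apply del: opr_apply_linear)
  have 2: "((\<lambda>v. opr_apply (fam_at A v) (opr_apply (fam_at B w) x))
      \<longlongrightarrow> opr_apply (fam_at A w) (opr_apply (fam_at B w) x)) (at w)"
    using A unfolding strongly_continuous_tendsto by blast
  show "((\<lambda>w. opr_apply (fam_at (A * B) w) x) \<longlongrightarrow> opr_apply (fam_at (A * B) w) x) (at w)"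
    using tendsto_add[OF 1 2] by simp
qed

lemma continuous_matrix_elem:
  assumes "strongly_continuous A"
  shows "continuous_on UNIV (\<lambda>w. matrix_elem n (fam_at A w) m)"
  unfolding matrix_elem_def using assms
  by (intro bounded_linear.continuous_on[OF bounded_linear_cinner_right])
     (simp add: strongly_continuous_def)

text \<open>For families of infinite range the strong continuity of the adjoint may fail.\<close>

lemma strongly_continuous_star:
  fixes A :: "('w::topological_space, 'd lattice) fam"
  assumes A: "strongly_continuous A" and "finite_range A"
  shows "strongly_continuous (star A)"
proof -
  obtain R where R: "\<And>w n m. lattice_norm (n - m) > R \<Longrightarrow> matrix_elem n (fam_at A w) m = 0"
    using assms unfolding finite_range_def by blast
  have ket: "continuous_on UNIV (\<lambda>w. opr_apply (fam_at (star A) w) (ket m))" for m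
  proof -
    \<comment> \<open>The ball of radius \<open>R\<close> about \<open>m\<close> supports column
      \<open>m\<close> of the adjoint for every \<open>w\<close>, so that column is a finite sum
      with continuous coefficients.\<close>
    define F where "F = (\<lambda>n. n + m) ` {n :: 'd lattice. lattice_norm n \<le> R}"
    have F: "finite F" unfolding F_def by (intro finite_imageI finite_lattice_ball)
    have out: "cnj (matrix_elem m (fam_at A w) n) = 0" if "n \<notin> F" for w n
    proof -
      have "n \<in> F" if "lattice_norm (n - m) \<le> R"
        unfolding F_def using that by (intro image_eqI[of _ _ "n - m"]) auto
      with that have "lattice_norm (n - m) > R" by force
      then show ?thesis using R[of m n] by (simp add: lattice_norm_minus_commute)
    qed
    have nth: "ell2_nth (opr_apply (fam_at (star A) w) (ket m)) n = cnj (matrix_elem m (fam_at A w) n)"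
      for w n
      using matrix_elem_adj[of n "fam_at A w" m] by (simp add: matrix_elem_def cinner_ket)
    have "opr_apply (fam_at (star A) w) (ket m) = (\<Sum>n\<in>F. cnj (matrix_elem m (fam_at A w) n) *\<^sub>C ket n)"
      for w
      unfolding ell2_nth_inject[symmetric] by (rule ext) (use out in \<open>auto simp: nth[unfolded star.rep_eq] ell2_nth_trunc[OF F]\<close>)
    moreover have cont: "continuous_on UNIV (\<lambda>w. c w *\<^sub>C ket n)"
      if "continuous_on UNIV c" for c :: "'w \<Rightarrow> complex" and n :: "'d lattice"
    proof -
      have "bounded_linear (\<lambda>c. c *\<^sub>C ket n)"
        by (rule bounded_linear_intro[where K = 1])
           (auto simp: cscale_add_left scaleR_conv_of_real cscale_of_real simp flip: cscale_cscale)
      then show ?thesis using that by (rule bounded_linear.continuous_on)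
    qed
    ultimately show ?thesis
      by (simp only:) (intro continuous_on_sum cont continuous_on_cnj continuous_matrix_elem A)
  qed
  \<comment> \<open>Continuity passes from basis vectors to \<open>x\<close> because truncations of
    \<open>x\<close> converge uniformly in \<open>w\<close>, by the bound
    \<open>norm (star A)\<close>.\<close>
  have "continuous_on UNIV (\<lambda>w. opr_apply (fam_at (star A) w) x)" for x
  proof (rule uniform_limit_theorem[of _ "\<lambda>F w. opr_apply (fam_at (star A) w) (\<Sum>j\<in>F. ell2_nth x j *\<^sub>C ket j)"
        "finite_subsets_at_top UNIV"])
    let ?t = "\<lambda>F. \<Sum>j\<in>F. ell2_nth x j *\<^sub>C ket j"
    show "\<forall>\<^sub>F F in finite_subsets_at_top UNIV. continuous_on UNIV (\<lambda>w. opr_apply (fam_at (star A) w) (?t F))"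
      unfolding opr_apply_sum opr_apply_cscale
      by (intro always_eventually allI continuous_on_sum bounded_linear.continuous_on[OF bounded_linear_cscale] ket)
    have "((\<lambda>F. norm (star A) * norm (?t F - x)) \<longlongrightarrow> 0) (finite_subsets_at_top UNIV)"
      by (intro tendsto_mult_right_zero tendsto_norm_zero LIM_zero trunc_tendsto)
    then have "\<forall>\<^sub>F F in finite_subsets_at_top UNIV. norm (star A) * norm (?t F - x) < e" if "e > 0"
      for e
      using that by (rule order_tendstoD)
    moreover have "dist (opr_apply (fam_at (star A) w) y) (opr_apply (fam_at (star A) w) x)
        \<le> norm (star A) * norm (y - x)" for w y
      unfolding dist_norm opr_apply_linear[symmetric] by (rule norm_fam_apply)
    ultimately show "uniform_limit UNIV (\<lambda>F w. opr_apply (fam_at (star A) w) (?t F))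
        (\<lambda>w. opr_apply (fam_at (star A) w) x) (finite_subsets_at_top UNIV)"
      unfolding uniform_limit_iff by (blast intro: eventually_mono le_less_trans)
  qed simp
  then show ?thesis by (simp add: strongly_continuous_def)
qed

lemma finite_range_algebra_star:
  fixes A :: "('w::topological_space, 'd lattice) fam"
  shows "A \<in> finite_range_algebra \<tau> \<Longrightarrow> star A \<in> finite_range_algebra \<tau>"
  unfolding finite_range_algebra_def
proof (intro CollectI conjI; elim CollectE conjE)
  assume "strongly_continuous A" "finite_range A"
  then show "strongly_continuous (star A)" by (rule strongly_continuous_star)
next
  assume "covariant \<tau> A"
  then have "fam_at A (\<tau> j w) = shift j * fam_at A w * adj (shift j)" if "j < CARD('d)" for j w
    using that by (simp add: covariant_def)
  then show "covariant \<tau> (star A)"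
    unfolding covariant_def by (simp add: adj_mult mult.assoc)
next
  assume "finite_range A"
  then show "finite_range (star A)"
    unfolding finite_range_def by (simp add: matrix_elem_adj) (metis lattice_norm_minus_commute)
qed

lemma finite_range_algebra_mult:
  fixes A B :: "('w::topological_space, 'd lattice) fam"
  assumes "A \<in> finite_range_algebra \<tau>" "B \<in> finite_range_algebra \<tau>"
  shows "A * B \<in> finite_range_algebra \<tau>"
proof -
  have split: "shift j * (fam_at A w * fam_at B w) * adj (shift j)
      = (shift j * fam_at A w * adj (shift j)) * (shift j * fam_at B w * adj (shift j))" for j w
  proof -
    have "adj (shift j) * (shift j * X) = X" for X :: "'d lattice opr"
      by (simp add: shift_unitary(1) flip: mult.assoc)
    then show ?thesis by (simp add: mult.assoc)
  qed
  have "covariant \<tau> (A * B)"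
    using assms unfolding finite_range_algebra_def covariant_def times_fam.rep_eq split by simp
  then show ?thesis
    using assms unfolding finite_range_algebra_def
    by (simp add: strongly_continuous_mult finite_range_mult)
qed

lemma matrix_elem_simps:
  "matrix_elem n (A + B) m = matrix_elem n A m + matrix_elem n B m"
  "matrix_elem n (cscale_opr c A) m = c * matrix_elem n A m"
  "matrix_elem n (A - B) m = matrix_elem n A m - matrix_elem n B m"
  by (simp_all add: matrix_elem_def cinner_add_right cinner_cscale_right cinner_diff_right)

lemma finite_range_algebra_add:
  assumes A: "A \<in> finite_range_algebra \<tau>" and B: "B \<in> finite_range_algebra \<tau>"
  shows "A + B \<in> finite_range_algebra \<tau>"
proof -
  have "finite_range (A + B)"
  proof -
    obtain R S where "\<And>w n m. lattice_norm (n - m) > R \<Longrightarrow> matrix_elem n (fam_at A w) m = 0"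
      and "\<And>w n m. lattice_norm (n - m) > S \<Longrightarrow> matrix_elem n (fam_at B w) m = 0"
      using A B unfolding finite_range_algebra_def finite_range_def by blast
    then show ?thesis
      unfolding finite_range_def by (intro exI[of _ "max R S"]) (simp add: matrix_elem_simps)
  qed
  then show ?thesis
    using A B unfolding finite_range_algebra_def strongly_continuous_def covariant_def
    by (auto simp: algebra_simps intro: continuous_on_add)
qed

lemma finite_range_algebra_cscale:
  fixes A :: "('w::topological_space, 'd lattice) fam"
  assumes A: "A \<in> finite_range_algebra \<tau>"
  shows "cscale_fam c A \<in> finite_range_algebra \<tau>"
proof -
  have "covariant \<tau> (cscale_fam c A)"
  proof -
    have "shift j * cscale_opr c B * adj (shift j) = cscale_opr c (shift j * B * adj (shift j))"
      for j and B :: "'d lattice opr"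
      by (rule opr_eqI) (simp add: opr_apply_cscale)
    then show ?thesis using A unfolding finite_range_algebra_def covariant_def by simp
  qed
  moreover have "finite_range (cscale_fam c A)"
    using A unfolding finite_range_algebra_def finite_range_def by (auto simp: matrix_elem_simps) 
  ultimately show ?thesis
    using A unfolding finite_range_algebra_def strongly_continuous_def
    by (auto intro: bounded_linear.continuous_on[OF bounded_linear_cscale])
qed

lemma finite_range_algebra_one:
  "(1 :: ('w::topological_space, 'd lattice) fam) \<in> finite_range_algebra \<tau>"
proof -
  have "lattice_norm (0 :: 'd lattice) = 0" by (simp add: lattice_norm_def zero_lattice.rep_eq)
  then have "finite_range (1 :: ('w, 'd lattice) fam)"
    unfolding finite_range_def
    by (intro exI[of _ 0]) (auto simp: matrix_elem_def cinner_ket ket.rep_eq)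
  then show ?thesis
    unfolding finite_range_algebra_def strongly_continuous_def covariant_def
    by (simp add: shift_unitary)
qed

text \<open>Carries the algebra operations from finite range to the norm closure; a unary operation
  is treated as one that ignores its second argument.\<close>

lemma closure_image2:
  fixes f :: "'a::first_countable_topology \<Rightarrow> 'b::first_countable_topology \<Rightarrow> 'c::first_countable_topology"
  assumes "A \<in> closure S" "B \<in> closure S'"
    and "\<And>A B. A \<in> S \<Longrightarrow> B \<in> S' \<Longrightarrow> f A B \<in> U"
    and "\<And>X Y A B. X \<longlonglongrightarrow> A \<Longrightarrow> Y \<longlonglongrightarrow> B \<Longrightarrow> (\<lambda>n. f (X n) (Y n)) \<longlonglongrightarrow> f A B"
  shows "f A B \<in> closure U"
proof -
  obtain X Y where "\<forall>n. X n \<in> S" "X \<longlonglongrightarrow> A" "\<forall>n. Y n \<in> S'" "Y \<longlonglongrightarrow> B"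
    using assms(1,2) unfolding closure_sequential by blast
  then show ?thesis
    unfolding closure_sequential using assms(3,4) by (intro exI[of _ "\<lambda>n. f (X n) (Y n)"]) auto
qed

lemma crossed_product_one: "1 \<in> crossed_product \<tau>"
  unfolding crossed_product_def using closure_subset finite_range_algebra_one by blast

lemma crossed_product_mult: "A \<in> crossed_product \<tau> \<Longrightarrow> B \<in> crossed_product \<tau>
    \<Longrightarrow> A * B \<in> crossed_product \<tau>"
  unfolding crossed_product_def
  by (rule closure_image2[where f = "(*)"]) (auto intro: finite_range_algebra_mult tendsto_mult)

lemma crossed_product_add: "A \<in> crossed_product \<tau> \<Longrightarrow> B \<in> crossed_product \<tau>
    \<Longrightarrow> A + B \<in> crossed_product \<tau>"
  unfolding crossed_product_def
  by (rule closure_image2[where f = "(+)"]) (auto intro: finite_range_algebra_add tendsto_add)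

lemma crossed_product_cscale: "A \<in> crossed_product \<tau> \<Longrightarrow> cscale_fam c A \<in> crossed_product \<tau>"
  unfolding crossed_product_def
  by (rule closure_image2[where f = "\<lambda>A _. cscale_fam c A", OF _ _ finite_range_algebra_cscale])
     (auto simp: cscale_fam_eq intro: tendsto_mult)

lemma crossed_product_star: "A \<in> crossed_product \<tau> \<Longrightarrow> star A \<in> crossed_product \<tau>"
  unfolding crossed_product_def
  by (rule closure_image2[where f = "\<lambda>A _. star A", OF _ _ finite_range_algebra_star])
     (auto intro: bounded_linear.tendsto[OF bounded_linear_star])

lemma closed_crossed_product: "closed (crossed_product \<tau>)"
  unfolding crossed_product_def by (rule closed_closure)

section \<open>The trace\<close>

text \<open>Induction on the l1 norm, one generator step towards the origin at a time. The
  hypothesis is an equation, so it also serves for backward steps.\<close>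

lemma lattice_translation_invariant:
  fixes g :: "'d lattice \<Rightarrow> 'b"
  assumes g: "\<And>k j. j < CARD('d) \<Longrightarrow> g (k + basis_vec j) = g k"
  shows "g k = g 0"
proof (induction k rule: measure_induct_rule[where f = "\<lambda>k. \<Sum>i<CARD('d). nat \<bar>coord k i\<bar>"])
  case (less k)
  show ?case
  proof (cases "k = 0")
    case False
    then obtain i where "coord k i \<noteq> 0"
      by (metis coord_inject ext zero_lattice.rep_eq)
    then have i: "i < CARD('d)" "coord k i \<noteq> 0" using coord[of k] by (auto simp: not_le[symmetric])
    have dec: "(\<Sum>i<CARD('d). nat \<bar>coord l i\<bar>) < (\<Sum>i<CARD('d). nat \<bar>coord k i\<bar>)"
      if "\<bar>coord l i\<bar> < \<bar>coord k i\<bar>" "\<And>j. j \<noteq> i \<Longrightarrow> coord l j = coord k j" for l :: "'d lattice"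
    proof (rule sum_strict_mono_ex1)
      show "\<forall>j\<in>{..<CARD('d)}. nat \<bar>coord l j\<bar> \<le> nat \<bar>coord k j\<bar>"
        using that by (metis le_refl nat_mono order_less_imp_le)
      show "\<exists>j\<in>{..<CARD('d)}. nat \<bar>coord l j\<bar> < nat \<bar>coord k j\<bar>"
        using that(1) i by (intro bexI[of _ i]) auto
    qed simp
    show ?thesis
    proof (cases "coord k i > 0")
      case True
      have "g (k - basis_vec i) = g 0"
        by (intro less dec) (use i True in \<open>auto simp: minus_lattice.rep_eq basis_vec.rep_eq\<close>)
      then show ?thesis using g[OF i(1), of "k - basis_vec i"] by simp
    next
      case False
      have "g (k + basis_vec i) = g 0"
        by (intro less dec) (use i False in \<open>auto simp: plus_lattice.rep_eq basis_vec.rep_eq\<close>)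
      then show ?thesis using g[OF i(1), of k] by simp
    qed
  qed simp
qed

lemma matrix_elem_translate:
  fixes A :: "('w, 'd lattice) fam"
  assumes "covariant \<tau> A" "j < CARD('d)"
  shows "matrix_elem (n + basis_vec j) (fam_at A (\<tau> j w)) (m + basis_vec j) = matrix_elem n (fam_at A w) m"
proof -
  have "fam_at A (\<tau> j w) = shift j * fam_at A w * adj (shift j)"
    using assms unfolding covariant_def by simp
  then show ?thesis
    by (simp add: matrix_elem_def opr_apply_shift opr_apply_adj_shift cinner_translate translate_translate
        flip: shift_ket)
qed

text \<open>Norm convergence of finite-range approximants gives pointwise convergence of their
  continuous matrix elements.\<close>

lemma measurable_matrix_elem:
  assumes P: "sets P = sets borel" and A: "A \<in> crossed_product \<tau>"
  shows "(\<lambda>w. matrix_elem n (fam_at A w) m) \<in> borel_measurable P"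
proof -
  obtain X where X: "\<forall>i. X i \<in> finite_range_algebra \<tau>" and lim: "X \<longlonglongrightarrow> A"
    using A unfolding crossed_product_def closure_sequential by blast
  show ?thesis
  proof (rule borel_measurable_LIMSEQ_metric)
    show "(\<lambda>w. matrix_elem n (fam_at (X i) w) m) \<in> borel_measurable P" for i
      using X unfolding finite_range_algebra_def measurable_cong_sets[OF P refl]
      by (intro borel_measurable_continuous_onI continuous_matrix_elem) auto
    show "(\<lambda>i. matrix_elem n (fam_at (X i) w) m) \<longlonglongrightarrow> matrix_elem n (fam_at A w) m" for w
    proof (rule Lim_transform_bound[of _ "\<lambda>i. X i - A", THEN LIM_zero_cancel])
      show "(\<lambda>i. X i - A) \<longlonglongrightarrow> 0" using lim by (rule LIM_zero)
      have "cmod (matrix_elem n (fam_at (X i) w) m - matrix_elem n (fam_at A w) m) \<le> norm (X i - A)"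
        for i
        using norm_matrix_elem_le[of n "fam_at (X i - A) w" m] norm_fam_at[of "X i - A" w]
        by (simp add: matrix_elem_simps)
      then show "\<forall>\<^sub>F i in sequentially. norm (matrix_elem n (fam_at (X i) w) m - matrix_elem n (fam_at A w) m)
          \<le> norm (X i - A)" by simp
    qed
  qed
qed

lemma integrable_matrix_elem:
  assumes "prob_space P" "sets P = sets borel" "A \<in> crossed_product \<tau>"
  shows "integrable P (\<lambda>w. matrix_elem n (fam_at A w) m)"
proof -
  interpret prob_space P by fact
  have "cmod (matrix_elem n (fam_at A w) m) \<le> norm A" for w
    by (meson norm_fam_at norm_matrix_elem_le order_trans)
  then show ?thesis
    using measurable_matrix_elem[OF assms(2,3)] by (intro integrable_const_bound[of _ "norm A"]) auto
qed

lemma fam_trace_add: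
  assumes "prob_space P" "sets P = sets borel" "A \<in> crossed_product \<tau>" "B \<in> crossed_product \<tau>"
  shows "fam_trace P (A + B) = fam_trace P A + fam_trace P B"
  unfolding fam_trace_def plus_fam.rep_eq matrix_elem_simps
  by (intro Bochner_Integration.integral_add integrable_matrix_elem[where \<tau> = \<tau>] assms)

lemma fam_trace_cscale: "fam_trace P (cscale_fam c A) = c * fam_trace P A"
  by (simp add: fam_trace_def matrix_elem_simps)

lemma norm_fam_trace_le:
  assumes "prob_space P"
  shows "cmod (fam_trace P A) \<le> norm A"
proof -
  interpret prob_space P by fact
  have "norm (fam_trace P A) \<le> (\<integral>w. norm (matrix_elem 0 (fam_at A w) 0) \<partial>P)"
    unfolding fam_trace_def by (rule integral_norm_bound)
  also have "\<dots> \<le> (\<integral>w. norm A \<partial>P)"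
    by (intro integral_mono_AE') (auto intro: order_trans[OF norm_matrix_elem_le norm_fam_at])
  finally show ?thesis by (simp add: prob_space)
qed

lemma fam_trace_one:
  assumes "prob_space P"
  shows "fam_trace P 1 = 1"
proof -
  interpret prob_space P by fact
  show ?thesis by (simp add: fam_trace_def matrix_elem_def cinner_ket ket.rep_eq prob_space)
qed

text \<open>The integrand is real and nonnegative; a non-integrable one has integral 0 by
  convention, so the claim covers every positive family.\<close>

lemma fam_trace_pos:
  assumes "fam_pos_semidef A"
  shows "fam_trace P A \<in> \<real>" "0 \<le> Re (fam_trace P A)"
proof -
  define r where "r w = Re (matrix_elem 0 (fam_at A w) 0)" for w
  have "matrix_elem 0 (fam_at A w) 0 = of_real (r w)" and r: "0 \<le> r w" for w
    using assms unfolding fam_pos_semidef_def pos_semidef_def matrix_elem_def r_def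
    by (auto simp: complex_is_Real_iff complex_eq_iff)
  then have "fam_trace P A = of_real (\<integral>w. r w \<partial>P)" by (simp add: fam_trace_def)
  then show "fam_trace P A \<in> \<real>" "0 \<le> Re (fam_trace P A)" using r by simp_all
qed

text \<open>The diagonal element of a product is a finite sum over intermediate sites
  \<open>k\<close>. Covariance and invariance of \<open>P\<close> allow the base point of each
  averaged term to be moved, which exchanges the roles of the two sites.\<close>

lemma fam_trace_cyclic_finite_range:
  fixes A B :: "('w::topological_space, 'd lattice) fam"
  assumes P: "prob_space P" "sets P = sets borel"
    and act: "lattice_action CARD('d) \<tau>" and inv: "invariant_ergodic CARD('d) \<tau> P"
    and A: "A \<in> finite_range_algebra \<tau>" and B: "B \<in> finite_range_algebra \<tau>"
  shows "fam_trace P (A * B) = fam_trace P (B * A)"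
proof -
  interpret prob_space P by fact
  have A': "A \<in> crossed_product \<tau>" and B': "B \<in> crossed_product \<tau>"
    using A B closure_subset unfolding crossed_product_def by blast+
  obtain R S where R: "\<And>w n m. lattice_norm (n - m) > R \<Longrightarrow> matrix_elem n (fam_at A w) m = 0"
    and S: "\<And>w n m. lattice_norm (n - m) > S \<Longrightarrow> matrix_elem n (fam_at B w) m = 0"
    using A B unfolding finite_range_algebra_def finite_range_def mem_Collect_eq by metis
  \<comment> \<open>The larger range lets the same set serve both orders of the product, and the
    ball is symmetric under \<open>k\<close> to \<open>- k\<close>.\<close>
  define F where "F = {n :: 'd lattice. lattice_norm n \<le> max R S}"
  have F: "finite F" unfolding F_def by (rule finite_lattice_ball)
  have [simp]: "lattice_norm (- n) = lattice_norm n" for n :: "'d lattice"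
    using lattice_norm_minus_commute[of 0 n] by simp
  define h where "h C D k l = (\<integral>w. matrix_elem l (fam_at C w) (k + l) * matrix_elem (k + l) (fam_at D w) l \<partial>P)"
    for C D :: "('w, 'd lattice) fam" and k l
  have tr: "fam_trace P (C * D) = (\<Sum>k\<in>F. h C D k 0)"
    if "C \<in> crossed_product \<tau>" "D \<in> crossed_product \<tau>"
      and out: "\<And>k w. k \<notin> F \<Longrightarrow> matrix_elem 0 (fam_at C w) k = 0" for C D
  proof -
    have "matrix_elem 0 (fam_at (C * D) w) 0
        = (\<Sum>k\<in>F. matrix_elem 0 (fam_at C w) k * matrix_elem k (fam_at D w) 0)" for w
    proof (rule has_sum_unique)
      show "((\<lambda>k. matrix_elem 0 (fam_at C w) k * matrix_elem k (fam_at D w) 0) has_sum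
          matrix_elem 0 (fam_at (C * D) w) 0) UNIV"
        by (simp add: matrix_elem_mult)
      show "((\<lambda>k. matrix_elem 0 (fam_at C w) k * matrix_elem k (fam_at D w) 0) has_sum
          (\<Sum>k\<in>F. matrix_elem 0 (fam_at C w) k * matrix_elem k (fam_at D w) 0)) UNIV"
        using has_sum_finite[OF F] by (rule has_sum_cong_neutral[THEN iffD1, rotated -1]) (auto simp: out)
    qed
    moreover have "integrable P (\<lambda>w. matrix_elem 0 (fam_at C w) k * matrix_elem k (fam_at D w) 0)"
      for k
    proof (rule integrable_const_bound[of _ "norm C * norm D"])
      have "cmod (matrix_elem 0 (fam_at C w) k) * cmod (matrix_elem k (fam_at D w) 0) \<le> norm C * norm D" for w
        by (intro mult_mono) (auto intro: order_trans[OF norm_matrix_elem_le norm_fam_at])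
      then show "AE w in P. norm (matrix_elem 0 (fam_at C w) k * matrix_elem k (fam_at D w) 0) \<le> norm C * norm D"
        by (simp add: norm_mult)
    qed (intro borel_measurable_times measurable_matrix_elem[OF P(2), of _ \<tau>] that)
    ultimately show ?thesis
      unfolding fam_trace_def h_def by simp
  qed
  have inv_h: "h A B k (l + basis_vec j) = h A B k l" if j: "j < CARD('d)" for k l j
  proof -
    have "continuous_on UNIV (\<tau> j)"
      using act j unfolding lattice_action_def homeomorphism_def by blast
    then have m: "\<tau> j \<in> measurable P P"
      unfolding measurable_cong_sets[OF P(2) P(2)] by (rule borel_measurable_continuous_onI)
    let ?f = "\<lambda>l w. matrix_elem l (fam_at A w) (k + l) * matrix_elem (k + l) (fam_at B w) l"
    have cov: "covariant \<tau> A" "covariant \<tau> B" using A B unfolding finite_range_algebra_def by auto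
    have "h A B k (l + basis_vec j) = (\<integral>w. ?f (l + basis_vec j) w \<partial>distr P P (\<tau> j))"
      using inv j unfolding invariant_ergodic_def h_def by simp
    also have "\<dots> = (\<integral>w. ?f (l + basis_vec j) (\<tau> j w) \<partial>P)"
      by (intro integral_distr m borel_measurable_times measurable_matrix_elem[OF P(2), where \<tau> = \<tau>] A' B')
    also have "\<dots> = h A B k l"
      using matrix_elem_translate[OF cov(1) j] matrix_elem_translate[OF cov(2) j]
      unfolding h_def add.assoc[symmetric] by simp
    finally show ?thesis .
  qed
  have const_h: "h A B k l = h A B k 0" for k l
    by (rule lattice_translation_invariant) (rule inv_h)
  have "fam_trace P (A * B) = (\<Sum>k\<in>F. h A B k 0)"
    by (rule tr[OF A' B']) (use R in \<open>auto simp: F_def\<close>)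
  \<comment> \<open>With base point \<open>- k\<close> the intermediate site becomes 0, so the term
    is one of the product in reverse order.\<close>
  also have "\<dots> = (\<Sum>k\<in>F. h A B k (- k))"
    by (intro sum.cong refl const_h[symmetric])
  also have "\<dots> = (\<Sum>k\<in>F. h B A (- k) 0)"
    unfolding h_def by (simp add: mult.commute)
  also have "\<dots> = (\<Sum>k\<in>F. h B A k 0)"
    by (rule sum.reindex_bij_witness[of _ uminus uminus]) (auto simp: F_def)
  also have "\<dots> = fam_trace P (B * A)"
    by (rule tr[OF B' A', symmetric]) (use S in \<open>auto simp: F_def\<close>)
  finally show ?thesis .
qed

lemma tendsto_fam_trace:
  fixes A :: "('w::topological_space, 'd lattice) fam"
  assumes P: "prob_space P" "sets P = sets borel"
    and X: "\<And>n. X n \<in> crossed_product \<tau>" "X \<longlonglongrightarrow> A"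
  shows "(\<lambda>n. fam_trace P (X n)) \<longlonglongrightarrow> fam_trace P A"
proof -
  have A: "A \<in> crossed_product \<tau>"
    using closed_crossed_product X by (rule closed_sequentially)
  have neg: "cscale_fam (- 1) A = - A" by (simp add: cscale_fam_eq cconst_minus)
  have diff: "fam_trace P (X n - A) = fam_trace P (X n) - fam_trace P A" for n
    using fam_trace_add[OF P X(1)[of n] crossed_product_cscale[OF A, of "- 1"]] fam_trace_cscale[of P "- 1" A]
    unfolding neg by simp
  have "cmod (fam_trace P (X n) - fam_trace P A) \<le> norm (X n - A)" for n
    unfolding diff[symmetric] by (rule norm_fam_trace_le[OF P(1)])
  then show ?thesis
    by (intro LIM_zero_cancel[OF Lim_transform_bound[OF _ LIM_zero[OF X(2)]]]) simp
qed

lemma fam_trace_cyclic: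
  fixes A B :: "('w::topological_space, 'd lattice) fam"
  assumes P: "prob_space P" "sets P = sets borel"
    and act: "lattice_action CARD('d) \<tau>" and inv: "invariant_ergodic CARD('d) \<tau> P"
    and A: "A \<in> crossed_product \<tau>" and B: "B \<in> crossed_product \<tau>"
  shows "fam_trace P (A * B) = fam_trace P (B * A)"
proof -
  obtain X Y where X: "\<And>n. X n \<in> finite_range_algebra \<tau>" "X \<longlonglongrightarrow> A"
    and Y: "\<And>n. Y n \<in> finite_range_algebra \<tau>" "Y \<longlonglongrightarrow> B"
    using A B unfolding crossed_product_def closure_sequential by blast
  have in_cp: "X n * Y n \<in> crossed_product \<tau>" "Y n * X n \<in> crossed_product \<tau>" for n
    using finite_range_algebra_mult[OF X(1) Y(1)] finite_range_algebra_mult[OF Y(1) X(1)] closure_subset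
    unfolding crossed_product_def by blast+
  have "(\<lambda>n. fam_trace P (X n * Y n)) \<longlonglongrightarrow> fam_trace P (A * B)"
    by (intro tendsto_fam_trace[OF P, where \<tau> = \<tau>] in_cp tendsto_mult X Y)
  moreover have "(\<lambda>n. fam_trace P (Y n * X n)) \<longlonglongrightarrow> fam_trace P (B * A)"
    by (intro tendsto_fam_trace[OF P, where \<tau> = \<tau>] in_cp tendsto_mult X Y)
  moreover have "fam_trace P (X n * Y n) = fam_trace P (Y n * X n)" for n
    by (rule fam_trace_cyclic_finite_range[OF P act inv X(1) Y(1)])
  ultimately show ?thesis using LIMSEQ_unique by simp
qed

section \<open>Transfer operators\<close>

lemma cscale_minus_left: "(- c) *\<^sub>C x = - (c *\<^sub>C x)"
  by transfer simp

text \<open>A case split on the sign avoids moving a power past noncommuting factors.\<close>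

lemma neg_one_power_cases: "(- 1 :: 'r::ring_1) ^ n = 1 \<or> (- 1 :: 'r) ^ n = - 1"
  by (cases "even n") simp_all

text \<open>A norm-closed unital star subalgebra of the bounded families. The operator part of the
  argument needs only this, and no lattice.\<close>

locale star_algebra =
  fixes R :: "('w, 'a) fam set"
  assumes one_mem: "1 \<in> R"
    and mult_mem: "A \<in> R \<Longrightarrow> B \<in> R \<Longrightarrow> A * B \<in> R"
    and add_mem: "A \<in> R \<Longrightarrow> B \<in> R \<Longrightarrow> A + B \<in> R"
    and cscale_mem: "A \<in> R \<Longrightarrow> cscale_fam c A \<in> R"
    and star_mem: "A \<in> R \<Longrightarrow> star A \<in> R"
    and closed_R: "closed R"
begin

lemma cconst_mem: "cconst c \<in> R"
  unfolding cconst_def by (intro cscale_mem one_mem)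

lemma zero_mem: "0 \<in> R"
  using cconst_mem[of 0] by simp

lemma minus_mem: "A \<in> R \<Longrightarrow> - A \<in> R"
  using cscale_mem[of A "-1"] by (simp add: cscale_fam_eq cconst_minus)

lemma diff_mem: "A \<in> R \<Longrightarrow> B \<in> R \<Longrightarrow> A - B \<in> R"
  using add_mem[OF _ minus_mem] by simp

lemma sum_mem: "(\<And>i. i \<in> F \<Longrightarrow> f i \<in> R) \<Longrightarrow> sum f F \<in> R"
  by (induction F rule: infinite_finite_induct) (auto intro: zero_mem add_mem)

lemma power_mem: "A \<in> R \<Longrightarrow> A ^ n \<in> R"
  by (induction n) (auto intro: one_mem mult_mem)

lemmas mem_intros = one_mem mult_mem add_mem cscale_mem star_mem cconst_mem zero_mem minus_mem diff_mem

text \<open>The inverse stays in \<open>R\<close> because the partial sums of the geometric series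
  do and \<open>R\<close> is closed.\<close>

lemma neumann_inverse:
  assumes A: "A \<in> R" and "norm (1 - A) < 1"
  shows "\<exists>B\<in>R. is_ring_inverse A B"
proof
  let ?x = "1 - A" and ?B = "\<Sum>n. (1 - A) ^ n"
  have s: "summable (\<lambda>n. ?x ^ n)" by (rule complete_algebra_summable_geometric) fact
  have tail: "(\<Sum>n. ?x ^ Suc n) = ?B - 1" using suminf_split_head[OF s] by simp
  have "?x * ?B = ?B - 1" unfolding suminf_mult[OF s, symmetric] tail[symmetric] by simp
  moreover have "?B * ?x = ?B - 1"
    unfolding suminf_mult2[OF s] tail[symmetric] by (simp only: power_Suc2)
  ultimately show "is_ring_inverse A ?B"
    by (simp add: is_ring_inverse_def algebra_simps)
  show "?B \<in> R"
  proof (rule closed_sequentially[OF closed_R])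
    show "(\<lambda>n. \<Sum>i<n. ?x ^ i) \<longlonglongrightarrow> ?B" using summable_LIMSEQ[OF s] .
    show "(\<Sum>i<n. ?x ^ i) \<in> R" for n by (intro sum_mem power_mem diff_mem one_mem A)
  qed
qed

end

text \<open>The operator inequality (A - \<open>star A\<close>)/(2i) \<ge> e. Its uniformity in
  \<open>w\<close> is what bounds the inverse family.\<close>

definition imag_ge :: "real \<Rightarrow> ('w, 'a) fam \<Rightarrow> bool" where
  "imag_ge e A \<longleftrightarrow> (\<forall>w x. e * (norm x)\<^sup>2 \<le> Im (cinner x (opr_apply (fam_at A w) x)))"

lemma norm_add_sq: "(norm (x + y :: 'a ell2))\<^sup>2 = (norm x)\<^sup>2 + 2 * Re (cinner x y) + (norm y)\<^sup>2"
  by (simp add: power2_norm_eq_inner inner_add inner_commute[of y x]) (simp add: inner_ell2_def)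

lemma is_ring_inverse_mult:
  assumes "is_ring_inverse a b" "is_ring_inverse c d"
  shows "is_ring_inverse (a * c) (d * b)"
proof -
  have "c * (d * x) = x" "b * (a * x) = x" for x
    using assms by (simp_all add: is_ring_inverse_def flip: mult.assoc)
  then show ?thesis using assms by (simp add: is_ring_inverse_def mult.assoc)
qed

lemma is_ring_inverse_star: "is_ring_inverse A B \<Longrightarrow> is_ring_inverse (star A) (star B)"
  unfolding is_ring_inverse_def by (metis star_mult star_one)

lemma is_ring_inverse_fam_at:
  assumes "is_ring_inverse A B"
  shows "opr_apply (fam_at A w) (opr_apply (fam_at B w) x) = x"
proof -
  have "opr_apply (fam_at (A * B) w) x = x" using assms by (simp add: is_ring_inverse_def)
  then show ?thesis by simp
qed

text \<open>For small \<open>c > 0\<close> the operator \<open>1 + \<i> c A\<close> is a strict contraction, so \<open>- \<i> c A\<close> is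
  inverted by a Neumann series.\<close>

lemma (in star_algebra) imag_ge_invertible:
  assumes A: "A \<in> R" and im: "imag_ge e A" and e: "0 < e"
  shows "\<exists>B\<in>R. is_ring_inverse A B"
proof -
  define K where "K = norm A + 1"
  \<comment> \<open>This \<open>c\<close> minimises the bound 1 - 2ce + c^2 K^2 for the squared norm
    of the contraction; the minimum is 1 - e^2/K^2. The maximum with 0 in \<open>q\<close> keeps the
    square root harmless.\<close>
  define c where "c = e / K\<^sup>2"
  define q where "q = max 0 (1 - e\<^sup>2 / K\<^sup>2)"
  have K: "0 < K" using norm_ge_zero[of A] unfolding K_def by linarith
  have c: "0 < c" using e K by (simp add: c_def)
  have q: "0 \<le> q" "q < 1" using e K by (auto simp: q_def)
  let ?A' = "cconst (- \<i> * of_real c) * A"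
  have "norm (1 - ?A') \<le> sqrt q"
  proof (intro norm_fam_leI norm_opr_leI)
    fix w x
    let ?y = "opr_apply (fam_at A w) x"
    have "norm ?y \<le> K * norm x"
      using norm_fam_apply[of A w x] unfolding K_def by (simp add: distrib_right add_increasing2)
    then have "(norm ?y)\<^sup>2 \<le> K\<^sup>2 * (norm x)\<^sup>2"
      by (metis norm_ge_zero power_mono power_mult_distrib)
    then have 1: "c\<^sup>2 * (norm ?y)\<^sup>2 \<le> c\<^sup>2 * (K\<^sup>2 * (norm x)\<^sup>2)" by (simp add: mult_left_mono)
    have 2: "c * (e * (norm x)\<^sup>2) \<le> c * Im (cinner x ?y)"
      using im c unfolding imag_ge_def by simp
    have eq: "opr_apply (fam_at (1 - ?A') w) x = x + (\<i> * of_real c) *\<^sub>C ?y"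
      by (simp add: fam_at_cconst cscale_minus_left)
    have "(norm (opr_apply (fam_at (1 - ?A') w) x))\<^sup>2
        = (norm x)\<^sup>2 + c\<^sup>2 * (norm ?y)\<^sup>2 - 2 * (c * Im (cinner x ?y))"
      unfolding eq norm_add_sq using c by (simp add: cinner_cscale_right norm_mult power_mult_distrib)
    also have "\<dots> \<le> (norm x)\<^sup>2 + c\<^sup>2 * (K\<^sup>2 * (norm x)\<^sup>2) - 2 * (c * (e * (norm x)\<^sup>2))"
      using 1 2 by linarith
    also have "\<dots> = (1 - e\<^sup>2 / K\<^sup>2) * (norm x)\<^sup>2"
      using K by (simp add: c_def field_simps power2_eq_square)
    also have "\<dots> \<le> q * (norm x)\<^sup>2" by (intro mult_right_mono) (auto simp: q_def)
    finally have "sqrt ((norm (opr_apply (fam_at (1 - ?A') w) x))\<^sup>2) \<le> sqrt (q * (norm x)\<^sup>2)"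
      by (rule real_sqrt_le_mono)
    then show "norm (opr_apply (fam_at (1 - ?A') w) x) \<le> sqrt q * norm x"
      by (simp add: real_sqrt_mult)
  qed (use q in simp)
  also have "\<dots> < 1" using q by simp
  finally obtain B where B: "B \<in> R" "is_ring_inverse ?A' B"
    using neumann_inverse[of ?A'] A by (auto intro: mem_intros)
  have "is_ring_inverse A (cconst (- \<i> * of_real c) * B)"
    using B(2) unfolding is_ring_inverse_def
    by (metis cconst_commute cconst_left_commute mult.assoc)
  then show ?thesis using B(1) by (blast intro: mem_intros)
qed

text \<open>With u = B \<open>star t\<close> x, the form of t B \<open>star t\<close> at x is the
  inner product of A u with u, whose imaginary part is at most -e times the squared norm of u. Since
  x = \<open>star s\<close> A u, the norm of u controls that of x, which gives the new constant
  e/L^2.\<close>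

lemma imag_ge_neg_inverse:
  assumes e: "0 < e" and im: "imag_ge e A" and AB: "is_ring_inverse A B" and ts: "is_ring_inverse t s"
  shows "\<exists>e'>0. imag_ge e' (- (t * B * star t))"
proof -
  define L where "L = norm (star s) * norm A + 1"
  have L: "0 < L" unfolding L_def by (simp add: add_nonneg_pos)
  have "e / L\<^sup>2 * (norm x)\<^sup>2 \<le> Im (cinner x (opr_apply (fam_at (- (t * B * star t)) w) x))" for w x
  proof -
    define y where "y = opr_apply (fam_at (star t) w) x"
    define u where "u = opr_apply (fam_at B w) y"
    have y: "y = opr_apply (fam_at A w) u"
      unfolding u_def using is_ring_inverse_fam_at[OF AB] by simp
    have ts': "is_ring_inverse (star s) (star t)"
      using is_ring_inverse_star[OF ts] by (auto simp: is_ring_inverse_def)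
    have "norm x = norm (opr_apply (fam_at (star s) w) y)"
      unfolding y_def using is_ring_inverse_fam_at[OF ts'] by simp
    also have "\<dots> \<le> norm (star s) * norm y" by (rule norm_fam_apply)
    also have "\<dots> \<le> norm (star s) * (norm A * norm u)"
      unfolding y by (intro mult_left_mono norm_fam_apply norm_ge_zero)
    also have "\<dots> \<le> L * norm u" unfolding L_def by (simp add: distrib_right mult.assoc)
    finally have "(norm x)\<^sup>2 \<le> L\<^sup>2 * (norm u)\<^sup>2"
      by (metis norm_ge_zero power_mono power_mult_distrib)
    then have "e / L\<^sup>2 * (norm x)\<^sup>2 \<le> e * (norm u)\<^sup>2"
      using e L by (simp add: field_simps)
    also have "\<dots> \<le> Im (cinner u y)" using im unfolding imag_ge_def y by blast
    also have "\<dots> = - Im (cinner y u)" by (subst cinner_commute) simp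
    also have "cinner y u = cinner x (opr_apply (fam_at (t * B * star t) w) x)"
      by (simp add: y_def u_def cinner_adj)
    finally show ?thesis by simp
  qed
  then show ?thesis unfolding imag_ge_def using e L by (intro exI[of _ "e / L\<^sup>2"]) simp
qed

section \<open>The recursion for the first column of the transfer products\<close>

locale jacobi = star_algebra R for R :: "('w, 'a) fam set" +
  fixes t s :: "nat \<Rightarrow> ('w, 'a) fam"
  assumes t_mem: "n \<ge> 1 \<Longrightarrow> t n \<in> R" and s_mem: "n \<ge> 1 \<Longrightarrow> s n \<in> R"
    and ts: "n \<ge> 1 \<Longrightarrow> is_ring_inverse (t n) (s n)"
begin

definition potential :: "(nat \<Rightarrow> ('w, 'a) fam) \<Rightarrow> bool" where
  "potential V \<longleftrightarrow> (\<forall>n\<ge>1. V n \<in> R \<and> star (V n) = V n)"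

text \<open>The transfer product applied to the column (1, 0), at complex energy because the contour
  leaves the real line.\<close>

primrec col :: "(nat \<Rightarrow> ('w, 'a) fam) \<Rightarrow> complex \<Rightarrow> nat \<Rightarrow> ('w, 'a) fam \<times> ('w, 'a) fam" where
  "col V z 0 = (1, 0)"
| "col V z (Suc n) = ((cconst z - V (Suc n)) * s (Suc n) * fst (col V z n) - star (t (Suc n)) * snd (col V z n),
      s (Suc n) * fst (col V z n))"

text \<open>The derivative of \<open>col\<close> with respect to \<open>z\<close>.\<close>

primrec dcol :: "(nat \<Rightarrow> ('w, 'a) fam) \<Rightarrow> complex \<Rightarrow> nat \<Rightarrow> ('w, 'a) fam \<times> ('w, 'a) fam" where
  "dcol V z 0 = (0, 0)"
| "dcol V z (Suc n) = (s (Suc n) * fst (col V z n)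
        + (cconst z - V (Suc n)) * s (Suc n) * fst (dcol V z n) - star (t (Suc n)) * snd (dcol V z n),
      s (Suc n) * fst (dcol V z n))"

text \<open>No adjoint falls on an energy-dependent factor, so \<open>den\<close> and
  \<open>num\<close> continue the phase denominator and numerator as polynomials in
  \<open>z\<close>.\<close>

definition den :: "(nat \<Rightarrow> ('w, 'a) fam) \<Rightarrow> nat \<Rightarrow> complex \<Rightarrow> ('w, 'a) fam" where
  "den V n z = fst (col V z n) + cconst \<i> * snd (col V z n)"

definition dden :: "(nat \<Rightarrow> ('w, 'a) fam) \<Rightarrow> nat \<Rightarrow> complex \<Rightarrow> ('w, 'a) fam" where
  "dden V n z = fst (dcol V z n) + cconst \<i> * snd (dcol V z n)"

definition num :: "(nat \<Rightarrow> ('w, 'a) fam) \<Rightarrow> nat \<Rightarrow> complex \<Rightarrow> ('w, 'a) fam" where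
  "num V n z = fst (col V z n) - cconst \<i> * snd (col V z n)"

definition dnum :: "(nat \<Rightarrow> ('w, 'a) fam) \<Rightarrow> nat \<Rightarrow> complex \<Rightarrow> ('w, 'a) fam" where
  "dnum V n z = fst (dcol V z n) - cconst \<i> * snd (dcol V z n)"

lemma potential_neg: "potential V \<Longrightarrow> potential (\<lambda>n. - V n)"
  by (simp add: potential_def minus_mem star_minus)

lemma col_mem:
  assumes "potential V"
  shows "fst (col V z n) \<in> R \<and> snd (col V z n) \<in> R \<and> fst (dcol V z n) \<in> R \<and> snd (dcol V z n) \<in> R"
proof (induction n)
  case (Suc n)
  have "V (Suc n) \<in> R" "s (Suc n) \<in> R" "t (Suc n) \<in> R"
    using assms s_mem t_mem by (simp_all add: potential_def)
  with Suc show ?case by (simp add: mem_intros)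
qed (simp add: mem_intros)

lemma den_mem: "potential V \<Longrightarrow> den V n z \<in> R" "potential V \<Longrightarrow> dden V n z \<in> R"
  "potential V \<Longrightarrow> num V n z \<in> R" "potential V \<Longrightarrow> dnum V n z \<in> R"
  using col_mem[of V z n] by (simp_all add: den_def dden_def num_def dnum_def mem_intros)

text \<open>With \<open>Y = z - V + Z\<close> one has \<open>a' + Z b' = Y t\<^sup>-\<^sup>1 (a + Z' b)\<close>, where \<open>Z' = - t Y\<^sup>-\<^sup>1 t\<^sup>*\<close> again
  lies in the upper half-plane.\<close>

lemma col_combination_invertible:
  assumes V: "potential V" and z: "0 \<le> Im z"
    and "Z \<in> R" "0 < e" "imag_ge e Z"
  shows "\<exists>B\<in>R. is_ring_inverse (fst (col V z n) + Z * snd (col V z n)) B"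
  using assms(3-)
proof (induction n arbitrary: Z e)
  case 0
  show ?case by (intro bexI[of _ 1] one_mem) (simp add: is_ring_inverse_def)
next
  case (Suc n)
  let ?t = "t (Suc n)" and ?s = "s (Suc n)" and ?a = "fst (col V z n)" and ?b = "snd (col V z n)"
  define Y where "Y = cconst z - V (Suc n) + Z"
  have mem: "V (Suc n) \<in> R" "?s \<in> R" "?t \<in> R" "is_ring_inverse ?t ?s" and sa: "star (V (Suc n)) = V (Suc n)"
    using V s_mem t_mem ts by (simp_all add: potential_def)
  have Y: "Y \<in> R" unfolding Y_def by (intro mem_intros mem Suc.prems)
  have "e * (norm x)\<^sup>2 \<le> Im (cinner x (opr_apply (fam_at Y w) x))" for w x
  proof -
    have "adj (fam_at (V (Suc n)) w) = fam_at (V (Suc n)) w" using sa by (metis star.rep_eq)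
    then have "Im (cinner x (opr_apply (fam_at (V (Suc n)) w) x)) = 0"
      by (metis cinner_adj cinner_commute complex_cnj_cancel_iff complex_is_Real_iff Reals_cnj_iff)
    moreover have "Im (cinner x (opr_apply (fam_at (cconst z) w) x)) \<ge> 0"
      using z by (simp add: fam_at_cconst cinner_cscale_right cinner_self_norm)
    ultimately show ?thesis
      using Suc.prems(3) unfolding Y_def imag_ge_def
      by (simp add: cinner_add_right cinner_diff_right add_increasing)
  qed
  then have Yim: "imag_ge e Y" by (simp add: imag_ge_def)
  obtain B where B: "B \<in> R" "is_ring_inverse Y B"
    using imag_ge_invertible[OF Y Yim Suc.prems(2)] by blast
  define Z' where "Z' = - (?t * B * star ?t)"
  have "Z' \<in> R" unfolding Z'_def by (intro mem_intros mem B)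
  moreover obtain e' where "0 < e'" "imag_ge e' Z'"
    using imag_ge_neg_inverse[OF Suc.prems(2) Yim B(2) mem(4)] unfolding Z'_def by blast
  ultimately obtain C where C: "C \<in> R" "is_ring_inverse (?a + Z' * ?b) C"
    using Suc.IH by blast
  have cancel: "?s * (?t * x) = x" "Y * (B * x) = x" for x
    using mem(4) B(2) by (simp_all add: is_ring_inverse_def flip: mult.assoc)
  have "fst (col V z (Suc n)) + Z * snd (col V z (Suc n)) = Y * ?s * ?a - star ?t * ?b"
    by (simp add: Y_def algebra_simps)
  also have "\<dots> = (Y * ?s) * (?a + Z' * ?b)"
    by (simp add: Z'_def right_diff_distrib mult.assoc cancel)
  finally have eq: "fst (col V z (Suc n)) + Z * snd (col V z (Suc n)) = (Y * ?s) * (?a + Z' * ?b)" .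
  have "is_ring_inverse ?s ?t" using mem(4) by (simp add: is_ring_inverse_def)
  then have "is_ring_inverse (fst (col V z (Suc n)) + Z * snd (col V z (Suc n))) (C * (?t * B))"
    unfolding eq by (intro is_ring_inverse_mult B(2) C(2))
  then show ?case using C(1) B(1) mem by (blast intro: mult_mem)
qed

text \<open>The peeling starts at Z = i, whose imaginary part is exactly 1.\<close>

lemma den_invertible:
  assumes "potential V" "0 \<le> Im z"
  shows "\<exists>B\<in>R. is_ring_inverse (den V n z) B"
  unfolding den_def
  by (rule col_combination_invertible[OF assms cconst_mem, of 1])
     (simp_all add: imag_ge_def fam_at_cconst cinner_cscale_right cinner_self_norm)

text \<open>With J = diag(1, -1), the transfer operator at (-V, -z) is -J M J, and J fixes (1, 0).
  The \<open>dcol\<close> lines carry the further minus sign of the chain rule.\<close>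

lemma col_neg:
  "fst (col (\<lambda>n. - V n) (- z) n) = (- 1) ^ n * fst (col V z n)
   \<and> snd (col (\<lambda>n. - V n) (- z) n) = - ((- 1) ^ n * snd (col V z n))
   \<and> fst (dcol (\<lambda>n. - V n) (- z) n) = - ((- 1) ^ n * fst (dcol V z n))
   \<and> snd (dcol (\<lambda>n. - V n) (- z) n) = (- 1) ^ n * snd (dcol V z n)"
proof (induction n)
  case (Suc n)
  from neg_one_power_cases[of n, where 'r = "('w, 'a) fam"] show ?case
    using Suc by (elim disjE) (simp_all add: cconst_minus algebra_simps)
qed simp

lemma num_eq_den_neg: "num V n z = (- 1) ^ n * den (\<lambda>n. - V n) n (- z)"
  and dnum_eq_dden_neg: "dnum V n z = - ((- 1) ^ n * dden (\<lambda>n. - V n) n (- z))"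
proof -
  from neg_one_power_cases[of n, where 'r = "('w, 'a) fam"] show "num V n z = (- 1) ^ n * den (\<lambda>n. - V n) n (- z)"
    "dnum V n z = - ((- 1) ^ n * dden (\<lambda>n. - V n) n (- z))"
    unfolding num_def dnum_def den_def dden_def using col_neg[of V z n] by auto
qed

text \<open>Reflection maps the lower half-plane to the upper one; on the real axis numerator and
  denominator are both invertible.\<close>

lemma num_invertible:
  assumes "potential V" "Im z \<le> 0"
  shows "\<exists>B\<in>R. is_ring_inverse (num V n z) B"
proof -
  obtain B where B: "B \<in> R" "is_ring_inverse (den (\<lambda>n. - V n) n (- z)) B"
    using den_invertible[OF potential_neg[OF assms(1)], of "- z" n] assms(2) by auto
  from neg_one_power_cases[of n, where 'r = "('w, 'a) fam"] have "is_ring_inverse (num V n z) ((- 1) ^ n * B)"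
    using B(2) unfolding num_eq_den_neg by (auto simp: is_ring_inverse_def)
  then show ?thesis using B(1) by (blast intro: mem_intros power_mem)
qed

text \<open>At real energy the transfer operators preserve the form
  \<open>star a * b - star b * a\<close>, and it vanishes on (1, 0).\<close>

lemma col_symplectic:
  assumes V: "potential V" and z: "cnj z = z"
  shows "star (fst (col V z n)) * snd (col V z n) = star (snd (col V z n)) * fst (col V z n)"
proof (induction n)
  case 0
  show ?case by (simp add: star_zero)
next
  case (Suc n)
  let ?t = "t (Suc n)" and ?s = "s (Suc n)" and ?a = "fst (col V z n)" and ?b = "snd (col V z n)"
  have sa: "star (V (Suc n)) = V (Suc n)" and ts: "is_ring_inverse ?t ?s"
    using V ts by (simp_all add: potential_def)
  have "?t * (?s * x) = x" "star ?s * (star ?t * x) = x" for x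
    using ts is_ring_inverse_star[OF ts] by (simp_all add: is_ring_inverse_def flip: mult.assoc)
  then show ?case using Suc
    by (simp add: star_diff star_mult sa star_cconst z left_diff_distrib right_diff_distrib mult.assoc)
qed

text \<open>A Christoffel-Darboux identity: each step preserves the form up to the energy derivative
  of the transfer operator, which sits only in its upper left entry and adds
  \<open>star b * b\<close> for the new \<open>b\<close>.\<close>

lemma col_velocity:
  assumes V: "potential V" and z: "cnj z = z"
  shows "star (snd (col V z n)) * fst (dcol V z n) - star (fst (col V z n)) * snd (dcol V z n)
    = (\<Sum>k=1..n. star (snd (col V z k)) * snd (col V z k))"
proof (induction n)
  case (Suc n)
  let ?t = "t (Suc n)" and ?s = "s (Suc n)"
  have sa: "star (V (Suc n)) = V (Suc n)" and ts: "is_ring_inverse ?t ?s"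
    using V ts by (simp_all add: potential_def)
  have "?t * (?s * x) = x" "star ?s * (star ?t * x) = x" for x
    using ts is_ring_inverse_star[OF ts] by (simp_all add: is_ring_inverse_def flip: mult.assoc)
  then show ?case unfolding sum.cl_ivl_Suc Suc.IH[symmetric]
    by (simp add: star_diff star_mult sa star_cconst z left_diff_distrib right_diff_distrib
        distrib_left mult.assoc)
qed simp

lemma star_i_mult: "star (cconst \<i> * A) = - (cconst \<i> * star A)"
  by (simp add: star_mult star_cconst cconst_minus cconst_commute[of "star A"])

lemma i_i_mult: "cconst \<i> * (cconst \<i> * A) = - A"
  by (simp add: cconst_minus flip: mult.assoc cconst_mult)

text \<open>Both sides are \<open>star a * a + star b * b\<close> plus cross terms, and these cancel
  by \<open>col_symplectic\<close>. With invertibility this makes the phase unitary.\<close>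

lemma num_den_norm:
  assumes "potential V" "cnj z = z"
  shows "star (num V n z) * num V n z = star (den V n z) * den V n z"
  using col_symplectic[OF assms, of n]
  by (simp add: num_def den_def star_diff star_add star_i_mult i_i_mult mult.assoc
      left_diff_distrib right_diff_distrib distrib_left distrib_right
      cconst_left_commute[of "star (fst (col V z n))"] cconst_left_commute[of "star (snd (col V z n))"])

text \<open>The diagonal terms cancel in the difference and the cross terms double, whence the
  factor 2i.\<close>

lemma num_den_velocity:
  assumes "potential V" "cnj z = z"
  shows "star (num V n z) * dnum V n z - star (den V n z) * dden V n z
    = cconst (2 * \<i>) * (\<Sum>k=1..n. star (snd (col V z k)) * snd (col V z k))"
proof -
  have two: "cconst (2 * \<i>) * A = cconst \<i> * A + cconst \<i> * A" for A :: "('w, 'a) fam"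
    by (simp only: mult_2 cconst_add distrib_right)
  show ?thesis
    unfolding col_velocity[OF assms, symmetric] two
    by (simp add: num_def den_def dnum_def dden_def star_diff star_add star_i_mult i_i_mult mult.assoc
        left_diff_distrib right_diff_distrib distrib_left distrib_right
        cconst_left_commute[of "star (fst (col V z n))"] cconst_left_commute[of "star (snd (col V z n))"])
qed

end

section \<open>Derivatives, polynomials and contour integration\<close>

lemma norm_mult3_le: "norm (a * b * c :: 'r::real_normed_algebra) \<le> norm a * norm b * norm c"
  by (meson mult_right_mono norm_ge_zero norm_mult_ineq order_trans)

text \<open>Everything rests on the resolvent identity \<open>diff\<close>. The set \<open>S\<close>
  is arbitrary because the inverse will be differentiated up to the boundary of a
  half-plane.\<close>

lemma has_derivative_ring_inverse:
  fixes F :: "'b::real_normed_vector \<Rightarrow> 'r::real_normed_algebra_1"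
  assumes inv: "\<And>y. y \<in> S \<Longrightarrow> is_ring_inverse (F y) (G y)" and x: "x \<in> S"
    and F: "(F has_derivative F') (at x within S)"
  shows "(G has_derivative (\<lambda>h. - (G x * F' h * G x))) (at x within S)"
proof -
  have diff: "G y - G x = - (G y * (F y - F x) * G x)" if "y \<in> S" for y
    using inv[OF that] inv[OF x] by (simp add: is_ring_inverse_def algebra_simps)
  have Fc: "((\<lambda>y. F y - F x) \<longlongrightarrow> 0) (at x within S)"
    using has_derivative_continuous[OF F] by (intro LIM_zero) (simp add: continuous_within)
  have ev: "\<forall>\<^sub>F y in at x within S. y \<in> S" by (simp add: eventually_at_filter)
  \<comment> \<open>Continuity of \<open>G\<close> is not given. Near \<open>x\<close> the resolvent
    identity lets half of the norm of \<open>G y\<close> be absorbed, which gives a local bound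
    first.\<close>
  have bound: "norm (G y) \<le> 2 * norm (G x)"
    if "y \<in> S" "norm (F y - F x) * norm (G x) < 1 / 2" for y
  proof -
    have "norm (G y - G x) \<le> norm (G y) * (norm (F y - F x) * norm (G x))"
      using norm_mult3_le[of "G y" "F y - F x" "G x"] unfolding diff[OF that(1)] by (simp add: mult.assoc)
    also have "\<dots> \<le> norm (G y) * (1 / 2)" using that(2) by (intro mult_left_mono) auto
    finally show ?thesis using norm_triangle_ineq2[of "G y" "G x"] by simp
  qed
  have "((\<lambda>y. norm (F y - F x) * norm (G x)) \<longlongrightarrow> 0) (at x within S)"
    by (intro tendsto_mult_left_zero tendsto_norm_zero Fc)
  then have "\<forall>\<^sub>F y in at x within S. norm (F y - F x) * norm (G x) < 1 / 2"
    by (rule order_tendstoD) simp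
  with ev have ev': "\<forall>\<^sub>F y in at x within S. y \<in> S \<and> norm (G y) \<le> 2 * norm (G x)"
    by eventually_elim (simp add: bound)
  have "((\<lambda>y. G y - G x) \<longlongrightarrow> 0) (at x within S)"
  proof (rule Lim_null_comparison)
    show "((\<lambda>y. 2 * norm (G x) * norm (F y - F x) * norm (G x)) \<longlongrightarrow> 0) (at x within S)"
      by (intro tendsto_mult_left_zero tendsto_mult_right_zero tendsto_norm_zero Fc)
    show "\<forall>\<^sub>F y in at x within S. norm (G y - G x) \<le> 2 * norm (G x) * norm (F y - F x) * norm (G x)"
      using ev'
    proof eventually_elim
      case (elim y)
      have "norm (G y - G x) \<le> norm (G y) * norm (F y - F x) * norm (G x)"
        using norm_mult3_le[of "G y" "F y - F x" "G x"] elim by (simp add: diff)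
      also have "\<dots> \<le> 2 * norm (G x) * norm (F y - F x) * norm (G x)"
        using elim by (intro mult_right_mono) auto
      finally show ?case .
    qed
  qed
  then have Gc: "(G \<longlongrightarrow> G x) (at x within S)" by (rule LIM_zero_cancel)
  interpret F': bounded_linear F' using F by (rule has_derivative_bounded_linear)
  obtain K where K: "\<And>h. norm (F' h) \<le> norm h * K" using F'.bounded by blast
  define q where "q y = norm (F y - F x - F' (y - x)) / norm (y - x)" for y
  have q: "(q \<longlongrightarrow> 0) (at x within S)"
    using F unfolding q_def has_derivative_iff_norm by simp
  show ?thesis
  proof (rule has_derivativeI_sandwich[of 1])
    show "bounded_linear (\<lambda>h. - (G x * F' h * G x))"
      by (intro bounded_linear_minus bounded_linear_mult_left[THEN bounded_linear_compose]
          bounded_linear_mult_right[THEN bounded_linear_compose] F'.bounded_linear_axioms)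
    fix y assume y: "y \<in> S" "y \<noteq> x"
    have "G y - G x - - (G x * F' (y - x) * G x)
        = - (G y * (F y - F x - F' (y - x)) * G x) - (G y - G x) * F' (y - x) * G x"
    proof -
      have "- (G y * (F y - F x - F' (y - x)) * G x) = (G y - G x) + G y * F' (y - x) * G x"
        unfolding diff[OF y(1)] by (simp add: algebra_simps)
      then show ?thesis by (simp add: algebra_simps)
    qed
    also have "norm \<dots> \<le> norm (G y) * norm (F y - F x - F' (y - x)) * norm (G x)
        + norm (G y - G x) * norm (F' (y - x)) * norm (G x)"
      by (rule order_trans[OF norm_triangle_ineq4]) (simp add: add_mono norm_mult3_le)
    also have "\<dots> \<le> norm (G y) * norm (F y - F x - F' (y - x)) * norm (G x)
        + norm (G y - G x) * (norm (y - x) * K) * norm (G x)"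
      by (intro add_left_mono mult_right_mono mult_left_mono K norm_ge_zero)
    also have "\<dots> = (norm (G y) * q y * norm (G x) + norm (G y - G x) * K * norm (G x)) * norm (y - x)"
      using y(2) by (simp add: q_def field_simps)
    finally show "norm (G y - G x - - (G x * F' (y - x) * G x)) / norm (y - x)
        \<le> norm (G y) * q y * norm (G x) + norm (G y - G x) * K * norm (G x)"
      using y(2) by (simp add: divide_le_eq)
  next
    have "((\<lambda>y. norm (G y) * q y * norm (G x) + norm (G y - G x) * K * norm (G x)) \<longlongrightarrow>
        norm (G x) * 0 * norm (G x) + norm (G x - G x) * K * norm (G x)) (at x within S)"
      by (intro tendsto_intros Gc q)
    then show "((\<lambda>y. norm (G y) * q y * norm (G x) + norm (G y - G x) * K * norm (G x)) \<longlongrightarrow> 0) (at x within S)"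
      by simp
  qed simp
qed

text \<open>By Cauchy the segment integral is minus the arc integral. On the arc \<open>f\<close> is
  c/z up to C/r^2: the main term gives i pi c and the error is at most C pi / r.\<close>

lemma semicircle_integral:
  assumes hol: "f holomorphic_on {z. 0 \<le> Im z}"
    and bound: "\<And>z. 0 \<le> Im z \<Longrightarrow> K \<le> cmod z \<Longrightarrow> cmod (z * f z - c) \<le> C / cmod z"
  shows "((\<lambda>r. integral {- r..r} (\<lambda>x. f (of_real x))) \<longlongrightarrow> - (\<i> * pi * c)) at_top"
proof -
  let ?H = "{z. 0 \<le> Im z}"
  have est: "cmod (integral {- r..r} (\<lambda>x. f (of_real x)) - (- (\<i> * pi * c))) \<le> C * pi / r"
    if r: "r \<ge> max K 1" for r
  proof -
    let ?l = "linepath (- of_real r) (of_real r :: complex)" and ?p = "part_circlepath 0 r 0 pi"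
    have r0: "0 < r" using r by simp
    have pl: "path_image ?l \<subseteq> ?H"
      by (auto simp: linepath_def path_image_def)
    have pc: "0 \<le> Im z" "cmod z = r" if z: "z \<in> path_image ?p" for z
    proof -
      obtain u where "0 \<le> u" "u \<le> pi" "z = r * cis u"
        using z by (auto simp: path_image_part_circlepath' closed_segment_eq_real_ivl)
      then show "0 \<le> Im z" "cmod z = r" using r0 by (simp_all add: norm_mult sin_ge_zero)
    qed
    have cont: "continuous_on ?H f" using hol by (rule holomorphic_on_imp_continuous_on)
    \<comment> \<open>The closed half-plane is convex and \<open>f\<close> is holomorphic within it,
      so the contour may run along its boundary.\<close>
    have "(f has_contour_integral 0) (?l +++ ?p)"
    proof (rule Cauchy_theorem_convex_simple[OF hol])
      show "convex ?H" by (rule convex_halfspace_Im_ge)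
      show "path_image (?l +++ ?p) \<subseteq> ?H"
        using pl pc by (intro subset_path_image_join) auto
    qed (auto simp: cis_conv_exp[symmetric])
    then have "contour_integral (?l +++ ?p) f = 0" by (rule contour_integral_unique)
    moreover have fl: "f contour_integrable_on ?l"
      by (intro contour_integrable_continuous_linepath continuous_on_subset[OF cont])
         (use pl in \<open>simp add: path_image_linepath\<close>)
    moreover have fp: "f contour_integrable_on ?p"
      by (intro contour_integrable_continuous_part_circlepath continuous_on_subset[OF cont]) (use pc in auto)
    ultimately have "contour_integral ?l f = - contour_integral ?p f"
      by (simp add: add_eq_0_iff2)
    moreover have "contour_integral ?l f = integral {- r..r} (\<lambda>x. f (of_real x))"
      using contour_integral_linepath_Reals_eq[of "- of_real r" "of_real r" f] r0 by simp
    moreover have inv: "(\<lambda>z. c / z) contour_integrable_on ?p"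
    proof (intro contour_integrable_continuous_part_circlepath continuous_intros ballI)
      fix z assume "z \<in> path_image ?p"
      from pc(2)[OF this] show "z \<noteq> 0" using r0 by auto
    qed
    moreover have "contour_integral ?p (\<lambda>z. c / z) = \<i> * pi * c"
      using r0 by (simp add: contour_integral_part_circlepath_eq scaleR_conv_of_real)
    moreover have "cmod (contour_integral ?p (\<lambda>z. f z - c / z)) \<le> C / r\<^sup>2 * r * \<bar>pi - 0\<bar>"
    proof (rule contour_integral_bound_part_circlepath)
      have pt: "cmod (f z - c / z) \<le> C / r\<^sup>2" if z: "0 \<le> Im z" "cmod z = r" for z
      proof -
        have "cmod (f z - c / z) = cmod (z * f z - c) / r"
        proof -
          have "z \<noteq> 0" using z r0 by auto
          then have "f z - c / z = (z * f z - c) / z" by (simp add: field_simps)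
          then show ?thesis using z by (simp add: norm_divide)
        qed
        also have "\<dots> \<le> C / r / r"
          using bound[of z] z r r0 by (intro divide_right_mono) auto
        finally show ?thesis by (simp add: power2_eq_square)
      qed
      then show "cmod (f z - c / z) \<le> C / r\<^sup>2" if "z \<in> path_image ?p" for z
        using pc[OF that] by blast
      \<comment> \<open>No sign of \<open>C\<close> is assumed; the estimate at the point
        \<open>r\<close> forces it.\<close>
      show "0 \<le> C / r\<^sup>2"
        by (rule order_trans[OF norm_ge_zero pt[of "of_real r"]]) (use r0 in auto)
    qed (use r0 fp inv in \<open>auto intro: contour_integrable_diff\<close>)
    ultimately show ?thesis
      using r0 by (simp add: contour_integral_diff[OF fp inv] norm_minus_commute power2_eq_square)
  qed
  have "((\<lambda>r. C * pi / r) \<longlongrightarrow> 0) at_top"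
    by (intro tendsto_divide_0[OF tendsto_const] filterlim_at_top_imp_at_infinity filterlim_ident)
  then show ?thesis
    by (rule LIM_zero_cancel[OF Lim_null_comparison[rotated]])
       (rule eventually_at_top_linorderI[of "max K 1"], rule est)
qed

section \<open>Polynomials with operator coefficients\<close>

context star_algebra
begin

text \<open>Coefficients, values and derivative travel together, so one induction yields all three.
  Vanishing beyond \<open>n\<close> allows the degree bound to be raised; in the derivative the term
  k = 0 has exponent 0 - 1 = 0 but factor 0.\<close>

definition is_poly ::
  "nat \<Rightarrow> (nat \<Rightarrow> ('w, 'a) fam) \<Rightarrow> (complex \<Rightarrow> ('w, 'a) fam) \<Rightarrow> (complex \<Rightarrow> ('w, 'a) fam) \<Rightarrow> bool" where
  "is_poly n c F F' \<longleftrightarrow> (\<forall>k. c k \<in> R) \<and> (\<forall>k>n. c k = 0)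
    \<and> (\<forall>z. F z = (\<Sum>k\<le>n. cconst (z ^ k) * c k))
    \<and> (\<forall>z. F' z = (\<Sum>k\<le>n. cconst (of_nat k * z ^ (k - 1)) * c k))"

lemma is_poly_Suc: "is_poly n c F F' \<Longrightarrow> is_poly (Suc n) c F F'"
  by (simp add: is_poly_def)

lemma is_poly_mult_left:
  "A \<in> R \<Longrightarrow> is_poly n c F F' \<Longrightarrow> is_poly n (\<lambda>k. A * c k) (\<lambda>z. A * F z) (\<lambda>z. A * F' z)"
  by (simp add: is_poly_def mult_mem sum_distrib_left cconst_left_commute)

lemma is_poly_add:
  "is_poly n c F F' \<Longrightarrow> is_poly n d G G' \<Longrightarrow>
    is_poly n (\<lambda>k. c k + d k) (\<lambda>z. F z + G z) (\<lambda>z. F' z + G' z)"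
  by (simp add: is_poly_def add_mem sum.distrib distrib_left)

lemma is_poly_diff:
  "is_poly n c F F' \<Longrightarrow> is_poly n d G G' \<Longrightarrow>
    is_poly n (\<lambda>k. c k - d k) (\<lambda>z. F z - G z) (\<lambda>z. F' z - G' z)"
  by (simp add: is_poly_def diff_mem sum_subtractf right_diff_distrib)

lemma is_poly_shift:
  assumes "is_poly n c F F'"
  shows "is_poly (Suc n) (\<lambda>k. if k = 0 then 0 else c (k - 1))
      (\<lambda>z. cconst z * F z) (\<lambda>z. F z + cconst z * F' z)"
proof -
  have "cconst (of_nat (Suc k) * z ^ k) * c k
      = cconst (z ^ k) * c k + cconst z * (cconst (of_nat k * z ^ (k - 1)) * c k)" for k z
  proof -
    have eq: "of_nat (Suc k) * z ^ k = z ^ k + z * (of_nat k * z ^ (k - 1))"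
      by (cases k) (simp_all add: algebra_simps)
    show ?thesis by (simp only: eq cconst_add cconst_mult distrib_right mult.assoc)
  qed
  then show ?thesis
    using assms unfolding is_poly_def sum.atMost_Suc_shift
    by (auto simp: zero_mem sum_distrib_left sum.distrib cconst_mult mult.assoc)
qed

end

text \<open>The target is only a real normed space, so complex differentiability is expressed by a
  derivative of the form \<open>cconst h * W\<close>.\<close>

lemma has_derivative_cconst_sum:
  fixes c :: "nat \<Rightarrow> ('w, 'a) fam"
  assumes p: "\<And>k. (p k has_field_derivative p' k) (at z within S)"
  shows "((\<lambda>z. \<Sum>k\<le>n. cconst (p k z) * c k) has_derivative
      (\<lambda>h. cconst h * (\<Sum>k\<le>n. cconst (p' k) * c k))) (at z within S)"
proof -
  have "((\<lambda>z. cconst (p k z) * c k) has_derivative (\<lambda>h. cconst (p' k * h) * c k)) (at z within S)"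
    for k
    by (intro has_derivative_mult_left bounded_linear.has_derivative[OF bounded_linear_cconst]
        p[unfolded has_field_derivative_def])
  then have "((\<lambda>z. \<Sum>k\<le>n. cconst (p k z) * c k) has_derivative
      (\<lambda>h. \<Sum>k\<le>n. cconst (p' k * h) * c k)) (at z within S)"
    by (intro has_derivative_sum)
  then show ?thesis
    by (simp add: sum_distrib_left mult.commute[of _ "_ :: complex"] cconst_mult mult.assoc)
qed

context star_algebra
begin

lemma is_poly_has_derivative:
  assumes "is_poly n c F F'"
  shows "(F has_derivative (\<lambda>h. cconst h * F' z)) (at z within S)"
proof -
  have F: "F = (\<lambda>z. \<Sum>k\<le>n. cconst (z ^ k) * c k)" and F': "F' z = (\<Sum>k\<le>n. cconst (of_nat k * z ^ (k - 1)) * c k)"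
    using assms unfolding is_poly_def by auto
  show ?thesis unfolding F F'
    by (rule has_derivative_cconst_sum) (auto intro!: derivative_eq_intros)
qed

lemma is_poly_has_derivative2:
  assumes "is_poly n c F F'"
  shows "\<exists>W\<in>R. (F' has_derivative (\<lambda>h. cconst h * W)) (at z within S)"
proof
  have F': "F' = (\<lambda>z. \<Sum>k\<le>n. cconst (of_nat k * z ^ (k - 1)) * c k)" and c: "\<And>k. c k \<in> R"
    using assms unfolding is_poly_def by auto
  show "(F' has_derivative (\<lambda>h. cconst h *
      (\<Sum>k\<le>n. cconst (of_nat k * (of_nat (k - 1) * z ^ (k - 1 - 1))) * c k))) (at z within S)"
    unfolding F' by (rule has_derivative_cconst_sum) (auto intro!: derivative_eq_intros)
  show "(\<Sum>k\<le>n. cconst (of_nat k * (of_nat (k - 1) * z ^ (k - 1 - 1))) * c k) \<in> R"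
    by (intro sum_mem mult_mem cconst_mem c)
qed

text \<open>Since F G = 1, the difference is (z F' - n F) G. The leading terms cancel in the first
  factor, while invertibility of the leading coefficient keeps z^n G bounded.\<close>

lemma is_poly_log_derivative_bound:
  assumes poly: "is_poly n c F F'" and M: "is_ring_inverse (c n) M"
  shows "\<exists>C K. \<forall>z G. is_ring_inverse (F z) G \<longrightarrow> K \<le> cmod z \<longrightarrow>
    norm (cconst z * (F' z * G) - of_nat n) \<le> C / cmod z"
proof -
  define B where "B = (\<Sum>k<n. norm (c k))"
  have B: "0 \<le> B" unfolding B_def by (simp add: sum_nonneg)
  have "norm (cconst z * (F' z * G) - of_nat n) \<le> 2 * of_nat n * B * norm M / cmod z"
    \<comment> \<open>The threshold ensures \<open>norm M * B\<close> \<le> r/2, so the lower-order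
      part can be absorbed, and r \<ge> 1, so powers are monotone.\<close>
    if G: "is_ring_inverse (F z) G" and z: "2 * norm M * B + 1 \<le> cmod z" for z G
  proof -
    let ?r = "cmod z"
    have r1: "1 \<le> ?r" using z B by (smt (verit) mult_nonneg_nonneg norm_ge_zero)
    have pw: "?r ^ k * ?r \<le> ?r ^ n" if "k < n" for k
      using that r1 power_increasing[of "Suc k" n ?r] by (simp add: mult.commute)
    define Q where "Q = (\<Sum>k<n. cconst (z ^ k) * c k)"
    have F: "F z = cconst (z ^ n) * c n + Q"
      using poly unfolding is_poly_def Q_def by (simp add: lessThan_Suc_atMost[symmetric] add.commute)
    have "norm Q \<le> (\<Sum>k<n. ?r ^ k * norm (c k))"
      unfolding Q_def by (intro sum_norm_le order_trans[OF norm_mult_ineq]) (simp add: norm_power)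
    then have "norm Q * ?r \<le> (\<Sum>k<n. ?r ^ k * norm (c k)) * ?r" by (intro mult_right_mono) auto
    also have "\<dots> = (\<Sum>k<n. ?r ^ k * ?r * norm (c k))"
      by (simp add: sum_distrib_left sum_distrib_right mult_ac)
    also have "\<dots> \<le> (\<Sum>k<n. ?r ^ n * norm (c k))" by (intro sum_mono mult_right_mono pw) auto
    finally have Q: "norm Q * ?r \<le> ?r ^ n * B" by (simp add: B_def sum_distrib_left)
    \<comment> \<open>\<open>M\<close> on the left strips the leading coefficient and isolates z^n
      G.\<close>
    have "M * (F z * G) = cconst (z ^ n) * G + M * Q * G"
      unfolding F using M
      by (simp add: is_ring_inverse_def distrib_left distrib_right cconst_left_commute mult.assoc)
         (simp flip: mult.assoc)
    moreover have "M * (F z * G) = M" using G by (simp add: is_ring_inverse_def)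
    ultimately have "cconst (z ^ n) * G = M - M * Q * G" by (simp only: eq_diff_eq)
    moreover have "norm (cconst (z ^ n) * G) = ?r ^ n * norm G"
    proof (rule antisym)
      show "norm (cconst (z ^ n) * G) \<le> ?r ^ n * norm G"
        by (rule order_trans[OF norm_mult_ineq]) (simp add: norm_power)
      have "z \<noteq> 0" using r1 by auto
      then have "G = cconst (inverse (z ^ n)) * (cconst (z ^ n) * G)"
        by (simp flip: mult.assoc cconst_mult)
      then have "norm G \<le> inverse (?r ^ n) * norm (cconst (z ^ n) * G)"
        by (metis norm_mult_ineq norm_cconst norm_inverse norm_power)
      then show "?r ^ n * norm G \<le> norm (cconst (z ^ n) * G)"
        using \<open>z \<noteq> 0\<close> by (simp add: field_simps)
    qed
    ultimately have "?r ^ n * norm G \<le> norm M + norm (M * Q * G)"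
      by (metis norm_triangle_ineq4)
    also have "norm (M * Q * G) \<le> norm M * norm Q * norm G"
      by (meson mult_right_mono norm_ge_zero norm_mult_ineq order_trans)
    finally have "?r ^ n * norm G * ?r \<le> norm M * ?r + norm M * (norm Q * ?r) * norm G"
      using r1 mult_right_mono[of _ _ ?r] by (fastforce simp: algebra_simps)
    also have "\<dots> \<le> norm M * ?r + norm M * (?r ^ n * B) * norm G"
      by (intro add_left_mono mult_right_mono mult_left_mono Q) auto
    finally have "(?r ^ n * norm G) * (?r - norm M * B) \<le> norm M * ?r" by (simp add: algebra_simps)
    moreover have "(?r ^ n * norm G) * (?r / 2) \<le> (?r ^ n * norm G) * (?r - norm M * B)"
      using z by (intro mult_left_mono) auto
    ultimately have "(?r ^ n * norm G) * (?r / 2) \<le> norm M * ?r" by linarith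
    then have "(?r ^ n * norm G) * ?r \<le> (2 * norm M) * ?r"
      unfolding times_divide_eq_right by linarith
    then have Gn: "?r ^ n * norm G \<le> 2 * norm M"
      by (rule mult_right_le_imp_le) (use r1 in linarith)
    define D where "D = cconst z * F' z - of_nat n * F z"
    have "D = (\<Sum>k\<le>n. cconst (of_nat k - of_nat n) * (cconst (z ^ k) * c k))"
    proof -
      have 1: "z * of_nat k * z ^ (k - Suc 0) = of_nat k * z ^ k" for k by (cases k) auto
      have 2: "of_nat m = (cconst (of_nat m) :: ('w, 'a) fam)" for m
        using cconst_of_real[of "of_nat m", symmetric] by simp
      show ?thesis
        using poly unfolding D_def is_poly_def 2
        by (simp add: sum_distrib_left sum_subtractf cconst_diff left_diff_distrib
            flip: mult.assoc cconst_mult) (simp add: 1)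
    qed
    also have "\<dots> = (\<Sum>k<n. cconst (of_nat k - of_nat n) * (cconst (z ^ k) * c k))"
      by (simp add: lessThan_Suc_atMost[symmetric])
    finally have D: "D = \<dots>" .
    have "norm D \<le> (\<Sum>k<n. of_nat n * (?r ^ k * norm (c k)))"
      unfolding D
    proof (rule sum_norm_le)
      fix k assume "k \<in> {..<n}"
      then have 1: "norm (cconst (of_nat k - of_nat n) :: ('w, 'a) fam) \<le> of_nat n"
        by (simp add: norm_minus_commute[of "of_nat k"] flip: of_nat_diff)
      have 2: "norm (cconst (z ^ k) * c k) \<le> ?r ^ k * norm (c k)"
        by (rule order_trans[OF norm_mult_ineq]) (simp add: norm_power)
      show "norm (cconst (of_nat k - of_nat n) * (cconst (z ^ k) * c k)) \<le> of_nat n * (?r ^ k * norm (c k))"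
        by (rule order_trans[OF norm_mult_ineq mult_mono[OF 1 2]]) auto
    qed
    then have "norm D * ?r \<le> (\<Sum>k<n. of_nat n * (?r ^ k * norm (c k))) * ?r"
      by (intro mult_right_mono) auto
    also have "\<dots> = (\<Sum>k<n. of_nat n * (?r ^ k * ?r * norm (c k)))"
      by (simp add: sum_distrib_left sum_distrib_right mult_ac)
    also have "\<dots> \<le> (\<Sum>k<n. of_nat n * (?r ^ n * norm (c k)))"
      by (intro sum_mono mult_left_mono mult_right_mono pw) auto
    also have "\<dots> = of_nat n * (?r ^ n * B)" by (simp add: B_def sum_distrib_left)
    finally have Dn: "norm D * ?r \<le> of_nat n * (?r ^ n * B)" .
    have "cconst z * (F' z * G) - of_nat n = D * G"
      using G by (simp add: D_def is_ring_inverse_def left_diff_distrib mult.assoc)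
    then have "norm (cconst z * (F' z * G) - of_nat n) * ?r \<le> norm D * ?r * norm G"
      using mult_right_mono[OF norm_mult_ineq[of D G], of ?r] by (simp add: mult_ac)
    also have "\<dots> \<le> of_nat n * (?r ^ n * B) * norm G" by (intro mult_right_mono Dn) auto
    also have "\<dots> = of_nat n * B * (?r ^ n * norm G)" by simp
    also have "\<dots> \<le> of_nat n * B * (2 * norm M)" by (intro mult_left_mono Gn) (simp add: B)
    finally have "norm (cconst z * (F' z * G) - of_nat n) * ?r \<le> of_nat n * B * (2 * norm M)" .
    moreover have "z \<noteq> 0" using r1 by auto
    ultimately show ?thesis by (simp add: field_simps)
  qed
  then show ?thesis by blast
qed

end

context jacobi
begin

text \<open>The leading coefficient of the first entry is the product s_n ... s_1 of invertible
  factors. The second entry lags one degree behind, so it does not disturb the leading coefficient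
  of \<open>den\<close>.\<close>

lemma col_is_poly:
  assumes V: "potential V"
  shows "\<exists>\<alpha> \<beta> M. is_poly n \<alpha> (\<lambda>z. fst (col V z n)) (\<lambda>z. fst (dcol V z n))
    \<and> is_poly n \<beta> (\<lambda>z. snd (col V z n)) (\<lambda>z. snd (dcol V z n))
    \<and> is_ring_inverse (\<alpha> n) M \<and> \<beta> n = 0"
proof (induction n)
  case 0
  show ?case
    by (intro exI[of _ "\<lambda>k. if k = 0 then 1 else 0"] exI[of _ "\<lambda>_. 0"] exI[of _ 1])
       (simp add: is_poly_def is_ring_inverse_def mem_intros)
next
  case (Suc n)
  let ?t = "t (Suc n)" and ?s = "s (Suc n)" and ?V = "V (Suc n)"
  have mem: "?V \<in> R" "?s \<in> R" "star ?t \<in> R" "is_ring_inverse ?t ?s"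
    using V s_mem t_mem ts by (simp_all add: potential_def star_mem)
  obtain \<alpha> \<beta> M where \<alpha>: "is_poly n \<alpha> (\<lambda>z. fst (col V z n)) (\<lambda>z. fst (dcol V z n))"
    and \<beta>: "is_poly n \<beta> (\<lambda>z. snd (col V z n)) (\<lambda>z. snd (dcol V z n))"
    and M: "is_ring_inverse (\<alpha> n) M" and "\<beta> n = 0"
    using Suc by blast
  let ?\<alpha> = "\<lambda>k. (if k = 0 then 0 else ?s * \<alpha> (k - 1)) - ?V * (?s * \<alpha> k) - star ?t * \<beta> k"
  have s\<alpha>: "is_poly n (\<lambda>k. ?s * \<alpha> k) (\<lambda>z. ?s * fst (col V z n)) (\<lambda>z. ?s * fst (dcol V z n))"
    by (rule is_poly_mult_left[OF mem(2) \<alpha>])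
  have eq: "(\<lambda>z. fst (col V z (Suc n)))
      = (\<lambda>z. cconst z * (?s * fst (col V z n)) - ?V * (?s * fst (col V z n)) - star ?t * snd (col V z n))"
    "(\<lambda>z. fst (dcol V z (Suc n)))
      = (\<lambda>z. (?s * fst (col V z n) + cconst z * (?s * fst (dcol V z n))) - ?V * (?s * fst (dcol V z n))
        - star ?t * snd (dcol V z n))"
    by (simp_all add: left_diff_distrib mult.assoc add_diff_eq)
  have "is_poly (Suc n) ?\<alpha> (\<lambda>z. fst (col V z (Suc n))) (\<lambda>z. fst (dcol V z (Suc n)))"
    unfolding eq
    by (rule is_poly_diff[OF is_poly_diff[OF is_poly_shift[OF s\<alpha>] is_poly_mult_left[OF mem(1) is_poly_Suc[OF s\<alpha>]]]
          is_poly_mult_left[OF mem(3) is_poly_Suc[OF \<beta>]]])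
  moreover have "is_poly (Suc n) (\<lambda>k. ?s * \<alpha> k) (\<lambda>z. snd (col V z (Suc n)))
      (\<lambda>z. snd (dcol V z (Suc n)))"
    using is_poly_Suc[OF s\<alpha>] by simp
  moreover have zero: "\<alpha> (Suc n) = 0" "\<beta> (Suc n) = 0" using \<alpha> \<beta> unfolding is_poly_def by auto
  have "?\<alpha> (Suc n) = ?s * \<alpha> n" using zero by simp
  moreover have "is_ring_inverse (?s * \<alpha> n) (M * ?t)"
    by (intro is_ring_inverse_mult M) (use mem(4) in \<open>simp add: is_ring_inverse_def\<close>)
  moreover have "?s * \<alpha> (Suc n) = 0" using zero by simp
  ultimately show ?case
    by (intro exI[of _ ?\<alpha>] exI[of _ "\<lambda>k. ?s * \<alpha> k"] exI[of _ "M * ?t"] conjI) simp_all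
qed

lemma den_is_poly:
  assumes "potential V"
  shows "\<exists>c M. is_poly n c (den V n) (dden V n) \<and> is_ring_inverse (c n) M"
proof -
  obtain \<alpha> \<beta> M where "is_poly n \<alpha> (\<lambda>z. fst (col V z n)) (\<lambda>z. fst (dcol V z n))"
    and "is_poly n \<beta> (\<lambda>z. snd (col V z n)) (\<lambda>z. snd (dcol V z n))"
    and "is_ring_inverse (\<alpha> n) M" "\<beta> n = 0"
    using col_is_poly[OF assms] by blast
  then show ?thesis
    using is_poly_add[OF _ is_poly_mult_left[OF cconst_mem]]
    by (intro exI[of _ "\<lambda>k. \<alpha> k + cconst \<i> * \<beta> k"] exI[of _ M])
       (auto simp: den_def[abs_def] dden_def[abs_def])
qed

end

section \<open>The phase velocity\<close>

text \<open>The contour argument yields only symmetric limits; for a nonnegative integrand monotone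
  convergence makes the limit a true integral.\<close>

lemma has_bochner_integral_symmetric_limit:
  fixes g :: "real \<Rightarrow> real"
  assumes cont: "continuous_on UNIV g" and pos: "\<And>x. 0 \<le> g x"
    and lim: "((\<lambda>r. integral {- r..r} g) \<longlongrightarrow> I) at_top"
  shows "has_bochner_integral lborel g I"
proof (rule has_bochner_integral_monotone_convergence)
  let ?f = "\<lambda>i x. indicator {- real i..real i} x *\<^sub>R g x"
  have si: "set_integrable lborel {- real i..real i} g" for i
    by (intro borel_integrable_atLeastAtMost' continuous_on_subset[OF cont]) simp
  then show "integrable lborel (?f i)" for i by (simp add: set_integrable_def)
  have "integral\<^sup>L lborel (?f i) = integral {- real i..real i} g" for i
    using set_borel_integral_eq_integral(2)[OF si[of i]] by (simp add: set_lebesgue_integral_def)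
  then show "(\<lambda>i. integral\<^sup>L lborel (?f i)) \<longlonglongrightarrow> I"
    using filterlim_compose[OF lim filterlim_real_sequentially] by simp
  show "AE x in lborel. mono (\<lambda>i. ?f i x)"
    by (intro AE_I2 monoI) (auto simp: indicator_def pos)
  have "(\<lambda>i. ?f i x) \<longlonglongrightarrow> g x" for x
  proof (rule tendsto_eventually)
    obtain j :: nat where "\<bar>x\<bar> \<le> real j" using real_arch_simple by blast
    then show "\<forall>\<^sub>F i in sequentially. ?f i x = g x"
      by (intro eventually_sequentiallyI[of j]) (auto simp: indicator_def)
  qed
  then show "AE x in lborel. (\<lambda>i. ?f i x) \<longlonglongrightarrow> g x" by (rule AE_I2)
  show "g \<in> borel_measurable lborel"
    using borel_measurable_continuous_onI[OF cont] by simp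
qed

lemma fam_pos_semidef_star_mult: "fam_pos_semidef (star A * A)"
  unfolding fam_pos_semidef_def pos_semidef_def
  by (simp add: cinner_self_norm flip: cinner_adj)

lemma fam_pos_semidef_add: "fam_pos_semidef A \<Longrightarrow> fam_pos_semidef B \<Longrightarrow> fam_pos_semidef (A + B)"
  unfolding fam_pos_semidef_def pos_semidef_def by (simp add: cinner_add_right)

lemma fam_pos_semidef_sum: "(\<And>i. i \<in> F \<Longrightarrow> fam_pos_semidef (A i)) \<Longrightarrow> fam_pos_semidef (sum A F)"
proof (induction F rule: infinite_finite_induct)
  case (insert i F)
  then show ?case by (simp add: fam_pos_semidef_add)
qed (simp_all add: fam_pos_semidef_def pos_semidef_def)

lemma fam_pos_semidef_cconst_mult:
  "fam_pos_semidef A \<Longrightarrow> 0 \<le> r \<Longrightarrow> fam_pos_semidef (cconst (of_real r) * A)"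
  unfolding fam_pos_semidef_def pos_semidef_def by (simp add: fam_at_cconst cinner_cscale_right)

context jacobi
begin

lemma ring_inv_den:
  assumes "potential V" "0 \<le> Im z"
  shows "is_ring_inverse (den V n z) (ring_inv (den V n z))" "ring_inv (den V n z) \<in> R"
  using den_invertible[OF assms, of n] ring_inv_eq by metis+

definition phase :: "(nat \<Rightarrow> ('w, 'a) fam) \<Rightarrow> nat \<Rightarrow> real \<Rightarrow> ('w, 'a) fam" where
  "phase V n E = num V n (of_real E) * ring_inv (den V n (of_real E))"

definition dphase :: "(nat \<Rightarrow> ('w, 'a) fam) \<Rightarrow> nat \<Rightarrow> real \<Rightarrow> ('w, 'a) fam" where
  "dphase V n E = (let z = of_real E; G = ring_inv (den V n z) in
     dnum V n z * G - num V n z * G * dden V n z * G)"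

lemma num_has_derivative:
  assumes V: "potential V"
  shows "(num V n has_derivative (\<lambda>h. cconst h * dnum V n z)) (at z within S)"
proof -
  obtain \<alpha> \<beta> M where \<alpha>: "is_poly n \<alpha> (\<lambda>z. fst (col V z n)) (\<lambda>z. fst (dcol V z n))"
    and \<beta>: "is_poly n \<beta> (\<lambda>z. snd (col V z n)) (\<lambda>z. snd (dcol V z n))"
    using col_is_poly[OF V] by blast
  show ?thesis
    unfolding num_def[abs_def] dnum_def
    by (rule is_poly_has_derivative[OF is_poly_diff[OF \<alpha> is_poly_mult_left[OF cconst_mem \<beta>]]])
qed

text \<open>Inverses of \<open>den\<close> are known only on the closed upper half-plane, so the
  quotient is differentiated within it and then restricted to the real line.\<close>

lemma phase_has_vector_derivative:
  assumes V: "potential V"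
  shows "(phase V n has_vector_derivative dphase V n E) (at E)"
proof -
  let ?z = "of_real E :: complex" and ?S = "{z. 0 \<le> Im z}"
  let ?G = "\<lambda>z. ring_inv (den V n z)"
  obtain c M where c: "is_poly n c (den V n) (dden V n)" using den_is_poly[OF V] by blast
  have G: "(?G has_derivative (\<lambda>h. - (?G ?z * (cconst h * dden V n ?z) * ?G ?z))) (at ?z within ?S)"
    by (rule has_derivative_ring_inverse[OF _ _ is_poly_has_derivative[OF c]])
       (auto intro: ring_inv_den V)
  have "((\<lambda>z. num V n z * ?G z) has_derivative (\<lambda>h. num V n ?z * - (?G ?z * (cconst h * dden V n ?z) * ?G ?z)
      + cconst h * dnum V n ?z * ?G ?z)) (at ?z within ?S)"
    by (rule has_derivative_mult[OF num_has_derivative[OF V] G])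
  then have "((\<lambda>z. num V n z * ?G z) has_derivative (\<lambda>h. num V n ?z * - (?G ?z * (cconst h * dden V n ?z) * ?G ?z)
      + cconst h * dnum V n ?z * ?G ?z)) (at ?z within range of_real)"
    by (rule has_derivative_subset) auto
  then have "(phase V n has_derivative (\<lambda>h. num V n ?z * - (?G ?z * (cconst (of_real h) * dden V n ?z) * ?G ?z)
      + cconst (of_real h) * dnum V n ?z * ?G ?z)) (at E)"
    unfolding phase_def[abs_def]
    by (rule has_derivative_in_compose[OF bounded_linear.has_derivative[OF bounded_linear_of_real has_derivative_ident]])
  then show ?thesis
    unfolding has_vector_derivative_def dphase_def Let_def
    by (simp add: cconst_of_real algebra_simps flip: scaleR_conv_of_real)
qed

text \<open>By \<open>num_den_norm\<close> the factor \<open>star num * num\<close> in the second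
  term becomes \<open>star den * den\<close>, and \<open>den\<close> cancels its inverse;
  \<open>num_den_velocity\<close> remains, conjugated by that inverse.\<close>

lemma star_phase_mult_dphase:
  assumes V: "potential V"
  shows "star (phase V n E) * dphase V n E
    = cconst (2 * \<i>) * (\<Sum>k=1..n. star (snd (col V (of_real E) k) * ring_inv (den V n (of_real E)))
        * (snd (col V (of_real E) k) * ring_inv (den V n (of_real E))))"
proof -
  let ?z = "of_real E :: complex"
  let ?u = "num V n ?z" and ?v = "den V n ?z" and ?du = "dnum V n ?z" and ?dv = "dden V n ?z"
  define G where "G = ring_inv ?v"
  have z: "cnj ?z = ?z" by simp
  have G: "is_ring_inverse ?v G" unfolding G_def by (rule ring_inv_den[OF V]) simp
  have uv: "star ?u * (?u * x) = star ?v * (?v * x)" for x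
    using num_den_norm[OF V z, of n] by (simp flip: mult.assoc)
  have vG: "?v * (G * x) = x" for x using G by (simp add: is_ring_inverse_def flip: mult.assoc)
  have "star (?u * G) * (?du * G - ?u * G * ?dv * G) = star G * (star ?u * ?du - star ?v * ?dv) * G"
    by (simp add: star_mult right_diff_distrib left_diff_distrib mult.assoc uv vG)
  also have "\<dots> = cconst (2 * \<i>) * (\<Sum>k=1..n. star (snd (col V ?z k) * G) * (snd (col V ?z k) * G))"
    unfolding num_den_velocity[OF V z]
    by (simp add: star_mult sum_distrib_left sum_distrib_right mult.assoc cconst_left_commute[of "star G"])
  finally show ?thesis unfolding phase_def dphase_def Let_def G_def .
qed

definition velocity :: "(nat \<Rightarrow> ('w, 'a) fam) \<Rightarrow> nat \<Rightarrow> real \<Rightarrow> ('w, 'a) fam" where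
  "velocity V n E = cscale_fam (1 / (\<i> * of_nat n)) (star (phase V n E) * dphase V n E)"

lemma velocity_mem:
  assumes V: "potential V"
  shows "velocity V n E \<in> R"
proof -
  have "0 \<le> Im (of_real E)" by simp
  note G = ring_inv_den(2)[OF V this]
  show ?thesis
    unfolding velocity_def phase_def dphase_def Let_def by (intro mem_intros den_mem V G)
qed

lemma velocity_pos:
  assumes V: "potential V"
  shows "fam_pos_semidef (velocity V n E)"
proof -
  \<comment> \<open>For n = 0 both sides are 0 by the convention for division.\<close>
  have "1 / (\<i> * of_nat n) * (2 * \<i>) = of_real (2 / real n)" by simp
  then have "cconst (1 / (\<i> * of_nat n)) * (cconst (2 * \<i>) * A) = cconst (of_real (2 / real n)) * A"
    for A :: "('w, 'a) fam"
    by (metis cconst_mult mult.assoc)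
  then show ?thesis
    unfolding velocity_def cscale_fam_eq star_phase_mult_dphase[OF V]
    by (simp only:) (intro fam_pos_semidef_cconst_mult fam_pos_semidef_sum fam_pos_semidef_star_mult, simp)
qed

end

section \<open>The trace of the velocity and its integral\<close>

locale tracial_jacobi = jacobi R t s for R :: "('w, 'a) fam set" and t s +
  fixes tr :: "('w, 'a) fam \<Rightarrow> complex"
  assumes tr_add: "A \<in> R \<Longrightarrow> B \<in> R \<Longrightarrow> tr (A + B) = tr A + tr B"
    and tr_cscale: "tr (cscale_fam c A) = c * tr A"
    and norm_tr_le: "cmod (tr A) \<le> norm A"
    and tr_one: "tr 1 = 1"
    and tr_cyclic: "A \<in> R \<Longrightarrow> B \<in> R \<Longrightarrow> tr (A * B) = tr (B * A)"
    and tr_pos: "fam_pos_semidef A \<Longrightarrow> tr A \<in> \<real>" "fam_pos_semidef A \<Longrightarrow> 0 \<le> Re (tr A)"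
begin

lemma tr_cconst_mult: "tr (cconst c * A) = c * tr A"
  using tr_cscale[of c A] by (simp add: cscale_fam_eq)

lemma tr_minus: "tr (- A) = - tr A"
  using tr_cconst_mult[of "- 1" A] by (simp add: cconst_minus)

lemma tr_diff: "A \<in> R \<Longrightarrow> B \<in> R \<Longrightarrow> tr (A - B) = tr A - tr B"
  using tr_add[of A "- B"] by (simp add: minus_mem tr_minus)

text \<open>Additivity of \<open>tr\<close> is known only on \<open>R\<close>, so no bounded linear
  map on the whole type is available; the remainder is estimated directly through
  \<open>norm_tr_le\<close>.\<close>

lemma tr_has_field_derivative:
  assumes g: "(g has_derivative (\<lambda>h. cconst h * W)) (at x within S)"
    and mem: "\<And>z. z \<in> S \<Longrightarrow> g z \<in> R" "x \<in> S" "W \<in> R"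
  shows "((\<lambda>z. tr (g z)) has_field_derivative tr W) (at x within S)"
  unfolding has_field_derivative_def
proof (rule has_derivativeI_sandwich[of 1])
  show "bounded_linear ((*) (tr W))" by (rule bounded_linear_mult_right)
  show "((\<lambda>y. norm (g y - g x - cconst (y - x) * W) / norm (y - x)) \<longlongrightarrow> 0) (at x within S)"
    using g by (simp add: has_derivative_iff_norm)
  fix y assume y: "y \<in> S"
  have "tr (g y - g x - cconst (y - x) * W) = tr (g y) - tr (g x) - tr W * (y - x)"
    using mem y by (simp add: tr_diff tr_cconst_mult mem_intros)
  then show "norm (tr (g y) - tr (g x) - tr W * (y - x)) / norm (y - x)
      \<le> norm (g y - g x - cconst (y - x) * W) / norm (y - x)"
    using norm_tr_le[of "g y - g x - cconst (y - x) * W"] by (intro divide_right_mono) auto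
qed simp

text \<open>Stands in for the derivative of log det \<open>den\<close>.\<close>

definition log_deriv :: "(nat \<Rightarrow> ('w, 'a) fam) \<Rightarrow> nat \<Rightarrow> complex \<Rightarrow> complex" where
  "log_deriv V n z = tr (dden V n z * ring_inv (den V n z))"

lemma log_deriv_holomorphic:
  assumes V: "potential V"
  shows "log_deriv V n holomorphic_on {z. 0 \<le> Im z}"
  unfolding holomorphic_on_def
proof
  let ?S = "{z. 0 \<le> Im z}" and ?G = "\<lambda>z. ring_inv (den V n z)"
  fix x assume x: "x \<in> ?S"
  obtain c M where c: "is_poly n c (den V n) (dden V n)" using den_is_poly[OF V] by blast
  obtain W where W: "W \<in> R" "(dden V n has_derivative (\<lambda>h. cconst h * W)) (at x within ?S)"
    using is_poly_has_derivative2[OF c] by blast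
  have G: "(?G has_derivative (\<lambda>h. - (?G x * (cconst h * dden V n x) * ?G x))) (at x within ?S)"
    by (rule has_derivative_ring_inverse[OF _ x is_poly_has_derivative[OF c]])
       (auto intro: ring_inv_den V)
  have "((\<lambda>z. dden V n z * ?G z) has_derivative
      (\<lambda>h. dden V n x * - (?G x * (cconst h * dden V n x) * ?G x) + cconst h * W * ?G x)) (at x within ?S)"
    by (rule has_derivative_mult[OF W(2) G])
  \<comment> \<open>Pulling the central scalar to the front exhibits the real derivative as
    complex-linear.\<close>
  also have "(\<lambda>h. dden V n x * - (?G x * (cconst h * dden V n x) * ?G x) + cconst h * W * ?G x)
      = (\<lambda>h. cconst h * (W * ?G x - dden V n x * (?G x * (dden V n x * ?G x))))"
    by (simp add: right_diff_distrib mult.assoc cconst_left_commute[of "?G x"] cconst_left_commute[of "dden V n x"])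
  finally have "((\<lambda>z. tr (dden V n z * ?G z)) has_field_derivative
      tr (W * ?G x - dden V n x * (?G x * (dden V n x * ?G x)))) (at x within ?S)"
    by (rule tr_has_field_derivative) (use x in \<open>auto intro!: mem_intros den_mem V W ring_inv_den\<close>)
  then show "log_deriv V n field_differentiable at x within ?S"
    unfolding log_deriv_def[abs_def] field_differentiable_def by blast
qed

lemma log_deriv_integral:
  assumes V: "potential V"
  shows "((\<lambda>r. integral {- r..r} (\<lambda>x. log_deriv V n (of_real x))) \<longlongrightarrow> - (\<i> * pi * of_nat n)) at_top"
proof -
  obtain c M where c: "is_poly n c (den V n) (dden V n)" "is_ring_inverse (c n) M"
    using den_is_poly[OF V] by blast
  obtain C K where CK: "\<And>z G. is_ring_inverse (den V n z) G \<Longrightarrow> K \<le> cmod z \<Longrightarrow>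
      norm (cconst z * (dden V n z * G) - of_nat n) \<le> C / cmod z"
    using is_poly_log_derivative_bound[OF c] by blast
  have nat: "of_nat n = (cconst (of_nat n) * 1 :: ('w, 'a) fam)"
    using cconst_of_real[of "of_nat n", symmetric] by simp
  show ?thesis
  proof (rule semicircle_integral[OF log_deriv_holomorphic[OF V]])
    fix z assume z: "0 \<le> Im z" "K \<le> cmod z"
    note G = ring_inv_den[OF V z(1), of n]
    have "tr (cconst z * (dden V n z * ring_inv (den V n z)) - of_nat n) = z * log_deriv V n z - of_nat n"
      unfolding nat log_deriv_def using G(2) V
      by (subst tr_diff) (auto intro!: mem_intros den_mem simp: tr_cconst_mult tr_one simp del: mult_1_right)
    then show "cmod (z * log_deriv V n z - of_nat n) \<le> C / cmod z"
      using order_trans[OF norm_tr_le CK[OF G(1) z(2)]] by simp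
  qed
qed

text \<open>Unitarity writes the adjoint phase as den num^-1. The velocity then splits into a
  conjugate of num^-1 num' by \<open>den\<close> and the term den' den^-1; cyclicity removes the
  conjugation, and reflection rewrites the numerator.\<close>

lemma tr_velocity:
  assumes V: "potential V"
  shows "tr (velocity V n E) = 1 / (\<i> * of_nat n) *
    (- log_deriv (\<lambda>n. - V n) n (of_real (- E)) - log_deriv V n (of_real E))"
proof -
  let ?z = "of_real E :: complex"
  let ?u = "num V n ?z" and ?v = "den V n ?z" and ?du = "dnum V n ?z" and ?dv = "dden V n ?z"
  let ?v' = "den (\<lambda>n. - V n) n (- ?z)" and ?dv' = "dden (\<lambda>n. - V n) n (- ?z)"
  define G where "G = ring_inv ?v"
  define H where "H = ring_inv ?u"
  define G' where "G' = ring_inv ?v'"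
  have z: "cnj ?z = ?z" by simp
  have G: "is_ring_inverse ?v G" "G \<in> R" unfolding G_def by (rule ring_inv_den[OF V], simp)+
  have G': "is_ring_inverse ?v' G'" "G' \<in> R"
    unfolding G'_def by (rule ring_inv_den[OF potential_neg[OF V]], simp)+
  have H: "is_ring_inverse ?u H" "H \<in> R"
    using num_invertible[OF V, of ?z n] ring_inv_eq unfolding H_def by fastforce+
  have cancel: "?v * (G * x) = x" "?u * (H * x) = x" "H * (?u * x) = x" "star G * (star ?v * x) = x"
    for x
    using G H is_ring_inverse_star[OF G(1)] by (simp_all add: is_ring_inverse_def flip: mult.assoc)
  have "star G * star ?u = star G * (star ?u * ?u * H)"
    using H(1) by (simp add: is_ring_inverse_def mult.assoc)
  also have "\<dots> = ?v * H" unfolding num_den_norm[OF V z] by (simp add: mult.assoc cancel)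
  finally have "star (?u * G) = ?v * H" by (simp add: star_mult)
  then have "star (phase V n E) * dphase V n E = ?v * (H * ?du * G) - ?dv * G"
    unfolding phase_def dphase_def Let_def G_def[symmetric]
    by (simp add: right_diff_distrib mult.assoc cancel)
  moreover have mem: "?u \<in> R" "?v \<in> R" "?du \<in> R" "?dv \<in> R" by (intro den_mem V)+
  ultimately have "tr (star (phase V n E) * dphase V n E) = tr (?v * (H * ?du * G)) - log_deriv V n ?z"
    using G H by (simp add: tr_diff mem_intros log_deriv_def G_def)
  also have "tr (?v * (H * ?du * G)) = tr (H * ?du * G * ?v)"
    by (intro tr_cyclic mem_intros mem G H)
  also have "H * ?du * G * ?v = H * ?du" using G(1) by (simp add: is_ring_inverse_def mult.assoc)
  also have "tr (H * ?du) = tr (?du * H)" by (intro tr_cyclic mem_intros mem G H)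
  \<comment> \<open>The sign (-1)^n occurs in the derivative and in the inverse and cancels; the
    minus sign left over is that of the chain rule.\<close>
  also have "?du * H = - (?dv' * G')"
  proof -
    from neg_one_power_cases[of n, where 'r = "('w, 'a) fam"] show ?thesis
    proof
      assume p: "(- 1 :: ('w, 'a) fam) ^ n = 1"
      have "H = G'" unfolding H_def num_eq_den_neg p by (intro ring_inv_eq) (simp add: G')
      then show ?thesis unfolding dnum_eq_dden_neg p by simp
    next
      assume p: "(- 1 :: ('w, 'a) fam) ^ n = - 1"
      have "H = - G'" unfolding H_def num_eq_den_neg p
        by (intro ring_inv_eq) (use G'(1) in \<open>simp add: is_ring_inverse_def\<close>)
      then show ?thesis unfolding dnum_eq_dden_neg p by simp
    qed
  qed
  also have "tr (- (?dv' * G')) = - log_deriv (\<lambda>n. - V n) n (- ?z)"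
    by (simp add: tr_minus log_deriv_def G'_def)
  finally show ?thesis unfolding velocity_def tr_cscale by simp
qed

lemma tr_velocity_integral:
  assumes V: "potential V" and n: "n > 0"
  shows "has_bochner_integral lborel (\<lambda>E. tr (velocity V n E)) (of_real (2 * pi))"
proof -
  define g where "g E = Re (tr (velocity V n E))" for E
  have g: "tr (velocity V n E) = of_real (g E)" and g_pos: "0 \<le> g E" for E
    using tr_pos[OF velocity_pos[OF V]] by (auto simp: g_def complex_is_Real_iff complex_eq_iff)
  let ?f = "\<lambda>x. log_deriv V n (of_real x)" and ?f' = "\<lambda>x. log_deriv (\<lambda>n. - V n) n (of_real x)"
  have cont: "continuous_on A (\<lambda>x. log_deriv U n (of_real x))" if "potential U"
    for U and A :: "real set"
    by (rule continuous_on_compose2[OF holomorphic_on_imp_continuous_on[OF log_deriv_holomorphic[OF that]]])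
       (auto intro: continuous_intros)
  note cont_f = cont[OF V] and cont_f' = cont[OF potential_neg[OF V]]
  have cont_f'_neg: "continuous_on A (\<lambda>x. ?f' (- x))" for A
    by (rule continuous_on_compose2[OF cont_f'[of UNIV]]) (auto intro: continuous_intros)
  have cont_tr: "continuous_on A (\<lambda>E. tr (velocity V n E))" for A
    unfolding tr_velocity[OF V] by (intro continuous_intros cont_f cont_f'_neg)
  then have cont_g: "continuous_on A g" for A
    unfolding g_def[abs_def] by (intro continuous_on_Re)
  have "integral {- r..r} (\<lambda>E. tr (velocity V n E))
      = 1 / (\<i> * of_nat n) * (- integral {- r..r} ?f' - integral {- r..r} ?f)" for r
  proof -
    have "integral {- r..r} (\<lambda>E. tr (velocity V n E))
        = 1 / (\<i> * of_nat n) * integral {- r..r} (\<lambda>x. - ?f' (- x) - ?f x)"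
      unfolding tr_velocity[OF V] by (rule integral_mult_right)
    also have "integral {- r..r} (\<lambda>x. - ?f' (- x) - ?f x)
        = integral {- r..r} (\<lambda>x. - ?f' (- x)) - integral {- r..r} ?f"
      by (intro Henstock_Kurzweil_Integration.integral_diff integrable_continuous_real continuous_on_minus
          cont_f cont_f'_neg)
    \<comment> \<open>The symmetric interval is its own reflection, so the limit for the potential
      -V applies.\<close>
    also have "integral {- r..r} (\<lambda>x. - ?f' (- x)) = - integral {- r..r} ?f'"
      using Henstock_Kurzweil_Integration.integral_reflect_real[of r "- r" "?f'"] by simp
    finally show ?thesis .
  qed
  \<comment> \<open>Each logarithmic derivative contributes i pi n; divided by i n the two give 2
    pi.\<close>
  moreover have "((\<lambda>r. 1 / (\<i> * of_nat n) * (- integral {- r..r} ?f' - integral {- r..r} ?f)) \<longlongrightarrow>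
      1 / (\<i> * of_nat n) * (- (- (\<i> * pi * of_nat n)) - (- (\<i> * pi * of_nat n)))) at_top"
    by (intro tendsto_intros log_deriv_integral V potential_neg)
  ultimately have "((\<lambda>r. integral {- r..r} (\<lambda>E. tr (velocity V n E))) \<longlongrightarrow> of_real (2 * pi)) at_top"
    using n by simp
  then have "((\<lambda>r. Re (integral {- r..r} (\<lambda>E. tr (velocity V n E)))) \<longlongrightarrow> 2 * pi) at_top"
    using tendsto_Re by fastforce
  moreover have "Re (integral {- r..r} (\<lambda>E. tr (velocity V n E))) = integral {- r..r} g" for r
    using integral_linear[OF integrable_continuous_real[OF cont_tr] bounded_linear_Re, of "- r" r]
    by (simp add: g_def[abs_def] o_def)
  ultimately have "has_bochner_integral lborel g (2 * pi)"
    by (intro has_bochner_integral_symmetric_limit cont_g g_pos) simp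
  then show ?thesis unfolding g by (rule has_bochner_integral_of_real)
qed

end

theorem proposition1:
  fixes \<tau> :: "nat \<Rightarrow> 'w::topological_space \<Rightarrow> 'w"
    and P :: "'w measure"
    and T V :: "nat \<Rightarrow> ('w, 'd lattice) fam"
    and N :: nat
  assumes "compact (UNIV :: 'w set)"
    and "lattice_action CARD('d) \<tau>"
    and "prob_space P" and "sets P = sets borel"
    and "invariant_ergodic CARD('d) \<tau> P"
    and "\<And>n. n \<ge> 1 \<Longrightarrow> T n \<in> crossed_product \<tau>"
    and "\<And>n. n \<ge> 1 \<Longrightarrow> V n \<in> crossed_product \<tau>"
    and "\<And>n. n \<ge> 1 \<Longrightarrow> star (V n) = V n"
    and "\<And>n. n \<ge> 1 \<Longrightarrow> invertible_in (crossed_product \<tau>) (T n)"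
    and "bdd_above (\<Union>n\<in>{1..}. {norm (T n), norm (ring_inv (T n)), norm (V n)})"
    and "N \<ge> 2"
  shows "(\<forall>E. invertible_in (crossed_product \<tau>) (phase_denominator T V N E)
            \<and> prufer_phase T V N differentiable (at E)
            \<and> phase_velocity T V N E \<in> crossed_product \<tau>
            \<and> fam_pos_semidef (phase_velocity T V N E))
    \<and> has_bochner_integral lborel (\<lambda>E. fam_trace P (phase_velocity T V N E)) (of_real (2 * pi))"
proof -
  \<comment> \<open>The convention that the first hopping operator is the unit enters here, so that
    the recursion itself is uniform in \<open>n\<close>.\<close>
  define t where "t n = (if n = 1 then 1 else T n)" for n
  define s where "s n = ring_inv (t n)" for n
  have inv: "\<exists>b\<in>crossed_product \<tau>. is_ring_inverse (t n) b" if "n \<ge> 1" for n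
  proof (cases "n = 1")
    case True
    then show ?thesis
      by (intro bexI[of _ 1] crossed_product_one) (simp add: t_def is_ring_inverse_def)
  next
    case False
    then show ?thesis using assms(9)[OF that] by (simp add: t_def invertible_in_def)
  qed
  interpret tracial_jacobi "crossed_product \<tau>" t s "fam_trace P"
  proof
    show "t n \<in> crossed_product \<tau>" if "n \<ge> 1" for n
      using assms(6)[OF that] by (simp add: t_def crossed_product_one)
    show "s n \<in> crossed_product \<tau>" "is_ring_inverse (t n) (s n)" if "n \<ge> 1" for n
      using inv[OF that] ring_inv_eq unfolding s_def by metis+
    show "fam_trace P (A * B) = fam_trace P (B * A)"
      if "A \<in> crossed_product \<tau>" "B \<in> crossed_product \<tau>"
      for A B :: "('w, 'd lattice) fam"
      by (rule fam_trace_cyclic[OF assms(3,4,2,5) that])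
    show "fam_trace P (A + B) = fam_trace P A + fam_trace P B"
      if "A \<in> crossed_product \<tau>" "B \<in> crossed_product \<tau>"
      for A B :: "('w, 'd lattice) fam"
      by (rule fam_trace_add[OF assms(3,4) that])
  qed (rule crossed_product_one crossed_product_mult crossed_product_add crossed_product_cscale
      crossed_product_star closed_crossed_product fam_trace_cscale norm_fam_trace_le[OF assms(3)]
      fam_trace_one[OF assms(3)] fam_trace_pos; assumption?)+
  have V: "potential V" using assms(7,8) by (simp add: potential_def)
  have col: "transfer_prod T V E n *v vector [1, 0]
      = vector [fst (col V (of_real E) n), snd (col V (of_real E) n)]" for E n
  proof (induction n)
    case 0
    show ?case by simp
  next
    case (Suc n)
    have "transfer_prod T V E (Suc n) *v vector [1, 0]
        = transfer_op T V E (Suc n) *v (transfer_prod T V E n *v vector [1, 0])"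
      by (simp add: matrix_vector_mul_assoc)
    also have "\<dots> = vector [fst (col V (of_real E) (Suc n)), snd (col V (of_real E) (Suc n))]"
      unfolding Suc transfer_op_def Let_def t_def[symmetric] s_def[symmetric]
      by (simp add: vec_eq_iff forall_2 matrix_vector_mult_def sum_2 cconst_of_real mult.assoc)
    finally show ?case .
  qed
  \<comment> \<open>The adjoint of the column (1, i) is the row (1, -i), hence the minus sign in
    \<open>num\<close>.\<close>
  have num: "phase_numerator T V N E = num V N (of_real E)" for E
    unfolding phase_numerator_def col column_adj_mult_def num_def
    by (simp add: sum_2 star_cconst cconst_minus flip: cconst_def)
  have den: "phase_denominator T V N E = den V N (of_real E)" for E
    unfolding phase_denominator_def col column_adj_mult_def den_def
    by (simp add: sum_2 star_cconst flip: cconst_def)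
  have phase: "prufer_phase T V N = phase V N"
    by (simp add: fun_eq_iff prufer_phase_def phase_def num den)
  have vel: "phase_velocity T V N E = velocity V N E" for E
    unfolding phase_velocity_def velocity_def phase
    by (simp add: vector_derivative_at[OF phase_has_vector_derivative[OF V]])
  show ?thesis
  proof (intro conjI allI)
    fix E
    show "invertible_in (crossed_product \<tau>) (phase_denominator T V N E)"
      unfolding invertible_in_def den by (rule den_invertible[OF V]) simp
    show "prufer_phase T V N differentiable at E"
      unfolding phase using phase_has_vector_derivative[OF V] by (rule differentiableI_vector)
    show "phase_velocity T V N E \<in> crossed_product \<tau>"
      unfolding vel by (rule velocity_mem[OF V])
    show "fam_pos_semidef (phase_velocity T V N E)"
      unfolding vel by (rule velocity_pos[OF V])
  next
    show "has_bochner_integral lborel (\<lambda>E. fam_trace P (phase_velocity T V N E)) (of_real (2 * pi))"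
      unfolding vel using assms(11) by (intro tr_velocity_integral[OF V]) simp
  qed
qed

end
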